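(* Let $a>b>c>0$, $d>0$ and let $$Q_1=\Big\{(x,y,z,t)\in\mathbb R^4:\ \frac{x^2}{a^2}+\frac{y^2}{b^2}+\frac{z^2}{c^2}-\frac{t^2}{d^2}-1=0\Big\},$$ positively oriented by the unit normal directed by $-\nabla\big(\frac{x^2}{a^2}+\frac{y^2}{b^2}+\frac{z^2}{c^2}-\frac{t^2}{d^2}\big)$. Then the umbilic set of $Q_1$ is empty and its partially umbilic set consists of four curves $\mathcal P_{23}^1,\mathcal P_{23}^2,\mathcal P_{23}^3,\mathcal P_{23}^4$ (suitably numbered, all contained in $\mathcal P_{23}$). In the parametrization $\alpha(u,v,w)=(au,bv,cw,d\sqrt{u^2+v^2+w^2-1})$ (of the part $t\ge 0$ of $Q_1$) the partially umbilic set is given by $$\frac{a^2+d^2}{a^2-b^2}\,u^2-\frac{c^2+d^2}{b^2-c^2}\,w^2-1=0,\qquad u^2+w^2\ge 1,\qquad v=0.$$ Moreover: (i) All leaves of the principal foliation $\mathcal F_1$ are open arcs, diffeomorphic to $\mathbb R$. The partially umbilic curves $\mathcal P_{23}^i$ ($i=1,\dots,4$) are of type $D_1$, and their partially umbilic separatrix surfaces span open bands $W_1,W_2,W_3,W_4$ such that $\partial W_1=\mathcal P_{23}^1\cup\mathcal P_{23}^2$, $\partial W_2=\mathcal P_{23}^2\cup\mathcal P_{23}^3$, $\partial W_3=\mathcal P_{23}^3\cup\mathcal P_{23}^4$ and $\partial W_4=\mathcal P_{23}^1\cup\mathcal P_{23}^4$. (ii) All the leaves of the principal foliations $\mathcal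 F_2$ and $\mathcal F_3$ outside the bands $W_1,W_2,W_3,W_4$ are compact.
   Context: For an oriented hypersurface $M\subset\mathbb R^4$ with unit normal $N$, the principal curvatures $k_1\le k_2\le k_3$ are the eigenvalues of $D(-N)$ on the tangent bundle. Umbilic set: $\mathcal U=\{k_1=k_2=k_3\}$. Partially umbilic set: $\mathcal P_{12}\cup\mathcal P_{23}$, with $\mathcal P_{12}=\{k_1=k_2<k_3\}$ and $\mathcal P_{23}=\{k_1<k_2=k_3\}$. The eigenline field $\mathcal L_i$ of $k_i$ is defined off $\mathcal U\cup\mathcal P_{12}$ for $i=1$, off $\mathcal U\cup\mathcal P_{23}$ for $i=3$, and off $\mathcal U\cup\mathcal P_{12}\cup\mathcal P_{23}$ for $i=2$; $\mathcal F_i$ is the foliation of that domain by the integral curves (principal lines) of $\mathcal L_i$. Type $D_1$: let $p$ be a partially umbilic point, and $e_1,e_2,e_3$ an orthonormal basis of $T_pM$ with $e_1,e_2$ spanning the two-dimensional eigenspace (double principal curvature). Near $p$, $M=\{p+x_1e_1+x_2e_2+x_3e_3+h(x_1,x_2,x_3)N(p)\}$. After a suitable rotation of $e_1,e_2$ the third-order part of $h(x_1,x_2,0)$ is $\frac16(Ax_1^3+3Bx_1x_2^2+Cx_2^3)$. The point is of (Darbouxian) type $D_1$ if $B(B-A)\neq0$ and $\frac AB>\big(\frac{C}{2B}\big)^2+2$. A partially umbilic curve is of type $D_1$ if it is a regular curve all of whose points are of type $D_1$. Partially umbilic separatrix surface: for a partially umbilic curve $\mathcal C\subset\mathcal P_{ij}$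 and $k\in\{i,j\}$, the separatrix surface of $\mathcal F_k$ at $\mathcal C$ is the union of those leaves of $\mathcal F_k$ having a point of $\mathcal C$ as a limiting endpoint. Here the bands arise from the separatrix surfaces of both $\mathcal F_2$ and $\mathcal F_3$. An open band here is a surface diffeomorphic to $\mathbb R\times(0,1)$, and $\partial W$ denotes the topological boundary $\overline W\setminus W$ in $Q_1$. *)

theory Defs
  imports "HOL-Analysis.Analysis"
begin

section \<open>Smooth maps and diffeomorphisms between subsets of Euclidean spaces\<close>

text \<open>\<open>Ck_on k f U\<close> is meant for open \<open>U\<close>: all iterated directional derivatives of order at most
  \<open>k\<close> exist and are continuous on \<open>U\<close>.\<close>

primrec Ck_on :: "nat \<Rightarrow> ('a::euclidean_space \<Rightarrow> 'b::euclidean_space) \<Rightarrow> 'a set \<Rightarrow> bool" where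
  "Ck_on 0 f U \<longleftrightarrow> continuous_on U f"
| "Ck_on (Suc k) f U \<longleftrightarrow> (\<forall>x\<in>U. f differentiable (at x)) \<and>
     (\<forall>v. Ck_on k (\<lambda>x. frechet_derivative f (at x) v) U)"

definition smooth_on :: "('a::euclidean_space \<Rightarrow> 'b::euclidean_space) \<Rightarrow> 'a set \<Rightarrow> bool" where
  "smooth_on f U \<longleftrightarrow> open U \<and> (\<forall>k. Ck_on k f U)"

text \<open>A map on an arbitrary subset of a Euclidean space is smooth if it extends locally to smooth
  maps on open sets. Hence a set locally diffeomorphic to open subsets of \<open>\<real>\<^sup>m\<close> is an embedded
  smooth submanifold.\<close>

definition smooth_map :: "'a::euclidean_space set \<Rightarrow> ('a \<Rightarrow> 'b::euclidean_space) \<Rightarrow> bool" where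
  "smooth_map S f \<longleftrightarrow>
     (\<forall>x\<in>S. \<exists>U g. x \<in> U \<and> smooth_on g U \<and> (\<forall>y\<in>S \<inter> U. g y = f y))"

definition diffeomorphic :: "'a::euclidean_space set \<Rightarrow> 'b::euclidean_space set \<Rightarrow> bool" where
  "diffeomorphic S T \<longleftrightarrow>
     (\<exists>f g. homeomorphism S T f g \<and> smooth_map S f \<and> smooth_map T g)"

definition regular_curve :: "'a::euclidean_space set \<Rightarrow> bool" where
  "regular_curve C \<longleftrightarrow> C \<noteq> {} \<and> connected C \<and>
     (\<forall>p\<in>C. \<exists>U. open U \<and> p \<in> U \<and> diffeomorphic (C \<inter> U) (UNIV :: real set))"

definition open_band :: "'a::euclidean_space set \<Rightarrow> bool" where
  "open_band W \<longleftrightarrow> diffeomorphic W ((UNIV :: real set) \<times> {0<..<1::real})"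


section \<open>Principal curvatures of oriented hypersurfaces\<close>

text \<open>A hypersurface \<open>M\<close> of \<open>\<real>\<^sup>4\<close> is oriented by a unit normal field \<open>N\<close>.\<close>

definition tangent_space :: "(real^4 \<Rightarrow> real^4) \<Rightarrow> real^4 \<Rightarrow> (real^4) set" where
  "tangent_space N p = {v. v \<bullet> N p = 0}"

text \<open>The derivative within \<open>M\<close> is determined on tangent vectors only; it is used on no others.\<close>

definition shape_operator ::
    "(real^4) set \<Rightarrow> (real^4 \<Rightarrow> real^4) \<Rightarrow> real^4 \<Rightarrow> real^4 \<Rightarrow> real^4" where
  "shape_operator M N p = frechet_derivative (\<lambda>x. - N x) (at p within M)"

definition eigenspace ::
    "(real^4) set \<Rightarrow> (real^4 \<Rightarrow> real^4) \<Rightarrow> real^4 \<Rightarrow> real \<Rightarrow> (real^4) set" where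
  "eigenspace M N p \<kappa> = {v \<in> tangent_space N p. shape_operator M N p v = \<kappa> *\<^sub>R v}"

text \<open>The list \<open>[k\<^sub>1, k\<^sub>2, k\<^sub>3]\<close> with \<open>k\<^sub>1 \<le> k\<^sub>2 \<le> k\<^sub>3\<close>, each eigenvalue repeated according to its
  multiplicity (the shape operator being self-adjoint, its multiplicities are the dimensions of
  the eigenspaces).\<close>

definition principal_curvatures ::
    "(real^4) set \<Rightarrow> (real^4 \<Rightarrow> real^4) \<Rightarrow> real^4 \<Rightarrow> real list" where
  "principal_curvatures M N p =
     (THE ks. sorted ks \<and> length ks = 3 \<and>
        (\<forall>\<kappa>. count_list ks \<kappa> = dim (eigenspace M N p \<kappa>)))"

text \<open>Here and below the index \<open>i\<close> ranges over \<open>1, 2, 3\<close>.\<close>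

definition principal_curvature ::
    "(real^4) set \<Rightarrow> (real^4 \<Rightarrow> real^4) \<Rightarrow> nat \<Rightarrow> real^4 \<Rightarrow> real" where
  "principal_curvature M N i p = principal_curvatures M N p ! (i - 1)"

definition umbilic_set :: "(real^4) set \<Rightarrow> (real^4 \<Rightarrow> real^4) \<Rightarrow> (real^4) set" where
  "umbilic_set M N = {p \<in> M. principal_curvature M N 1 p = principal_curvature M N 2 p \<and>
     principal_curvature M N 2 p = principal_curvature M N 3 p}"

definition P12_set :: "(real^4) set \<Rightarrow> (real^4 \<Rightarrow> real^4) \<Rightarrow> (real^4) set" where
  "P12_set M N = {p \<in> M. principal_curvature M N 1 p = principal_curvature M N 2 p \<and>
     principal_curvature M N 2 p < principal_curvature M N 3 p}"

definition P23_set :: "(real^4) set \<Rightarrow> (real^4 \<Rightarrow> real^4) \<Rightarrow> (real^4) set" where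
  "P23_set M N = {p \<in> M. principal_curvature M N 1 p < principal_curvature M N 2 p \<and>
     principal_curvature M N 2 p = principal_curvature M N 3 p}"

definition partially_umbilic_set :: "(real^4) set \<Rightarrow> (real^4 \<Rightarrow> real^4) \<Rightarrow> (real^4) set" where
  "partially_umbilic_set M N = P12_set M N \<union> P23_set M N"


section \<open>Principal foliations\<close>

definition foliation_domain ::
    "(real^4) set \<Rightarrow> (real^4 \<Rightarrow> real^4) \<Rightarrow> nat \<Rightarrow> (real^4) set" where
  "foliation_domain M N i =
     (if i = 1 then M - (umbilic_set M N \<union> P12_set M N)
      else if i = 3 then M - (umbilic_set M N \<union> P23_set M N)
      else M - (umbilic_set M N \<union> P12_set M N \<union> P23_set M N))"

definition eigenline_field ::
    "(real^4) set \<Rightarrow> (real^4 \<Rightarrow> real^4) \<Rightarrow> nat \<Rightarrow> real^4 \<Rightarrow> (real^4) set" where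
  "eigenline_field M N i p = eigenspace M N p (principal_curvature M N i p)"

definition integral_curve ::
    "(real^4) set \<Rightarrow> (real^4 \<Rightarrow> real^4) \<Rightarrow> nat \<Rightarrow> real set \<Rightarrow> (real \<Rightarrow> real^4) \<Rightarrow> bool" where
  "integral_curve M N i I \<gamma> \<longleftrightarrow> open I \<and> is_interval I \<and> \<gamma> ` I \<subseteq> foliation_domain M N i \<and>
     (\<exists>\<gamma>'. continuous_on I \<gamma>' \<and>
        (\<forall>s\<in>I. (\<gamma> has_vector_derivative \<gamma>' s) (at s) \<and> \<gamma>' s \<noteq> 0 \<and>
           \<gamma>' s \<in> eigenline_field M N i (\<gamma> s)))"

definition leaf ::
    "(real^4) set \<Rightarrow> (real^4 \<Rightarrow> real^4) \<Rightarrow> nat \<Rightarrow> real^4 \<Rightarrow> (real^4) set" where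
  "leaf M N i p = \<Union> {\<gamma> ` I | \<gamma> I. integral_curve M N i I \<gamma> \<and> p \<in> \<gamma> ` I}"

definition leaves :: "(real^4) set \<Rightarrow> (real^4 \<Rightarrow> real^4) \<Rightarrow> nat \<Rightarrow> (real^4) set set" where
  "leaves M N i = leaf M N i ` foliation_domain M N i"

text \<open>The whole leaf is parametrized over \<open>(0,1)\<close> by an integral curve converging to \<open>q\<close> at one end
  (which end is immaterial, since parametrizations can be reversed).\<close>

definition limiting_endpoint ::
    "(real^4) set \<Rightarrow> (real^4 \<Rightarrow> real^4) \<Rightarrow> nat \<Rightarrow> (real^4) set \<Rightarrow> real^4 \<Rightarrow> bool" where
  "limiting_endpoint M N i L q \<longleftrightarrow> q \<notin> L \<and>
     (\<exists>\<gamma>. integral_curve M N i {0<..<1} \<gamma> \<and> \<gamma> ` {0<..<1} = L \<and> (\<gamma> \<longlongrightarrow> q) (at_left 1))"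

definition separatrix_surface ::
    "(real^4) set \<Rightarrow> (real^4 \<Rightarrow> real^4) \<Rightarrow> nat \<Rightarrow> (real^4) set \<Rightarrow> (real^4) set" where
  "separatrix_surface M N i C =
     \<Union> {L \<in> leaves M N i. \<exists>q\<in>C. limiting_endpoint M N i L q}"


section \<open>Darbouxian type \<open>D\<^sub>1\<close>\<close>

text \<open>The third-order (homogeneous) part of \<open>h(x\<^sub>1,x\<^sub>2,0)\<close> at the origin is \<open>1/3!\<close> times the third
  derivative of \<open>s \<mapsto> h(s x\<^sub>1, s x\<^sub>2, 0)\<close> at \<open>0\<close>. The choice of \<open>e\<^sub>1, e\<^sub>2\<close> includes the rotation that
  removes the term \<open>x\<^sub>1\<^sup>2 x\<^sub>2\<close>.\<close>

definition type_D1_point :: "(real^4) set \<Rightarrow> (real^4 \<Rightarrow> real^4) \<Rightarrow> real^4 \<Rightarrow> bool" where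
  "type_D1_point M N p \<longleftrightarrow> p \<in> partially_umbilic_set M N \<and>
     (\<exists>e1 e2 e3 U V (h :: real \<times> real \<times> real \<Rightarrow> real) A B C.
        norm e1 = 1 \<and> norm e2 = 1 \<and> norm e3 = 1 \<and>
        e1 \<bullet> e2 = 0 \<and> e1 \<bullet> e3 = 0 \<and> e2 \<bullet> e3 = 0 \<and>
        span {e1, e2, e3} = tangent_space N p \<and>
        (\<exists>\<kappa>. eigenspace M N p \<kappa> = span {e1, e2}) \<and>
        open U \<and> p \<in> U \<and> 0 \<in> V \<and> smooth_on h V \<and>
        M \<inter> U = {p + x1 *\<^sub>R e1 + x2 *\<^sub>R e2 + x3 *\<^sub>R e3 + h (x1, x2, x3) *\<^sub>R N p | x1 x2 x3.
                   (x1, x2, x3) \<in> V} \<and>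
        (\<forall>x1 x2. (deriv ^^ 3) (\<lambda>s. h (s * x1, s * x2, 0)) 0 / fact 3 =
                   1/6 * (A * x1^3 + 3 * B * x1 * x2^2 + C * x2^3)) \<and>
        B * (B - A) \<noteq> 0 \<and> A / B > (C / (2 * B))^2 + 2)"

definition type_D1_curve :: "(real^4) set \<Rightarrow> (real^4 \<Rightarrow> real^4) \<Rightarrow> (real^4) set \<Rightarrow> bool" where
  "type_D1_curve M N C \<longleftrightarrow> regular_curve C \<and> (\<forall>p\<in>C. type_D1_point M N p)"


section \<open>The quadric\<close>

definition gradient :: "('a::real_inner \<Rightarrow> real) \<Rightarrow> 'a \<Rightarrow> 'a" where
  "gradient f x = (THE D. GDERIV f x :> D)"

definition quadric_form :: "real \<Rightarrow> real \<Rightarrow> real \<Rightarrow> real \<Rightarrow> real^4 \<Rightarrow> real" where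
  "quadric_form a b c d p =
     (p$1)^2 / a^2 + (p$2)^2 / b^2 + (p$3)^2 / c^2 - (p$4)^2 / d^2"

definition Q1 :: "real \<Rightarrow> real \<Rightarrow> real \<Rightarrow> real \<Rightarrow> (real^4) set" where
  "Q1 a b c d = {p. quadric_form a b c d p - 1 = 0}"

definition Q1_normal :: "real \<Rightarrow> real \<Rightarrow> real \<Rightarrow> real \<Rightarrow> real^4 \<Rightarrow> real^4" where
  "Q1_normal a b c d p =
     - (gradient (quadric_form a b c d) p /\<^sub>R norm (gradient (quadric_form a b c d) p))"

definition Q1_param ::
    "real \<Rightarrow> real \<Rightarrow> real \<Rightarrow> real \<Rightarrow> real \<Rightarrow> real \<Rightarrow> real \<Rightarrow> real^4" where
  "Q1_param a b c d u v w =
     vector [a * u, b * v, c * w, d * sqrt (u^2 + v^2 + w^2 - 1)]"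

end

theory Submission
  imports Defs
begin

text \<open>Put \<open>ax = (a\<^sup>2, b\<^sup>2, c\<^sup>2, - d\<^sup>2)\<close>. The quadric belongs to the confocal family
  \<open>\<Sum>\<^sub>i x\<^sub>i\<^sup>2 / (ax\<^sub>i - l) = 1\<close>, and the parameters of the three other members through a point \<open>p\<close> are its
  elliptic coordinates \<open>L1 \<le> - d\<^sup>2 < c\<^sup>2 \<le> L2 \<le> b\<^sup>2 \<le> L3 \<le> a\<^sup>2\<close>. The principal curvatures at \<open>p\<close> are
  \<open>1 / (L1 g) < 1 / (L3 g) \<le> 1 / (L2 g)\<close> with \<open>g\<close> half the length of the gradient; so the partially umbilic
  points are those with \<open>L2 = L3 = b\<^sup>2\<close>, and on a principal line two of the elliptic coordinates are
  constant. Solving for the \<open>x\<^sub>i\<^sup>2\<close> parametrizes all leaves explicitly: those of \<open>\<F>\<^sub>1\<close> are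
  graphs over the \<open>t\<close>-axis; those of \<open>\<F>\<^sub>2\<close> and \<open>\<F>\<^sub>3\<close> are ovals, except that an oval on which the constant
  \<open>L2\<close> (respectively \<open>L3\<close>) equals \<open>b\<^sup>2\<close> degenerates to arcs in \<open>y = 0\<close> that join two partially umbilic
  points. These arcs fill the bands. At a partially umbilic point the third-order part of \<open>h(x\<^sub>1, x\<^sub>2, 0)\<close> is
  a multiple of \<open>x\<^sub>1 (x\<^sub>1\<^sup>2 + x\<^sub>2\<^sup>2)\<close>, whence \<open>A = 3 B\<close> and \<open>C = 0\<close>.\<close>

section \<open>Calculus of smooth maps\<close>

text \<open>A leaf is the union of the images of all integral curves through a point, so exhibiting
  one curve is not enough: every other integral curve must be shown to stay on it. First integrals
  do this in place of a uniqueness theorem for differential equations. If a principal direction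
  satisfies \<open>v$i * (l - ax$i) = \<nu> * p$i\<close>, the elliptic coordinate \<open>l\<close>
  has derivative \<open>2 * \<nu>\<close> along the line. So the logarithmic derivative of
  \<open>p$i\<close> is half that of \<open>ax$i - l\<close>, and
  \<open>p$i / sqrt \<bar>ax$i - l\<bar>\<close> is constant if \<open>l\<close> cannot reach
  \<open>ax$i\<close>. These constants remember the signs of the coordinates, which the equations
  for the squares lose, and they determine the two elliptic coordinates that stay fixed. A
  coordinate whose factor can vanish is instead written as a sine, a cosine or a linear function of
  the parameter, so that it passes through zero smoothly. For the Darbouxian type, the quadric is a
  quadratic equation in the height over the tangent space, and the cubic jet follows by implicit
  differentiation.\<close>

lemma Ck_on_SucI:
  fixes f :: "'a::euclidean_space \<Rightarrow> 'b::euclidean_space"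
  assumes "\<And>x. x \<in> U \<Longrightarrow> (f has_derivative f' x) (at x)"
    and "\<And>v. Ck_on k (\<lambda>x. f' x v) U" and "open U"
    and cong: "\<And>g h :: 'a \<Rightarrow> 'b. (\<And>x. x \<in> U \<Longrightarrow> g x = h x) \<Longrightarrow> Ck_on k g U \<Longrightarrow> Ck_on k h U"
  shows "Ck_on (Suc k) f U"
proof -
  have "f' x v = frechet_derivative f (at x) v" if "x \<in> U" for x v
    using frechet_derivative_at[OF assms(1)[OF that]] by simp
  then have "Ck_on k (\<lambda>x. frechet_derivative f (at x) v) U" for v
    by (rule cong[OF _ assms(2)]) simp
  then show ?thesis
    using assms(1) by (auto simp: differentiable_def)
qed

text \<open>Congruence at order \<open>k\<close> is a premise of \<open>Ck_on_SucI\<close> because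
  in the induction step here it is available only as the induction hypothesis.
  \<open>Ck_on_Suc_derivI\<close> then discharges that premise.\<close>

lemma Ck_on_cong:
  assumes "open U" "\<And>x. x \<in> U \<Longrightarrow> f x = g x" "Ck_on k f U"
  shows "Ck_on k g U"
  using assms(2,3)
proof (induction k arbitrary: f g)
  case 0
  then show ?case
    unfolding Ck_on.simps(1) using continuous_on_cong[OF refl, of U f g] by simp
next
  case (Suc k)
  have "(g has_derivative frechet_derivative f (at x)) (at x)" if "x \<in> U" for x
  proof -
    have "(f has_derivative frechet_derivative f (at x)) (at x)"
      using Suc.prems(2) that unfolding Ck_on.simps(2) frechet_derivative_works by simp
    then show ?thesis
      by (rule has_derivative_transform_within_open[OF _ \<open>open U\<close> that]) (rule Suc.prems(1))
  qed
  moreover have "Ck_on k (\<lambda>x. frechet_derivative f (at x) v) U" for v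
    using Suc.prems(2) by simp
  ultimately show ?case
    by (rule Ck_on_SucI[where f' = "\<lambda>x. frechet_derivative f (at x)"]) (assumption, fact assms(1), rule Suc.IH)
qed

lemma Ck_on_Suc_derivI:
  assumes "\<And>x. x \<in> U \<Longrightarrow> (f has_derivative f' x) (at x)"
    and "\<And>v. Ck_on k (\<lambda>x. f' x v) U" and "open U"
  shows "Ck_on (Suc k) f U"
  by (rule Ck_on_SucI[OF assms]) (assumption, rule Ck_on_cong[OF assms(3)])

lemma Ck_on_Suc_has_derivative:
  "Ck_on (Suc k) f U \<Longrightarrow> x \<in> U \<Longrightarrow> (f has_derivative frechet_derivative f (at x)) (at x)"
  by (simp flip: frechet_derivative_works)

lemma Ck_on_Suc_deriv: "Ck_on (Suc k) f U \<Longrightarrow> Ck_on k (\<lambda>x. frechet_derivative f (at x) v) U"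
  by simp

lemma Ck_on_SucD: "Ck_on (Suc k) f U \<Longrightarrow> Ck_on k f U"
proof (induction k arbitrary: f)
  case 0
  then show ?case
    by (simp add: continuous_at_imp_continuous_on differentiable_imp_continuous_within)
qed (metis Ck_on.simps(2))

lemma Ck_on_const: "Ck_on k (\<lambda>x. c) U"
  by (induction k arbitrary: c) auto

lemma Ck_on_linear:
  assumes "bounded_linear L" "open U"
  shows "Ck_on k L U"
proof (cases k)
  case 0
  then show ?thesis using assms(1) by (simp add: linear_continuous_on)
next
  case (Suc j)
  show ?thesis unfolding Suc
    by (rule Ck_on_Suc_derivI[where f' = "\<lambda>_. L"])
       (intro bounded_linear_imp_has_derivative Ck_on_const assms)+
qed

lemma Ck_on_add:
  assumes "open U" "Ck_on k f U" "Ck_on k g U"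
  shows "Ck_on k (\<lambda>x. f x + g x) U"
  using assms(2,3)
proof (induction k arbitrary: f g)
  case 0
  then show ?case by (simp add: continuous_on_add)
next
  case (Suc k)
  show ?case
  proof (rule Ck_on_Suc_derivI[where f' = "\<lambda>x v. frechet_derivative f (at x) v + frechet_derivative g (at x) v"])
    show "((\<lambda>x. f x + g x) has_derivative
        (\<lambda>v. frechet_derivative f (at x) v + frechet_derivative g (at x) v)) (at x)" if "x \<in> U" for x
      by (intro has_derivative_add Ck_on_Suc_has_derivative[OF _ that]) fact+
    show "Ck_on k (\<lambda>x. frechet_derivative f (at x) v + frechet_derivative g (at x) v) U" for v
      using Suc.prems by (intro Suc.IH) simp_all
  qed fact
qed

lemma Ck_on_bilinear:
  assumes "open U" "bounded_bilinear pr" "Ck_on k f U" "Ck_on k g U"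
  shows "Ck_on k (\<lambda>x. pr (f x) (g x)) U"
  using assms(3,4)
proof (induction k arbitrary: f g)
  case 0
  then show ?case
    unfolding Ck_on.simps(1) by (intro bounded_bilinear.continuous_on[OF assms(2)])
next
  case (Suc k)
  show ?case
  proof (rule Ck_on_Suc_derivI[where f' = "\<lambda>x v. pr (f x) (frechet_derivative g (at x) v) +
        pr (frechet_derivative f (at x) v) (g x)"])
    fix x assume "x \<in> U"
    then show "((\<lambda>x. pr (f x) (g x)) has_derivative (\<lambda>v. pr (f x) (frechet_derivative g (at x) v) +
        pr (frechet_derivative f (at x) v) (g x))) (at x)"
      by (intro bounded_bilinear.FDERIV[OF assms(2)] Suc.prems[THEN Ck_on_Suc_has_derivative])
  next
    show "Ck_on k (\<lambda>x. pr (f x) (frechet_derivative g (at x) v) +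
        pr (frechet_derivative f (at x) v) (g x)) U" for v
      by (intro Ck_on_add Suc.IH \<open>open U\<close> Ck_on_Suc_deriv[OF Suc.prems(1)]
          Ck_on_Suc_deriv[OF Suc.prems(2)] Suc.prems[THEN Ck_on_SucD])
  qed fact
qed

text \<open>The derivative is a product of the derivative of \<open>f\<close> and two factors
  \<open>inverse (f x)\<close>, so the induction hypothesis for \<open>f\<close> itself raises the
  order by one. The square root is treated similarly.\<close>

lemma Ck_on_inverse:
  fixes f :: "'a::euclidean_space \<Rightarrow> real"
  assumes "open U" "\<And>x. x \<in> U \<Longrightarrow> f x \<noteq> 0" "Ck_on k f U"
  shows "Ck_on k (\<lambda>x. inverse (f x)) U"
  using assms(2,3)
proof (induction k arbitrary: f)
  case 0
  then show ?case by (auto intro: continuous_on_inverse)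
next
  case (Suc k)
  show ?case
  proof (rule Ck_on_Suc_derivI[where f' = "\<lambda>x v. (-1) * ((inverse (f x) * frechet_derivative f (at x) v) * inverse (f x))"])
    fix x assume "x \<in> U"
    then show "((\<lambda>x. inverse (f x)) has_derivative (\<lambda>v. (-1) * ((inverse (f x) * frechet_derivative f (at x) v) * inverse (f x)))) (at x)"
      using Suc.prems Deriv.has_derivative_inverse[OF _ Ck_on_Suc_has_derivative, of f x k U] by simp
  next
    show "Ck_on k (\<lambda>x. (-1) * ((inverse (f x) * frechet_derivative f (at x) v) * inverse (f x))) U" for v
      by (intro Ck_on_bilinear[OF _ bounded_bilinear_mult] Suc.IH \<open>open U\<close> Ck_on_const
          Suc.prems(1) Ck_on_Suc_deriv[OF Suc.prems(2)] Suc.prems(2)[THEN Ck_on_SucD])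
  qed fact
qed

lemma Ck_on_sqrt:
  fixes f :: "'a::euclidean_space \<Rightarrow> real"
  assumes "open U" "\<And>x. x \<in> U \<Longrightarrow> f x > 0" "Ck_on k f U"
  shows "Ck_on k (\<lambda>x. sqrt (f x)) U"
  using assms(2,3)
proof (induction k arbitrary: f)
  case 0
  then show ?case by (auto intro: continuous_on_real_sqrt)
next
  case (Suc k)
  show ?case
  proof (rule Ck_on_Suc_derivI[where f' = "\<lambda>x v. frechet_derivative f (at x) v * (inverse (sqrt (f x)) * (1/2))"])
    fix x assume "x \<in> U"
    then show "((\<lambda>x. sqrt (f x)) has_derivative (\<lambda>v. frechet_derivative f (at x) v * (inverse (sqrt (f x)) * (1/2)))) (at x)"
      using Suc.prems has_derivative_real_sqrt[OF _ Ck_on_Suc_has_derivative, of f x k U]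
      by simp
  next
    have "sqrt (f x) \<noteq> 0" if "x \<in> U" for x using Suc.prems(1)[OF that] by simp
    then show "Ck_on k (\<lambda>x. frechet_derivative f (at x) v * (inverse (sqrt (f x)) * (1/2))) U" for v
      by (intro Ck_on_bilinear[OF _ bounded_bilinear_mult] Ck_on_inverse Suc.IH \<open>open U\<close> Ck_on_const
          Suc.prems(1) Ck_on_Suc_deriv[OF Suc.prems(2)] Suc.prems(2)[THEN Ck_on_SucD])
  qed fact
qed

section \<open>Smooth functions on open sets, smooth maps and diffeomorphisms\<close>

lemma smooth_on_open: "smooth_on f U \<Longrightarrow> open U"
  by (simp add: smooth_on_def)

lemma smooth_on_const: "open U \<Longrightarrow> smooth_on (\<lambda>x. c) U"
  by (simp add: smooth_on_def Ck_on_const)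

lemma smooth_on_linear: "bounded_linear L \<Longrightarrow> open U \<Longrightarrow> smooth_on L U"
  by (simp add: smooth_on_def Ck_on_linear)

lemma smooth_on_add:
  "smooth_on f U \<Longrightarrow> smooth_on g U \<Longrightarrow> smooth_on (\<lambda>x. f x + g x) U"
  by (simp add: smooth_on_def Ck_on_add)

lemma smooth_on_mult:
  fixes f :: "'a::euclidean_space \<Rightarrow> real"
  shows "smooth_on f U \<Longrightarrow> smooth_on g U \<Longrightarrow> smooth_on (\<lambda>x. f x * g x) U"
  by (simp add: smooth_on_def Ck_on_bilinear[OF _ bounded_bilinear_mult])

lemma smooth_on_scaleR:
  "smooth_on f U \<Longrightarrow> smooth_on g U \<Longrightarrow> smooth_on (\<lambda>x. f x *\<^sub>R g x) U"
  by (simp add: smooth_on_def Ck_on_bilinear[OF _ bounded_bilinear_scaleR])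

lemma smooth_on_diff:
  fixes f :: "'a::euclidean_space \<Rightarrow> real"
  assumes "smooth_on f U" "smooth_on g U"
  shows "smooth_on (\<lambda>x. f x - g x) U"
proof -
  have "smooth_on (\<lambda>x. f x + (-1) * g x) U"
    using assms by (intro smooth_on_add smooth_on_mult smooth_on_const smooth_on_open[OF assms(1)])
  then show ?thesis by simp
qed

lemma smooth_on_divide:
  fixes f :: "'a::euclidean_space \<Rightarrow> real"
  assumes "smooth_on f U" "smooth_on g U" "\<And>x. x \<in> U \<Longrightarrow> g x \<noteq> 0"
  shows "smooth_on (\<lambda>x. f x / g x) U"
  using assms
  by (auto simp: smooth_on_def divide_inverse intro!: Ck_on_bilinear[OF _ bounded_bilinear_mult] Ck_on_inverse)

lemma smooth_on_sqrt:
  fixes f :: "'a::euclidean_space \<Rightarrow> real"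
  assumes "smooth_on f U" "\<And>x. x \<in> U \<Longrightarrow> f x > 0"
  shows "smooth_on (\<lambda>x. sqrt (f x)) U"
  using assms by (auto simp: smooth_on_def intro!: Ck_on_sqrt)

lemma smooth_on_power:
  fixes f :: "'a::euclidean_space \<Rightarrow> real"
  assumes "smooth_on f U"
  shows "smooth_on (\<lambda>x. f x ^ n) U"
proof (induction n)
  case 0
  then show ?case using smooth_on_const[OF smooth_on_open[OF assms]] by simp
next
  case (Suc n)
  then show ?case using smooth_on_mult[OF assms] by simp
qed

lemma vector_4_axis:
  "vector [x, y, z, t] =
    x *\<^sub>R axis 1 1 + y *\<^sub>R axis 2 1 + z *\<^sub>R axis 3 1 + t *\<^sub>R (axis 4 1 :: real^4)"
  by (simp add: vec_eq_iff forall_4 axis_def vector_def)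

lemma smooth_on_vector_4:
  assumes "smooth_on f1 U" "smooth_on f2 U" "smooth_on f3 U" "smooth_on f4 U"
  shows "smooth_on (\<lambda>x. vector [f1 x, f2 x, f3 x, f4 x] :: real^4) U"
  unfolding vector_4_axis
  by (intro smooth_on_add smooth_on_scaleR smooth_on_const smooth_on_open[OF assms(1)] assms)

lemma smooth_on_Pair:
  fixes f :: "'a::euclidean_space \<Rightarrow> real" and g :: "'a \<Rightarrow> real"
  assumes "smooth_on f U" "smooth_on g U"
  shows "smooth_on (\<lambda>x. (f x, g x)) U"
proof -
  have "smooth_on (\<lambda>x. f x *\<^sub>R (1::real, 0::real) + g x *\<^sub>R (0, 1)) U"
    by (intro smooth_on_add smooth_on_scaleR smooth_on_const smooth_on_open[OF assms(1)] assms)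
  then show ?thesis by simp
qed

lemma smooth_mapI: "smooth_on f U \<Longrightarrow> S \<subseteq> U \<Longrightarrow> smooth_map S f"
  unfolding smooth_map_def by blast

lemma smooth_map_continuous:
  assumes "smooth_map S f"
  shows "continuous_on S f"
  unfolding continuous_on_eq_continuous_within
proof
  fix x assume "x \<in> S"
  then obtain U g where U: "x \<in> U" "smooth_on g U" and eq: "\<forall>y\<in>S \<inter> U. g y = f y"
    using assms unfolding smooth_map_def by blast
  have "open U" and "continuous_on U g"
    using U(2) by (metis smooth_on_def Ck_on.simps(1))+
  then have "continuous (at x within S) g"
    using U(1) by (meson continuous_at_imp_continuous_at_within continuous_on_eq_continuous_at)
  then show "continuous (at x within S) f"
    unfolding continuous_within
    using U(1) \<open>open U\<close> eq \<open>x \<in> S\<close>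
    by (auto elim!: Lim_transform_eventually simp: eventually_at_topological intro!: exI[of _ U])
qed

lemma diffeomorphicI:
  assumes "smooth_map S f" "smooth_map T g" "f ` S \<subseteq> T" "g ` T \<subseteq> S"
    and "\<And>x. x \<in> S \<Longrightarrow> g (f x) = x" "\<And>y. y \<in> T \<Longrightarrow> f (g y) = y"
  shows "diffeomorphic S T"
  unfolding diffeomorphic_def
proof (intro exI conjI)
  show "homeomorphism S T f g"
    using assms by (intro homeomorphismI smooth_map_continuous) auto
qed (use assms in auto)

section \<open>Principal curvatures from an orthogonal eigenbasis\<close>

lemma sorted_list_eqI_count:
  assumes "sorted xs" "sorted ys" "\<And>x. count_list xs x = count_list ys x"
  shows "xs = ys"
proof -
  have "mset xs = mset ys"
    using assms(3) by (simp add: multiset_eq_iff count_mset)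
  then show ?thesis
    using assms(1,2) properties_for_sort by metis
qed

lemma orthogonal_basis_hyperplane:
  fixes u :: "real^4"
  assumes "u \<noteq> 0" and tan: "v1 \<bullet> u = 0" "v2 \<bullet> u = 0" "v3 \<bullet> u = 0"
    and nz: "v1 \<noteq> 0" "v2 \<noteq> 0" "v3 \<noteq> 0"
    and orth: "v1 \<bullet> v2 = 0" "v1 \<bullet> v3 = 0" "v2 \<bullet> v3 = 0"
  shows "v1 \<noteq> v2" "v1 \<noteq> v3" "v2 \<noteq> v3" "independent {v1, v2, v3}" "span {v1, v2, v3} = {v. v \<bullet> u = 0}"
proof -
  show ne: "v1 \<noteq> v2" "v1 \<noteq> v3" "v2 \<noteq> v3" using nz orth by auto
  have "v2 \<bullet> v1 = 0" "v3 \<bullet> v1 = 0" "v3 \<bullet> v2 = 0"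
    using orth by (simp_all add: inner_commute)
  then show ind: "independent {v1, v2, v3}"
    by (intro pairwise_orthogonal_independent)
       (use nz orth in \<open>auto simp: pairwise_def orthogonal_def\<close>)
  have T: "{v. v \<bullet> u = 0} = {v. u \<bullet> v = 0}" by (simp add: inner_commute)
  have "span {v1, v2, v3} = span {v. v \<bullet> u = 0}"
  proof (rule dim_eq_span)
    show "dim {v. v \<bullet> u = 0} \<le> dim {v1, v2, v3}"
      unfolding T by (subst dim_hyperplane[OF \<open>u \<noteq> 0\<close>]) (simp add: dim_eq_card_independent[OF ind] ne)
  qed (use tan in auto)
  moreover have "subspace {v. v \<bullet> u = 0}" unfolding T by (rule subspace_hyperplane)
  ultimately show "span {v1, v2, v3} = {v. v \<bullet> u = 0}" by simp
qed

text \<open>Comparing coefficients in the orthogonal basis shows that the eigenspace of \<kappa> is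
  spanned by the basis vectors with eigenvalue \<kappa>. So its dimension is the multiplicity of
  \<kappa> in the list, and a sorted list is determined by its multiplicities. \<open>S\<close>
  stands in for the shape operator because the derivative within \<open>M\<close> is prescribed on
  tangent vectors only.\<close>

lemma principal_curvatures_eqI:
  fixes S :: "real^4 \<Rightarrow> real^4"
  assumes N: "N p \<noteq> 0" and "linear S"
    and S: "\<And>v. v \<bullet> N p = 0 \<Longrightarrow> shape_operator M N p v = S v"
    and tan: "v1 \<bullet> N p = 0" "v2 \<bullet> N p = 0" "v3 \<bullet> N p = 0"
    and nz: "v1 \<noteq> 0" "v2 \<noteq> 0" "v3 \<noteq> 0"
    and orth: "v1 \<bullet> v2 = 0" "v1 \<bullet> v3 = 0" "v2 \<bullet> v3 = 0"
    and eig: "S v1 = k1 *\<^sub>R v1" "S v2 = k2 *\<^sub>R v2" "S v3 = k3 *\<^sub>R v3"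
    and le: "k1 \<le> k2" "k2 \<le> k3"
  shows "principal_curvatures M N p = [k1, k2, k3]"
proof -
  let ?T = "tangent_space N p"
  note basis = orthogonal_basis_hyperplane[OF N tan nz orth]
  note ne = basis(1-3) and ind = basis(4)
  have span: "span {v1, v2, v3} = ?T" unfolding basis(5) tangent_space_def ..
  have orth': "v2 \<bullet> v1 = 0" "v3 \<bullet> v1 = 0" "v3 \<bullet> v2 = 0"
    using orth by (simp_all add: inner_commute)
  have coord: "\<exists>c1 c2 c3. v = c1 *\<^sub>R v1 + c2 *\<^sub>R v2 + c3 *\<^sub>R v3" if v: "v \<in> ?T" for v
  proof -
    have "v \<in> span {v1, v2, v3}" using v span by simp
    then obtain c1 c2 c3 where "v - c1 *\<^sub>R v1 - c2 *\<^sub>R v2 - c3 *\<^sub>R v3 = 0"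
      by (auto simp: span_insert)
    then show ?thesis by (intro exI[of _ c1] exI[of _ c2] exI[of _ c3]) (simp add: algebra_simps)
  qed
  have espace: "eigenspace M N p k = span ({v. v = v1 \<and> k1 = k} \<union> {v. v = v2 \<and> k2 = k} \<union> {v. v = v3 \<and> k3 = k})"
    (is "_ = span ?B") for k
  proof
    show "eigenspace M N p k \<subseteq> span ?B"
    proof
      fix v assume "v \<in> eigenspace M N p k"
      then have v: "v \<in> ?T" and Sv: "S v = k *\<^sub>R v"
        using S by (auto simp: eigenspace_def tangent_space_def)
      obtain c1 c2 c3 where c: "v = c1 *\<^sub>R v1 + c2 *\<^sub>R v2 + c3 *\<^sub>R v3"
        using coord[OF v] by blast
      have "S v = (c1 * k1) *\<^sub>R v1 + (c2 * k2) *\<^sub>R v2 + (c3 * k3) *\<^sub>R v3"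
        using \<open>linear S\<close> by (simp add: c linear_add linear_scale eig)
      then have e: "(c1 * k1) *\<^sub>R v1 + (c2 * k2) *\<^sub>R v2 + (c3 * k3) *\<^sub>R v3 =
          (k * c1) *\<^sub>R v1 + (k * c2) *\<^sub>R v2 + (k * c3) *\<^sub>R v3"
        using Sv by (simp add: c algebra_simps)
      have sp: "y *\<^sub>R u \<in> span ?B" if "y = 0 \<or> u \<in> ?B" for y u
        using that by (elim disjE) (simp add: span_zero, intro span_scale span_base)
      \<comment> \<open>Pairing the two expansions of \<open>S v\<close> with \<open>v1\<close>
        gives \<open>c1 * k1 = k * c1\<close>, so either \<open>c1 = 0\<close> or \<open>v1\<close>
        belongs to the spanning set.\<close>
      have "c1 *\<^sub>R v1 \<in> span ?B"
        using arg_cong[OF e, of "\<lambda>w. w \<bullet> v1"] nz orth orth' by (intro sp) (auto simp: inner_add_left)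
      moreover have "c2 *\<^sub>R v2 \<in> span ?B"
        using arg_cong[OF e, of "\<lambda>w. w \<bullet> v2"] nz orth orth' by (intro sp) (auto simp: inner_add_left)
      moreover have "c3 *\<^sub>R v3 \<in> span ?B"
        using arg_cong[OF e, of "\<lambda>w. w \<bullet> v3"] nz orth orth' by (intro sp) (auto simp: inner_add_left)
      ultimately show "v \<in> span ?B" unfolding c by (intro span_add)
    qed
    have "subspace (eigenspace M N p k)"
    proof -
      have "eigenspace M N p k = {v. v \<bullet> N p = 0 \<and> S v = k *\<^sub>R v}"
        using S by (auto simp: eigenspace_def tangent_space_def)
      then show ?thesis
        using \<open>linear S\<close>
        by (auto simp: subspace_def linear_add linear_scale linear_0 inner_add_left scaleR_add_right)
    qed
    moreover have "?B \<subseteq> eigenspace M N p k"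
      using S tan eig by (auto simp: eigenspace_def tangent_space_def)
    ultimately show "span ?B \<subseteq> eigenspace M N p k"
      by (rule span_minimal[rotated])
  qed
  have dim: "dim (eigenspace M N p k) = count_list [k1, k2, k3] k" for k
  proof -
    let ?B = "{v. v = v1 \<and> k1 = k} \<union> {v. v = v2 \<and> k2 = k} \<union> {v. v = v3 \<and> k3 = k}"
    have "independent ?B"
      by (rule independent_mono[OF ind]) auto
    then have "dim (eigenspace M N p k) = card ?B"
      unfolding espace by (rule dim_span_eq_card_independent)
    also have "\<dots> = count_list [k1, k2, k3] k"
    proof -
      have "?B = (if k1 = k then {v1} else {}) \<union> (if k2 = k then {v2} else {}) \<union> (if k3 = k then {v3} else {})"
        by auto
      then show ?thesis using ne by (simp add: card_insert_if)
    qed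
    finally show ?thesis .
  qed
  show ?thesis
    unfolding principal_curvatures_def
  proof (rule the_equality)
    show "sorted [k1, k2, k3] \<and> length [k1, k2, k3] = 3 \<and>
        (\<forall>\<kappa>. count_list [k1, k2, k3] \<kappa> = dim (eigenspace M N p \<kappa>))"
      using le dim by simp
  next
    fix ks assume "sorted ks \<and> length ks = 3 \<and> (\<forall>\<kappa>. count_list ks \<kappa> = dim (eigenspace M N p \<kappa>))"
    then show "ks = [k1, k2, k3]"
      using le dim by (intro sorted_list_eqI_count) auto
  qed
qed

text \<open>A derivative within \<open>M\<close> need not be unique as a linear map, and
  \<open>frechet_derivative\<close> selects one. On the velocity of a curve in \<open>M\<close> the
  chain rule identifies it with the derivative of the composition, which is also
  \<open>D v\<close>.\<close>

lemma frechet_derivative_within_tangent: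
  fixes f :: "'a::euclidean_space \<Rightarrow> 'b::euclidean_space" and g :: "real \<Rightarrow> 'a"
  assumes f: "(f has_derivative D) (at p)"
    and g: "(g has_vector_derivative v) (at 0)" "g 0 = p"
    and "e > 0" and M: "\<And>s. \<bar>s\<bar> < e \<Longrightarrow> g s \<in> M"
  shows "frechet_derivative f (at p within M) v = D v"
proof -
  let ?T = "{-e<..<e}" and ?f' = "frechet_derivative f (at p within M)"
  have "(f has_derivative D) (at p within M)"
    using f by (rule has_derivative_at_withinI)
  then have f': "(f has_derivative ?f') (at p within M)"
    using frechet_derivative_works differentiable_def by blast
  have at: "at 0 within ?T = at (0::real)"
    using \<open>e > 0\<close> by (intro at_within_open) auto
  have dg: "(g has_derivative (\<lambda>h. h *\<^sub>R v)) (at 0 within ?T)"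
    using g(1) unfolding has_vector_derivative_def at .
  have "g ` ?T \<subseteq> M"
    using M by (auto simp: abs_if)
  then have "(f has_derivative ?f') (at (g 0) within g ` ?T)"
    using has_derivative_subset[OF f'] g(2) by simp
  then have "((\<lambda>x. f (g x)) has_derivative (\<lambda>h. ?f' (h *\<^sub>R v))) (at 0 within ?T)"
    by (rule has_derivative_in_compose[OF dg])
  moreover have "((\<lambda>x. f (g x)) has_derivative (\<lambda>h. D (h *\<^sub>R v))) (at 0 within ?T)"
    using g(2) f by (intro has_derivative_in_compose[OF dg]) (simp add: has_derivative_at_withinI)
  ultimately have "(\<lambda>h. ?f' (h *\<^sub>R v)) = (\<lambda>h. D (h *\<^sub>R v))"
    unfolding at by (rule has_derivative_unique)
  from fun_cong[OF this, of 1] show ?thesis by simp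
qed


section \<open>The shape operator of the quadric\<close>

lemma vector_4 [simp]:
  "(vector [x, y, z, t] :: 'a::zero^4)$1 = x" "(vector [x, y, z, t] :: 'a^4)$2 = y"
  "(vector [x, y, z, t] :: 'a^4)$3 = z" "(vector [x, y, z, t] :: 'a^4)$4 = t"
  by (simp_all add: vector_def)

lemma inner_vec_4: "v \<bullet> w = v$1 * w$1 + v$2 * w$2 + v$3 * w$3 + v$4 * (w::real^4)$4"
  by (simp add: inner_vec_def sum_4)

locale quadric =
  fixes a b c d :: real
  assumes ab: "a > b" and bc: "b > c" and c_pos: "c > 0" and d_pos: "d > 0"
begin

definition A where "A = a^2"
definition B where "B = b^2"
definition C where "C = c^2"
definition E where "E = d^2"

lemma ABCE: "A > B" "B > C" "C > 0" "E > 0" "A > 0" "B > 0" "A > C"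
proof -
  show "A > B" "B > C" "C > 0" "E > 0"
    using ab bc c_pos d_pos by (auto simp: A_def B_def C_def E_def power2_eq_square intro!: mult_strict_mono)
  then show "A > 0" "B > 0" "A > C" by auto
qed

text \<open>The squared semi-axes of \<open>x\<^sub>i\<^sup>2 / ax\<^sub>i\<close>; the last one is negative, so that all four coordinates
  play the same role.\<close>

definition ax :: "real^4" where "ax = vector [A, B, C, - E]"

lemma ax_simps [simp]: "ax$1 = A" "ax$2 = B" "ax$3 = C" "ax$4 = - E"
  by (simp_all add: ax_def)

lemma ax_nz: "ax$i \<noteq> 0"
  using ABCE exhaust_4[of i] by auto

text \<open>The quadratic form is \<open>p \<bullet> lam p\<close>, so this is half its gradient.
  Its symmetry as a linear map is what makes principal directions orthogonal.\<close>

definition lam :: "real^4 \<Rightarrow> real^4" where "lam p = (\<chi> i. p$i / ax$i)"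

lemma lam_nth [simp]: "lam p $ i = p$i / ax$i"
  by (simp add: lam_def)

lemma linear_lam: "linear lam"
  by (rule linearI) (simp_all add: vec_eq_iff add_divide_distrib)

lemma bounded_linear_lam: "bounded_linear lam"
  using linear_lam by (simp add: linear_conv_bounded_linear)

lemma inner_lam_commute: "v \<bullet> lam w = w \<bullet> lam v"
  by (simp add: inner_vec_4 mult.commute)

abbreviation Q where "Q \<equiv> Q1 a b c d"
abbreviation N where "N \<equiv> Q1_normal a b c d"

lemma quadric_form_eq: "quadric_form a b c d p = p \<bullet> lam p"
  by (simp add: quadric_form_def inner_vec_4 A_def B_def C_def E_def power2_eq_square)

lemma Q_iff: "p \<in> Q \<longleftrightarrow> p \<bullet> lam p = 1"
  by (simp add: Q1_def quadric_form_eq)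

lemma Q_iff_coords: "p \<in> Q \<longleftrightarrow> (p$1)^2 / A + (p$2)^2 / B + (p$3)^2 / C - (p$4)^2 / E = 1"
  by (simp add: Q_iff inner_vec_4 power2_eq_square)

lemma closed_Q: "closed Q"
proof -
  have "Q = {p. p \<bullet> lam p = 1}" by (auto simp: Q_iff)
  then show ?thesis
    by (simp add: closed_Collect_eq continuous_on_inner linear_continuous_on[OF bounded_linear_lam])
qed

lemma gradient_eq: "gradient (quadric_form a b c d) p = 2 *\<^sub>R lam p"
proof -
  have G: "GDERIV (quadric_form a b c d) p :> 2 *\<^sub>R lam p"
  proof -
    have "((\<lambda>p. p \<bullet> lam p) has_derivative (\<lambda>h. p \<bullet> lam h + h \<bullet> lam p)) (at p)"
      by (intro has_derivative_inner has_derivative_ident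
          bounded_linear_imp_has_derivative[OF bounded_linear_lam])
    moreover have "quadric_form a b c d = (\<lambda>p. p \<bullet> lam p)"
      by (simp add: fun_eq_iff quadric_form_eq)
    ultimately show ?thesis
      by (simp add: gderiv_def inner_lam_commute[of p])
  qed
  show ?thesis
    unfolding gradient_def
  proof (rule the_equality)
    show "GDERIV (quadric_form a b c d) p :> 2 *\<^sub>R lam p" by (rule G)
  next
    fix D assume "GDERIV (quadric_form a b c d) p :> D"
    then have "(\<lambda>h. h \<bullet> D) = (\<lambda>h. h \<bullet> (2 *\<^sub>R lam p))"
      using G unfolding gderiv_def by (rule has_derivative_unique)
    then have "h \<bullet> (D - 2 *\<^sub>R lam p) = 0" for h
      by (simp add: fun_eq_iff inner_diff_right)
    then have "(D - 2 *\<^sub>R lam p) \<bullet> (D - 2 *\<^sub>R lam p) = 0" by blast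
    then show "D = 2 *\<^sub>R lam p" by simp
  qed
qed

lemma N_eq: "N p = - (inverse (norm (lam p)) *\<^sub>R lam p)"
  by (simp add: Q1_normal_def gradient_eq)

lemma lam_nonzero: "p \<in> Q \<Longrightarrow> lam p \<noteq> 0"
  by (auto simp: Q_iff)

lemma tangent_iff: "p \<in> Q \<Longrightarrow> v \<in> tangent_space N p \<longleftrightarrow> v \<bullet> lam p = 0"
  using lam_nonzero[of p] by (auto simp: tangent_space_def N_eq)

text \<open>The straight line \<open>p + s *\<^sub>R v\<close> leaves the quadric only to second
  order: the form takes the value \<open>1 + s^2 * (v \<bullet> lam v)\<close> on it. Dividing by
  the square root of this value returns to the quadric and keeps the velocity at 0.\<close>

lemma exists_curve_tangent:
  assumes "p \<in> Q" "v \<bullet> lam p = 0"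
  obtains g e where "(g has_vector_derivative v) (at 0)" "g 0 = p" "e > 0"
    "\<And>s. \<bar>s\<bar> < e \<Longrightarrow> g s \<in> Q"
proof -
  let ?q = "v \<bullet> lam v"
  define g where "g = (\<lambda>s. inverse (sqrt (1 + s^2 * ?q)) *\<^sub>R (p + s *\<^sub>R v))"
  have "((\<lambda>s. inverse (sqrt (1 + s^2 * ?q))) has_real_derivative 0) (at 0)"
    by (auto intro!: derivative_eq_intros)
  then have "(g has_vector_derivative v) (at 0)"
    unfolding g_def by (auto intro!: derivative_eq_intros)
  moreover have "g 0 = p" by (simp add: g_def)
  moreover have "\<exists>e>0. \<forall>s. \<bar>s\<bar> < e \<longrightarrow> 1 + s^2 * ?q > 0"
  proof -
    have "open {s. 0 < 1 + s^2 * ?q}"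
      by (intro open_Collect_less continuous_intros)
    then show ?thesis
      by (force simp: open_dist dist_real_def dest: spec[of _ 0])
  qed
  then obtain e where e: "e > 0" "\<And>s. \<bar>s\<bar> < e \<Longrightarrow> 1 + s^2 * ?q > 0" by blast
  moreover have "g s \<in> Q" if "\<bar>s\<bar> < e" for s
  proof -
    have "(p + s *\<^sub>R v) \<bullet> lam (p + s *\<^sub>R v) = 1 + s^2 * ?q"
      using assms linear_lam inner_lam_commute[of p v]
      by (simp add: Q_iff linear_add linear_scale inner_add_left inner_add_right power2_eq_square)
    then show ?thesis
      using e(2)[OF that] linear_scale[OF linear_lam, of _ "p + s *\<^sub>R v"]
      by (simp add: Q_iff g_def del: scaleR_right_distrib scaleR_add_right scaleR_right.add)
         (simp add: field_simps)
  qed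
  ultimately show thesis using that by blast
qed

text \<open>The derivative of the normalized \<open>lam\<close> in the whole space, hence a linear
  extension of the shape operator from the tangent space.\<close>

definition shp :: "real^4 \<Rightarrow> real^4 \<Rightarrow> real^4" where
  "shp p v = inverse (norm (lam p)) *\<^sub>R lam v -
     ((lam p \<bullet> lam v) / norm (lam p) ^ 3) *\<^sub>R lam p"

lemma linear_shp: "linear (shp p)"
  unfolding shp_def
  by (rule linearI)
     (simp_all add: linear_add[OF linear_lam] linear_scale[OF linear_lam] inner_add_right
       add_divide_distrib algebra_simps)

lemma has_derivative_neg_N:
  assumes "p \<in> Q"
  shows "((\<lambda>x. - N x) has_derivative shp p) (at p)"
proof -
  let ?n = "norm (lam p)"
  have n: "?n > 0" using lam_nonzero[OF assms] by simp
  have "((\<lambda>x. norm (lam x)) has_derivative (\<lambda>h. (lam p \<bullet> lam h) / ?n)) (at p)"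
  proof -
    have "((\<lambda>x. norm (lam x)) has_derivative (\<lambda>h. lam h \<bullet> sgn (lam p))) (at p)"
      by (rule has_derivative_compose[OF bounded_linear_imp_has_derivative[OF bounded_linear_lam]
            has_derivative_norm[OF lam_nonzero[OF assms]]])
    moreover have "lam h \<bullet> sgn (lam p) = (lam p \<bullet> lam h) / ?n" for h
      by (simp add: sgn_div_norm inner_commute divide_inverse)
    ultimately show ?thesis by simp
  qed
  from Deriv.has_derivative_inverse[OF _ this]
  have "((\<lambda>x. inverse (norm (lam x))) has_derivative
      (\<lambda>h. - (inverse ?n * ((lam p \<bullet> lam h) / ?n) * inverse ?n))) (at p)"
    using n by simp
  from has_derivative_scaleR[OF this bounded_linear_imp_has_derivative[OF bounded_linear_lam]]
  have "((\<lambda>x. inverse (norm (lam x)) *\<^sub>R lam x) has_derivative shp p) (at p)"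
    by (rule has_derivative_eq_rhs) (auto simp: shp_def fun_eq_iff divide_inverse power3_eq_cube)
  then show ?thesis by (simp add: N_eq)
qed

lemma shape_operator_eq:
  assumes "p \<in> Q" "v \<bullet> lam p = 0"
  shows "shape_operator Q N p v = shp p v"
proof -
  obtain g e where "(g has_vector_derivative v) (at 0)" "g 0 = p" "e > 0"
    "\<And>s. \<bar>s\<bar> < e \<Longrightarrow> g s \<in> Q"
    using exists_curve_tangent[OF assms] by blast
  then show ?thesis
    unfolding shape_operator_def
    by (rule frechet_derivative_within_tangent[OF has_derivative_neg_N[OF assms(1)]])
qed

text \<open>The eigenvalue equation of \<open>shp p\<close> for
  \<open>1 / (l * norm (lam p))\<close>, cleared of denominators so that it makes sense for
  \<open>l = ax$i\<close> too. The multiplier \<open>\<nu>\<close> measures the normal part of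
  \<open>lam v\<close>, which the shape operator removes.\<close>

definition eigdir :: "real^4 \<Rightarrow> real \<Rightarrow> real^4 \<Rightarrow> bool" where
  "eigdir p l v \<longleftrightarrow> v \<bullet> lam p = 0 \<and> (\<exists>\<nu>. \<forall>i. v$i * (l - ax$i) = \<nu> * p$i)"

lemma shp_eigen_iff:
  assumes p: "p \<in> Q" and "l \<noteq> 0" and tan: "v \<bullet> lam p = 0"
  shows "shp p v = (1 / (l * norm (lam p))) *\<^sub>R v \<longleftrightarrow> eigdir p l v"
proof
  let ?n = "norm (lam p)" and ?g = "lam p \<bullet> lam v"
  have n: "?n > 0" using lam_nonzero[OF p] by simp
  {
    assume eq: "shp p v = (1 / (l * ?n)) *\<^sub>R v"
    have "v$i * (l - ax$i) = (?g * l / ?n^2) * p$i" for i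
      using arg_cong[OF eq, of "\<lambda>w. w$i"] n \<open>l \<noteq> 0\<close> ax_nz[of i]
      by (simp add: shp_def field_simps power2_eq_square power3_eq_cube)
    then show "eigdir p l v" unfolding eigdir_def using tan by blast
  }
  assume "eigdir p l v"
  then obtain \<nu> where \<nu>: "\<And>i. v$i * (l - ax$i) = \<nu> * p$i" by (auto simp: eigdir_def)
  have lamv: "lam v = (1 / l) *\<^sub>R v + (\<nu> / l) *\<^sub>R lam p"
    using \<nu> \<open>l \<noteq> 0\<close> ax_nz by (simp add: vec_eq_iff field_simps)
  then have "?g = \<nu> / l * ?n^2"
    using tan by (simp add: inner_add_right inner_commute[of "lam p" v] dot_square_norm)
  then show "shp p v = (1 / (l * ?n)) *\<^sub>R v"
    using n \<open>l \<noteq> 0\<close>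
    by (simp add: shp_def lamv power2_eq_square power3_eq_cube scaleR_add_right divide_inverse)
       (simp add: field_simps)
qed

lemma eigenspace_eq:
  assumes "p \<in> Q" "l \<noteq> 0"
  shows "eigenspace Q N p (1 / (l * norm (lam p))) = {v. eigdir p l v}"
  using shp_eigen_iff[OF assms] shape_operator_eq[OF assms(1)] tangent_iff[OF assms(1)]
  by (auto simp: eigenspace_def eigdir_def)

lemma eigdir_lam:
  assumes "eigdir p l v" "l \<noteq> 0" "w \<bullet> lam p = 0"
  shows "w \<bullet> lam v = (w \<bullet> v) / l"
proof -
  obtain \<nu> where \<nu>: "\<And>i. v$i * (l - ax$i) = \<nu> * p$i" using assms(1) by (auto simp: eigdir_def)
  have "lam v = (1 / l) *\<^sub>R v + (\<nu> / l) *\<^sub>R lam p"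
    using \<nu> \<open>l \<noteq> 0\<close> ax_nz by (simp add: vec_eq_iff field_simps)
  then show ?thesis using assms(3) by (simp add: inner_add_right)
qed

text \<open>The symmetric form \<open>v \<bullet> lam w\<close> equals \<open>v \<bullet> w\<close>
  divided by \<open>l\<close> and also divided by \<open>m\<close>.\<close>

lemma eigdir_orthogonal:
  assumes "p \<in> Q" and v: "eigdir p l v" and w: "eigdir p m w" and "l \<noteq> 0" "m \<noteq> 0" "l \<noteq> m"
  shows "v \<bullet> w = 0"
proof -
  have "v \<bullet> lam p = 0" "w \<bullet> lam p = 0" using v w by (auto simp: eigdir_def)
  then have "(w \<bullet> v) / l = (v \<bullet> w) / m"
    using eigdir_lam[OF v] eigdir_lam[OF w] assms(4,5) inner_lam_commute[of v w] by simp
  then show ?thesis using assms(4-6) by (simp add: inner_commute[of w v] field_simps)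
qed

end

section \<open>Elliptic coordinates\<close>

lemma cubic_four_zeros:
  fixes k0 k1 k2 k3 :: real
  assumes "\<And>x. x \<in> S \<Longrightarrow> k0 + k1 * x + k2 * x^2 + k3 * x^3 = 0" "finite S" "card S > 3"
  shows "k0 = 0 \<and> k1 = 0 \<and> k2 = 0 \<and> k3 = 0"
proof -
  let ?p = "[:k0, k1, k2, k3:]"
  have S: "S \<subseteq> {x. poly ?p x = 0}"
    using assms(1) by (auto simp: algebra_simps power2_eq_square power3_eq_cube)
  have "?p = 0"
  proof (rule ccontr)
    assume nz: "?p \<noteq> 0"
    have "card S \<le> card {x. poly ?p x = 0}"
      using S poly_roots_finite[OF nz] by (rule card_mono[rotated])
    also have "\<dots> \<le> degree ?p"
      by (rule card_poly_roots_bound[OF nz])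
    also have "\<dots> \<le> 3" by simp
    finally show False using assms(3) by simp
  qed
  then show ?thesis by simp
qed

lemma cubic_positive_left:
  fixes c0 c1 c2 L :: real
  obtains M where "M \<le> L" "- (M^3) + c2 * M^2 + c1 * M + c0 > 0"
proof -
  obtain n where n: "\<forall>x\<ge>n. poly [:c0, - c1, c2, 1:] x \<ge> 1"
    using poly_pinfty_gt_lc[of "[:c0, - c1, c2, 1:]"] by auto
  have "poly [:c0, - c1, c2, 1:] x = - ((- x)^3) + c2 * (- x)^2 + c1 * (- x) + c0" for x
    by (simp add: algebra_simps power2_eq_square power3_eq_cube)
  then have "- ((- x)^3) + c2 * (- x)^2 + c1 * (- x) + c0 > 0" if "x \<ge> n" for x
    using n that by (smt (verit))
  then show thesis using that[of "- max n (- L)"] by simp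
qed

context quadric
begin

text \<open>The equation \<open>\<Sum>\<^sub>i x\<^sub>i\<^sup>2 / (ax\<^sub>i (ax\<^sub>i - m)) = 0\<close> of the eigenvalues, multiplied by \<open>\<Prod>\<^sub>i (ax\<^sub>i - m)\<close>. On
  the quadric it is equivalent to \<open>\<Sum>\<^sub>i x\<^sub>i\<^sup>2 / (ax\<^sub>i - m) = 1\<close>.\<close>

definition pel :: "real^4 \<Rightarrow> real \<Rightarrow> real" where
  "pel p m = (p$1)^2 / A * ((B - m) * (C - m) * (- E - m)) +
     (p$2)^2 / B * ((A - m) * (C - m) * (- E - m)) +
     (p$3)^2 / C * ((A - m) * (B - m) * (- E - m)) -
     (p$4)^2 / E * ((A - m) * (B - m) * (C - m))"

definition ell :: "real^4 \<Rightarrow> real \<Rightarrow> real \<Rightarrow> real \<Rightarrow> bool" where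
  "ell p l1 l2 l3 \<longleftrightarrow> l1 \<le> - E \<and> C \<le> l2 \<and> l2 \<le> B \<and> B \<le> l3 \<and> l3 \<le> A \<and>
     (\<forall>m. pel p m = (l1 - m) * (l2 - m) * (l3 - m))"

text \<open>The cubic term carries the value of the quadratic form, so on \<open>Q\<close> the
  polynomial \<open>pel p\<close> has leading coefficient -1, like every product
  \<open>(l1 - m) * (l2 - m) * (l3 - m)\<close>.\<close>

lemma pel_coeffs:
  obtains c0 c1 c2 where
    "\<And>m. pel p m = - ((p$1)^2 / A + (p$2)^2 / B + (p$3)^2 / C - (p$4)^2 / E) * m^3 + c2 * m^2 + c1 * m + c0"
proof
  fix m
  define x y z t where "x = (p$1)^2 / A" and "y = (p$2)^2 / B" and "z = (p$3)^2 / C" and "t = (p$4)^2 / E"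
  show "pel p m = - ((p$1)^2 / A + (p$2)^2 / B + (p$3)^2 / C - (p$4)^2 / E) * m^3
    + ((p$1)^2 / A * (B + C - E) + (p$2)^2 / B * (A + C - E) + (p$3)^2 / C * (A + B - E) - (p$4)^2 / E * (A + B + C)) * m^2
    + (- ((p$1)^2 / A * (B * C - B * E - C * E) + (p$2)^2 / B * (A * C - A * E - C * E) + (p$3)^2 / C * (A * B - A * E - B * E) - (p$4)^2 / E * (A * B + A * C + B * C))) * m
    + (- ((p$1)^2 / A * (B * C * E)) - (p$2)^2 / B * (A * C * E) - (p$3)^2 / C * (A * B * E) - (p$4)^2 / E * (A * B * C))"
    unfolding pel_def x_def[symmetric] y_def[symmetric] z_def[symmetric] t_def[symmetric]
    by (simp add: algebra_simps power2_eq_square power3_eq_cube)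
qed

lemma ax_distinct: "card {A, B, C, - E} > 3"
  using ABCE by (simp add: card_insert_if)

text \<open>The difference of two cubics vanishes at the four distinct squared semi-axes, hence
  identically. The leading coefficients give \<open>s = 1\<close>, which is how
  \<open>ell_in_Q\<close> obtains membership in the quadric.\<close>

lemma cubic_eq_at_axes:
  assumes "\<And>m. f m = - s * m^3 + c2 * m^2 + c1 * m + (c0 :: real)"
    and "\<And>m. m \<in> {A, B, C, - E} \<Longrightarrow> f m = (l1 - m) * (l2 - m) * (l3 - m)"
  shows "s = 1 \<and> (\<forall>m. f m = (l1 - m) * (l2 - m) * (l3 - m))"
proof -
  have e: "f m - (l1 - m) * (l2 - m) * (l3 - m) = (c0 - l1 * l2 * l3) + (c1 + l1 * l2 + l1 * l3 + l2 * l3) * m +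
      (c2 - l1 - l2 - l3) * m^2 + (1 - s) * m^3" for m
    unfolding assms(1) by (simp add: algebra_simps power2_eq_square power3_eq_cube)
  then have z: "c0 - l1 * l2 * l3 = 0 \<and> c1 + l1 * l2 + l1 * l3 + l2 * l3 = 0 \<and> c2 - l1 - l2 - l3 = 0 \<and> 1 - s = 0"
    using assms(2) by (intro cubic_four_zeros[of "{A, B, C, - E}"]) (auto simp flip: e simp: ax_distinct simp del: insert_iff)
  then have "f m - (l1 - m) * (l2 - m) * (l3 - m) = 0" for m
    unfolding e by simp
  then show ?thesis using z by simp
qed

lemma pel_at_axes:
  "pel p A = - ((p$1)^2 / A * ((A - B) * (A - C) * (A + E)))"
  "pel p B = (p$2)^2 / B * ((A - B) * (B - C) * (B + E))"
  "pel p C = - ((p$3)^2 / C * ((A - C) * (B - C) * (C + E)))"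
  "pel p (- E) = - ((p$4)^2 / E * ((A + E) * (B + E) * (C + E)))"
  by (simp_all add: pel_def algebra_simps)

lemma ell_in_Q: "ell p l1 l2 l3 \<Longrightarrow> p \<in> Q"
  using pel_coeffs[of p] cubic_eq_at_axes[of "pel p"] unfolding ell_def Q_iff_coords by metis

lemma pel_ell: "ell p l1 l2 l3 \<Longrightarrow> pel p m = (l1 - m) * (l2 - m) * (l3 - m)"
  by (simp add: ell_def)

text \<open>At a squared semi-axis only one summand of \<open>pel\<close> survives, and it contains
  the square of the corresponding coordinate.\<close>

lemma ell_coords:
  assumes "ell p l1 l2 l3"
  shows "(p$1)^2 * ((A - B) * (A - C) * (A + E)) = A * ((A - l1) * (A - l2) * (A - l3))"
    and "(p$2)^2 * ((A - B) * (B - C) * (B + E)) = B * ((B - l1) * (B - l2) * (l3 - B))"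
    and "(p$3)^2 * ((A - C) * (B - C) * (C + E)) = C * ((C - l1) * (l2 - C) * (l3 - C))"
    and "(p$4)^2 * ((A + E) * (B + E) * (C + E)) = E * ((- E - l1) * (l2 + E) * (l3 + E))"
proof goal_cases
  case 1
  show ?case using pel_ell[OF assms, of A] ABCE by (simp add: pel_at_axes field_simps)
next
  case 2
  show ?case using pel_ell[OF assms, of B] ABCE by (simp add: pel_at_axes field_simps)
next
  case 3
  show ?case using pel_ell[OF assms, of C] ABCE by (simp add: pel_at_axes field_simps)
next
  case 4
  show ?case using pel_ell[OF assms, of "- E"] ABCE by (simp add: pel_at_axes field_simps)
qed

text \<open>Here the second coordinate of \<open>p\<close> is 0, and \<open>l\<close> is the
  elliptic coordinate left over besides \<open>B\<close>. The factor that \<open>B\<close>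
  contributes on the right of \<open>ell_coords\<close> cancels against one on the left.\<close>

lemma plane_coords:
  assumes e: "ell p l1 l2 l3" and l: "l2 = B \<and> l = l3 \<or> l3 = B \<and> l = l2"
  shows "(p$1)^2 = A * ((A - l1) * (A - l)) / ((A - C) * (A + E))"
    and "(p$3)^2 = C * ((C - l1) * (l - C)) / ((A - C) * (C + E))"
    and "(p$4)^2 = E * ((- E - l1) * (l + E)) / ((A + E) * (C + E))"
proof -
  have cancel: "x = w / k" if "x * (D * k) = D * w" "D \<noteq> 0" "k \<noteq> 0" for x D k w :: real
    using that by (simp add: eq_divide_eq)
  show "(p$1)^2 = A * ((A - l1) * (A - l)) / ((A - C) * (A + E))"
    using ell_coords(1)[OF e] l ABCE by (intro cancel[of _ "A - B"]) (auto simp: mult_ac)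
  show "(p$3)^2 = C * ((C - l1) * (l - C)) / ((A - C) * (C + E))"
    using ell_coords(3)[OF e] l ABCE by (intro cancel[of _ "B - C"]) (auto simp: mult_ac)
  show "(p$4)^2 = E * ((- E - l1) * (l + E)) / ((A + E) * (C + E))"
    using ell_coords(4)[OF e] l ABCE by (intro cancel[of _ "B + E"]) (auto simp: mult_ac)
qed

lemma ellI:
  assumes "l1 \<le> - E" "C \<le> l2" "l2 \<le> B" "B \<le> l3" "l3 \<le> A"
    and "(p$1)^2 * ((A - B) * (A - C) * (A + E)) = A * ((A - l1) * (A - l2) * (A - l3))"
    and "(p$2)^2 * ((A - B) * (B - C) * (B + E)) = B * ((B - l1) * (B - l2) * (l3 - B))"
    and "(p$3)^2 * ((A - C) * (B - C) * (C + E)) = C * ((C - l1) * (l2 - C) * (l3 - C))"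
    and "(p$4)^2 * ((A + E) * (B + E) * (C + E)) = E * ((- E - l1) * (l2 + E) * (l3 + E))"
  shows "ell p l1 l2 l3"
proof -
  have d: "x / u * k = w" if "x * k = u * w" "u > 0" for x u k w :: real
    using that by simp
  obtain c0 c1 c2 where "\<And>m. pel p m = - ((p$1)^2 / A + (p$2)^2 / B + (p$3)^2 / C - (p$4)^2 / E) * m^3 + c2 * m^2 + c1 * m + c0"
    using pel_coeffs[of p] by blast
  moreover have "pel p m = (l1 - m) * (l2 - m) * (l3 - m)" if "m \<in> {A, B, C, - E}" for m
  proof -
    have "pel p A = (l1 - A) * (l2 - A) * (l3 - A)"
      unfolding pel_at_axes d[OF assms(6) ABCE(5)] by (simp add: algebra_simps)
    moreover have "pel p B = (l1 - B) * (l2 - B) * (l3 - B)"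
      unfolding pel_at_axes d[OF assms(7) ABCE(6)] by (simp add: algebra_simps)
    moreover have "pel p C = (l1 - C) * (l2 - C) * (l3 - C)"
      unfolding pel_at_axes d[OF assms(8) ABCE(3)] by (simp add: algebra_simps)
    moreover have "pel p (- E) = (l1 - - E) * (l2 - - E) * (l3 - - E)"
      unfolding pel_at_axes d[OF assms(9) ABCE(4)] by (simp add: algebra_simps)
    ultimately show ?thesis using that by blast
  qed
  ultimately have "\<forall>m. pel p m = (l1 - m) * (l2 - m) * (l3 - m)"
    by (rule cubic_eq_at_axes[THEN conjunct2])
  then show ?thesis using assms(1-5) by (simp add: ell_def)
qed

text \<open>The signs of \<open>pel p\<close> at the squared semi-axes and far to the left enclose
  the roots. Only \<open>l1\<close> is taken from the intermediate value theorem: used on both sides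
  of \<open>B\<close>, it could return \<open>B\<close> twice although \<open>B\<close> need not be
  a double root. Instead the linear factor is split off and the quadratic factor is solved
  explicitly.\<close>

lemma ell_exists:
  assumes "p \<in> Q"
  shows "\<exists>l1 l2 l3. ell p l1 l2 l3"
proof -
  obtain c0 c1 c2 where "\<And>m. pel p m = - ((p$1)^2 / A + (p$2)^2 / B + (p$3)^2 / C - (p$4)^2 / E) * m^3 + c2 * m^2 + c1 * m + c0"
    using pel_coeffs[of p] by blast
  then have cub: "pel p m = - (m^3) + c2 * m^2 + c1 * m + c0" for m
    by (simp only: assms[unfolded Q_iff_coords])
  have sA: "pel p A \<le> 0" and sB: "pel p B \<ge> 0" and sC: "pel p C \<le> 0" and sE: "pel p (- E) \<le> 0"
    using ABCE by (auto simp: pel_at_axes)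
  obtain M where M: "M \<le> - E" "pel p M > 0"
    using cubic_positive_left[of "- E" c2 c1 c0] cub by metis
  have "continuous_on {M..- E} (pel p)"
    unfolding cub by (intro continuous_intros)
  then obtain l1 where l1: "M \<le> l1" "l1 \<le> - E" "pel p l1 = 0"
    using IVT2'[of "pel p" "- E" 0 M] M sE by auto
  define e f where "e = l1 - c2" and "f = l1^2 - c2 * l1 - c1"
  have quad: "pel p m = (l1 - m) * (m^2 + e * m + f)" for m
  proof -
    have "c0 = l1 * f"
      using l1(3) by (simp add: cub f_def algebra_simps power2_eq_square power3_eq_cube)
    then show ?thesis
      by (simp add: cub e_def f_def algebra_simps power2_eq_square power3_eq_cube)
  qed
  have l1_less: "l1 < C" "l1 < B" "l1 < A" using l1 ABCE by auto
  have qA: "A^2 + e * A + f \<ge> 0" and qB: "B^2 + e * B + f \<le> 0" and qC: "C^2 + e * C + f \<ge> 0"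
    using sA sB sC l1_less unfolding quad by (auto simp: mult_le_0_iff zero_le_mult_iff)
  define r where "r = sqrt (e^2 - 4 * f)"
  \<comment> \<open>Completing the square at \<open>B\<close>, where the quadratic factor is
    nonpositive, shows that the discriminant is nonnegative.\<close>
  have "0 \<le> (2 * B + e)^2 + 4 * (- (B^2 + e * B + f))"
    by (rule add_nonneg_nonneg, simp) (rule mult_nonneg_nonneg, simp, simp only: neg_0_le_iff_le, rule qB)
  also have "\<dots> = e^2 - 4 * f" by (simp add: algebra_simps power2_eq_square)
  finally have "e^2 - 4 * f \<ge> 0" .
  then have r: "r^2 = e^2 - 4 * f" "r \<ge> 0" by (simp_all add: r_def)
  define l2 l3 where "l2 = (- e - r) / 2" and "l3 = (- e + r) / 2"
  have q: "m^2 + e * m + f = (l2 - m) * (l3 - m)" for m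
  proof -
    have ef: "e = - (l2 + l3)" "f = l2 * l3"
      using r(1) by (simp_all add: l2_def l3_def field_simps power2_eq_square)
    show ?thesis unfolding ef by (simp add: algebra_simps power2_eq_square)
  qed
  have l23: "l2 \<le> l3" using r by (simp add: l2_def l3_def)
  have "l2 \<le> B" "B \<le> l3"
    using qB l23 unfolding q by (auto simp: mult_le_0_iff)
  moreover have "C \<le> l2"
    using qC \<open>B \<le> l3\<close> ABCE unfolding q by (auto simp: zero_le_mult_iff)
  moreover have "l3 \<le> A"
    using qA \<open>l2 \<le> B\<close> ABCE unfolding q by (auto simp: zero_le_mult_iff)
  ultimately have "ell p l1 l2 l3"
    using l1 quad q by (simp add: ell_def mult.assoc)
  then show ?thesis by blast
qed

text \<open>At \<open>l1\<close>, which is negative, the second product can vanish only through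
  \<open>m1\<close>, as \<open>m2\<close> and \<open>m3\<close> are positive. After division by the
  common factor, the values at \<open>A\<close> and \<open>C\<close> give the sum of the other two
  roots.\<close>

lemma ell_unique:
  assumes l: "ell p l1 l2 l3" and m: "ell p m1 m2 m3"
  shows "l1 = m1 \<and> l2 = m2 \<and> l3 = m3"
proof -
  have lr: "l1 \<le> - E" "C \<le> l2" "l2 \<le> B" "B \<le> l3" and mr: "m1 \<le> - E" "C \<le> m2" "m2 \<le> B" "B \<le> m3"
    using l m by (auto simp: ell_def)
  have eq: "(l1 - x) * (l2 - x) * (l3 - x) = (m1 - x) * (m2 - x) * (m3 - x)" for x
    using l m unfolding ell_def by metis
  have 1: "l1 = m1"
    using eq[of l1] lr mr ABCE by auto
  have eq2: "(l2 - x) * (l3 - x) = (m2 - x) * (m3 - x)" if "x \<ge> C" for x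
    using eq[of x] 1 that lr ABCE by (simp add: mult.assoc)
  have "l2 + l3 = m2 + m3"
  proof -
    have "(A - C) * (l2 + l3) = (A - C) * (m2 + m3)"
      using eq2[of A] eq2[of C] ABCE by (simp add: algebra_simps)
    then show ?thesis using ABCE by simp
  qed
  moreover have "l2 = m2 \<or> l2 = m3"
    using eq2[of l2] lr by auto
  ultimately show ?thesis using 1 lr mr by auto
qed

definition L1 where "L1 p = (THE l1. \<exists>l2 l3. ell p l1 l2 l3)"
definition L2 where "L2 p = (THE l2. \<exists>l1 l3. ell p l1 l2 l3)"
definition L3 where "L3 p = (THE l3. \<exists>l1 l2. ell p l1 l2 l3)"

lemma L_eqI:
  assumes "ell p l1 l2 l3"
  shows "L1 p = l1" "L2 p = l2" "L3 p = l3"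
  unfolding L1_def L2_def L3_def using assms ell_unique by (blast intro: the_equality)+

lemma ell_L: "p \<in> Q \<Longrightarrow> ell p (L1 p) (L2 p) (L3 p)"
  using ell_exists L_eqI by metis

lemma L_bounds:
  assumes "p \<in> Q"
  shows "L1 p \<le> - E" "C \<le> L2 p" "L2 p \<le> B" "B \<le> L3 p" "L3 p \<le> A"
    "L1 p < 0" "L2 p > 0" "L3 p > 0"
  using ell_L[OF assms] ABCE by (auto simp: ell_def)

lemma pel_L: "p \<in> Q \<Longrightarrow> pel p m = (L1 p - m) * (L2 p - m) * (L3 p - m)"
  using ell_L by (simp add: ell_def)

lemma tendsto_pel: "((\<lambda>q. pel q m) \<longlongrightarrow> pel p m) (at p within S)"
  unfolding pel_def by (intro tendsto_intros) (use ABCE in auto)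

text \<open>Each coordinate is compared with a number \<open>m\<close> in the interior of its range by the sign of the
  polynomial at \<open>m\<close>, which depends continuously on the point.\<close>

lemma continuous_on_by_sign:
  assumes "\<And>m. (\<forall>p\<in>Q. m \<le> f p) \<or> (\<forall>p\<in>Q. f p \<le> m) \<or>
    (\<forall>p\<in>Q. (m < f p \<longleftrightarrow> 0 < \<sigma> * pel p m) \<and> (f p < m \<longleftrightarrow> \<sigma> * pel p m < 0))"
  shows "continuous_on Q f"
  unfolding continuous_on_def
proof (intro ballI order_tendstoI)
  fix p y assume p: "p \<in> Q"
  have ev: "\<forall>\<^sub>F q in at p within Q. q \<in> Q" by (simp add: eventually_at_filter)
  have lim: "((\<lambda>q. \<sigma> * pel q m) \<longlongrightarrow> \<sigma> * pel p m) (at p within Q)" for m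
    by (intro tendsto_intros tendsto_pel)
  {
    assume "y < f p"
    then obtain m where m: "y < m" "m < f p" using dense by blast
    from assms[of m] consider "\<forall>p\<in>Q. m \<le> f p" | "\<forall>p\<in>Q. m < f p \<longleftrightarrow> 0 < \<sigma> * pel p m"
      using p m by fastforce
    then show "\<forall>\<^sub>F q in at p within Q. y < f q"
    proof cases
      case 1
      then show ?thesis using ev m by (auto elim!: eventually_mono)
    next
      case 2
      then have "0 < \<sigma> * pel p m" using p m by blast
      from order_tendstoD(1)[OF lim this] ev show ?thesis
        by eventually_elim (use 2 m in fastforce)
    qed
  }
  assume "f p < y"
  then obtain m where m: "f p < m" "m < y" using dense by blast
  from assms[of m] consider "\<forall>p\<in>Q. f p \<le> m" | "\<forall>p\<in>Q. f p < m \<longleftrightarrow> \<sigma> * pel p m < 0"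
    using p m by fastforce
  then show "\<forall>\<^sub>F q in at p within Q. f q < y"
  proof cases
    case 1
    then show ?thesis using ev m by (auto elim!: eventually_mono)
  next
    case 2
    then have "\<sigma> * pel p m < 0" using p m by blast
    from order_tendstoD(2)[OF lim this] ev show ?thesis
      by eventually_elim (use 2 m in fastforce)
  qed
qed

lemma continuous_on_L1: "continuous_on Q L1"
proof (rule continuous_on_by_sign[where \<sigma> = "1"], goal_cases)
  case (1 m)
  have "(m < L1 p \<longleftrightarrow> 0 < 1 * pel p m) \<and> (L1 p < m \<longleftrightarrow> 1 * pel p m < 0)" if "m < - E" "p \<in> Q" for p
    using L_bounds[OF \<open>p \<in> Q\<close>] that ABCE by (auto simp: pel_L zero_less_mult_iff mult_less_0_iff)
  moreover have "L1 p \<le> m" if "- E \<le> m" "p \<in> Q" for p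
    using L_bounds[OF that(2)] that(1) by linarith
  ultimately show ?case by (meson not_le)
qed

text \<open>The sign is that of the product of the two other factors. For \<open>m\<close> between
  \<open>C\<close> and \<open>B\<close> these have opposite signs, whereas they have equal signs in
  the cases of \<open>L1\<close> and \<open>L3\<close>.\<close>

lemma continuous_on_L2: "continuous_on Q L2"
proof (rule continuous_on_by_sign[where \<sigma> = "- 1"], goal_cases)
  case (1 m)
  have "(m < L2 p \<longleftrightarrow> 0 < - 1 * pel p m) \<and> (L2 p < m \<longleftrightarrow> - 1 * pel p m < 0)" if "C < m" "m < B" "p \<in> Q" for p
    using L_bounds[OF \<open>p \<in> Q\<close>] that ABCE by (auto simp: pel_L zero_less_mult_iff mult_less_0_iff)
  moreover have "m \<le> L2 p" if "m \<le> C" "p \<in> Q" for p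
    using L_bounds[OF that(2)] that(1) by linarith
  moreover have "L2 p \<le> m" if "B \<le> m" "p \<in> Q" for p
    using L_bounds[OF that(2)] that(1) by linarith
  ultimately show ?case by (meson not_le)
qed

lemma continuous_on_L3: "continuous_on Q L3"
proof (rule continuous_on_by_sign[where \<sigma> = "1"], goal_cases)
  case (1 m)
  have "(m < L3 p \<longleftrightarrow> 0 < 1 * pel p m) \<and> (L3 p < m \<longleftrightarrow> 1 * pel p m < 0)" if "B < m" "m < A" "p \<in> Q" for p
    using L_bounds[OF \<open>p \<in> Q\<close>] that ABCE by (auto simp: pel_L zero_less_mult_iff mult_less_0_iff)
  moreover have "m \<le> L3 p" if "m \<le> B" "p \<in> Q" for p
    using L_bounds[OF that(2)] that(1) by linarith
  moreover have "L3 p \<le> m" if "A \<le> m" "p \<in> Q" for p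
    using L_bounds[OF that(2)] that(1) by linarith
  ultimately show ?case by (meson not_le)
qed

end

section \<open>Principal directions and principal curvatures in terms of elliptic
  coordinates\<close>

lemma sum_four_fractions:
  fixes u :: real
  assumes "u \<noteq> 0" "v \<noteq> 0" "w \<noteq> 0" "s \<noteq> 0"
  shows "x / u + y / v + z / w - t / s =
    (x * (v * w * s) + y * (u * w * s) + z * (u * v * s) - t * (u * v * w)) / (u * v * w * s)"
  using assms by (simp add: divide_simps) (simp add: algebra_simps)

context quadric
begin

lemma Q_nonzero:
  assumes "p \<in> Q"
  obtains i where "i \<noteq> 4" "p$i \<noteq> 0"
proof -
  have "p$1 \<noteq> 0 \<or> p$2 \<noteq> 0 \<or> p$3 \<noteq> 0"
  proof (rule ccontr)
    assume "\<not> ?thesis"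
    then have "- ((p$4)^2 / E) = 1" using assms by (simp add: Q_iff_coords)
    moreover have "(p$4)^2 / E \<ge> 0" using ABCE by simp
    ultimately show False by linarith
  qed
  then show thesis using that[of 1] that[of 2] that[of 3] by auto
qed

text \<open>If \<open>l\<close> is no squared semi-axis, then \<open>v$i = p$i / (l - ax$i)\<close>
  solves the equation of a principal direction, and tangency is the root condition divided by the
  product of the four factors. If \<open>l = ax$i\<close>, the root condition forces
  \<open>p$i = 0\<close>, and the \<open>i\<close>-th axis is a principal direction.\<close>

lemma eigdir_of_root:
  assumes p: "p \<in> Q" and root: "pel p l = 0"
  obtains v where "v \<noteq> 0" "eigdir p l v"
proof (cases "\<exists>i. l = ax$i")
  case True
  then obtain i where i: "l = ax$i" by blast
  have "p$i = 0"
    using root exhaust_4[of i] ABCE unfolding i by (auto simp: pel_at_axes)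
  then have "eigdir p l (axis i 1)"
    unfolding eigdir_def i
    using \<open>p$i = 0\<close> by (intro conjI exI[of _ 0]) (simp add: inner_axis', simp add: axis_def)
  then show thesis using that[of "axis i 1"] by (simp add: axis_eq_0_iff)
next
  case False
  then have ne: "l - ax$i \<noteq> 0" for i by auto
  define v :: "real^4" where "v = (\<chi> i. p$i / (l - ax$i))"
  have "v \<bullet> lam p = - ((p$1)^2 / A / (A - l) + (p$2)^2 / B / (B - l) + (p$3)^2 / C / (C - l)
      - (p$4)^2 / E / (- E - l))"
  proof -
    have "v$i * lam p$i = - ((p$i)^2 / ax$i / (ax$i - l))" for i
    proof -
      define u where "u = l - ax$i"
      have "v$i = p$i / u" "ax$i - l = - u" by (simp_all add: v_def u_def)
      then show ?thesis by (simp add: power2_eq_square)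
    qed
    from this[of 1] this[of 2] this[of 3] this[of 4] show ?thesis
      by (simp add: inner_vec_4 del: lam_nth)
  qed
  also have "\<dots> = - (pel p l / ((A - l) * (B - l) * (C - l) * (- E - l)))"
    using ne[of 1] ne[of 2] ne[of 3] ne[of 4]
    by (subst sum_four_fractions) (auto simp: pel_def)
  finally have "v \<bullet> lam p = 0" using root by simp
  then have "eigdir p l v"
    unfolding eigdir_def using ne by (intro conjI exI[of _ 1]) (simp_all add: v_def)
  moreover have "v \<noteq> 0"
  proof -
    obtain i where "p$i \<noteq> 0" using Q_nonzero[OF p] by blast
    then have "v$i \<noteq> 0" using ne[of i] by (simp add: v_def)
    then show ?thesis by auto
  qed
  ultimately show thesis using that by blast
qed

text \<open>At a point with \<open>L2 p = L3 p = B\<close> the second coordinate vanishes, so that the second axis is an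
  eigenvector as well as the one with \<open>v\<^sub>i = p\<^sub>i / (B - ax\<^sub>i)\<close> for \<open>i \<noteq> 2\<close>.\<close>

definition pu_dir :: "real^4 \<Rightarrow> real^4" where
  "pu_dir p = vector [p$1 / (B - A), 0, p$3 / (B - C), p$4 / (B + E)]"

lemma ell_BB_y: "ell p l B B \<Longrightarrow> p$2 = 0"
  using ell_coords(2)[of p l B B] ABCE by auto

text \<open>With the coordinates from \<open>plane_coords\<close>, tangency becomes a partial
  fraction identity in which \<open>B\<close> has cancelled.\<close>

lemma eigdir_pu_dir:
  assumes e: "ell p l B B"
  shows "eigdir p B (pu_dir p)" "pu_dir p \<noteq> 0"
proof -
  have y: "p$2 = 0" using ell_BB_y[OF e] .
  note c = plane_coords[OF e disjI1[OF conjI[OF refl refl]]]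
  have "pu_dir p \<bullet> lam p = (p$1)^2 / (A * (B - A)) + (p$3)^2 / (C * (B - C)) - (p$4)^2 / (E * (B + E))"
    by (simp add: pu_dir_def inner_vec_4 power2_eq_square mult.commute)
  also have "\<dots> = - ((A - l) / ((A - C) * (A + E))) + (C - l) / ((A - C) * (C + E)) + (E + l) / ((A + E) * (C + E))"
  proof -
    have "(p$1)^2 / (A * (B - A)) = - ((A - l) / ((A - C) * (A + E)))"
      unfolding c(1) using ABCE by (simp add: divide_simps) (simp add: algebra_simps)
    moreover have "(p$3)^2 / (C * (B - C)) = (C - l) / ((A - C) * (C + E))"
      unfolding c(2) using ABCE by (simp add: divide_simps)
    moreover have "(p$4)^2 / (E * (B + E)) = - ((E + l) / ((A + E) * (C + E)))"
      unfolding c(3) using ABCE by (simp add: divide_simps)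
    ultimately show ?thesis by simp
  qed
  also have "\<dots> = 0"
    using ABCE by (simp add: divide_simps) (simp add: algebra_simps)
  finally show "eigdir p B (pu_dir p)"
    unfolding eigdir_def using ABCE y
    by (intro conjI exI[of _ 1]) (auto simp: pu_dir_def forall_4)
  obtain i where i: "i \<noteq> 4" "p$i \<noteq> 0" using Q_nonzero[OF ell_in_Q[OF e]] by blast
  then have "p$1 \<noteq> 0 \<or> p$3 \<noteq> 0" using y exhaust_4[of i] by auto
  then have "pu_dir p $ 1 \<noteq> 0 \<or> pu_dir p $ 3 \<noteq> 0"
    using ABCE by (auto simp: pu_dir_def)
  then show "pu_dir p \<noteq> 0" by auto
qed

lemma eigdir_axis_2: "p$2 = 0 \<Longrightarrow> eigdir p B (axis 2 1)"
  unfolding eigdir_def by (intro conjI exI[of _ 0]) (simp add: inner_axis', simp add: axis_def forall_4)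

text \<open>The negative coordinate \<open>L1\<close> yields the smallest curvature, and taking
  reciprocals reverses the order of \<open>L2\<close> and \<open>L3\<close>; the rest is an
  orthogonal triple of principal directions.\<close>

lemma principal_curvatures_Q:
  assumes p: "p \<in> Q"
  shows "principal_curvatures Q N p =
    [1 / (L1 p * norm (lam p)), 1 / (L3 p * norm (lam p)), 1 / (L2 p * norm (lam p))]"
proof -
  note b = L_bounds[OF p]
  let ?n = "norm (lam p)"
  have n: "?n > 0" using lam_nonzero[OF p] by simp
  have tan: "v \<bullet> N p = 0 \<longleftrightarrow> v \<bullet> lam p = 0" for v
    using tangent_iff[OF p, of v] by (simp add: tangent_space_def)
  have Np: "N p \<noteq> 0" using n by (auto simp: N_eq)
  obtain v1 where v1: "v1 \<noteq> 0" "eigdir p (L1 p) v1"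
    using eigdir_of_root[OF p] pel_L[OF p, of "L1 p"] by auto
  obtain v2 v3 where v2: "v2 \<noteq> 0" "eigdir p (L2 p) v2" and v3: "v3 \<noteq> 0" "eigdir p (L3 p) v3"
    and o: "v3 \<bullet> v2 = 0"
  proof (cases "L2 p = L3 p")
    \<comment> \<open>Equal eigenvalues do not imply orthogonality, so the two directions in the
      eigenspace of \<open>B\<close> are chosen by hand.\<close>
    case True
    then have BB: "L2 p = B" "L3 p = B" using b by auto
    then have e: "ell p (L1 p) B B" using ell_L[OF p] by simp
    have "axis 2 (1::real) \<bullet> pu_dir p = 0" by (simp add: inner_axis' pu_dir_def)
    then show thesis
      using that[of "pu_dir p" "axis 2 1"] eigdir_pu_dir[OF e] eigdir_axis_2[OF ell_BB_y[OF e]] BB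
      by (simp add: axis_eq_0_iff)
  next
    case False
    obtain v2 where v2: "v2 \<noteq> 0" "eigdir p (L2 p) v2"
      using eigdir_of_root[OF p] pel_L[OF p, of "L2 p"] by auto
    moreover obtain v3 where v3: "v3 \<noteq> 0" "eigdir p (L3 p) v3"
      using eigdir_of_root[OF p] pel_L[OF p, of "L3 p"] by auto
    moreover have "v3 \<bullet> v2 = 0"
      using False b by (intro eigdir_orthogonal[OF p v3(2) v2(2)]) auto
    ultimately show thesis using that by blast
  qed
  have o12: "v1 \<bullet> v3 = 0" "v1 \<bullet> v2 = 0"
    using b eigdir_orthogonal[OF p v1(2) v3(2)] eigdir_orthogonal[OF p v1(2) v2(2)] by auto
  have t: "v1 \<bullet> lam p = 0" "v2 \<bullet> lam p = 0" "v3 \<bullet> lam p = 0"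
    using v1 v2 v3 by (auto simp: eigdir_def)
  show ?thesis
  proof (rule principal_curvatures_eqI[where S = "shp p"])
    show "N p \<noteq> 0" "linear (shp p)" by (fact Np, rule linear_shp)
    show "shape_operator Q N p v = shp p v" if "v \<bullet> N p = 0" for v
      using shape_operator_eq[OF p] that tan by simp
    show "v1 \<bullet> N p = 0" "v3 \<bullet> N p = 0" "v2 \<bullet> N p = 0" using t tan by auto
    show "v1 \<noteq> 0" "v3 \<noteq> 0" "v2 \<noteq> 0" by fact+
    show "v1 \<bullet> v3 = 0" "v1 \<bullet> v2 = 0" "v3 \<bullet> v2 = 0" by fact+
    show "shp p v1 = (1 / (L1 p * ?n)) *\<^sub>R v1" "shp p v3 = (1 / (L3 p * ?n)) *\<^sub>R v3"
      "shp p v2 = (1 / (L2 p * ?n)) *\<^sub>R v2"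
      using shp_eigen_iff[OF p] t v1 v2 v3 b by auto
    have "1 / (L1 p * ?n) \<le> 0" "0 \<le> 1 / (L3 p * ?n)"
      using b n by (simp_all add: divide_le_0_iff mult_le_0_iff)
    then show "1 / (L1 p * ?n) \<le> 1 / (L3 p * ?n)" by linarith
    show "1 / (L3 p * ?n) \<le> 1 / (L2 p * ?n)"
      using b n by (intro divide_left_mono mult_right_mono mult_pos_pos) auto
  qed
qed

lemma principal_curvature_Q:
  assumes "p \<in> Q"
  shows "principal_curvature Q N (Suc 0) p = 1 / (L1 p * norm (lam p))"
    and "principal_curvature Q N 2 p = 1 / (L3 p * norm (lam p))"
    and "principal_curvature Q N 3 p = 1 / (L2 p * norm (lam p))"
  by (simp_all add: principal_curvature_def principal_curvatures_Q[OF assms])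

lemma principal_curvature_12:
  assumes "p \<in> Q"
  shows "principal_curvature Q N (Suc 0) p < principal_curvature Q N 2 p"
proof -
  have n: "norm (lam p) > 0" using lam_nonzero[OF assms] by simp
  have "1 / (L1 p * norm (lam p)) < 0" "0 < 1 / (L3 p * norm (lam p))"
    using L_bounds[OF assms] n by (simp_all add: divide_less_0_iff mult_less_0_iff)
  then show ?thesis unfolding principal_curvature_Q[OF assms] by linarith
qed

lemma principal_curvature_23:
  assumes "p \<in> Q"
  shows "principal_curvature Q N 2 p = principal_curvature Q N 3 p \<longleftrightarrow> L2 p = L3 p"
  using L_bounds[OF assms] lam_nonzero[OF assms] by (auto simp: principal_curvature_Q[OF assms])

lemma umbilic_set_Q: "umbilic_set Q N = {}"
  using principal_curvature_12 by (force simp: umbilic_set_def)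

lemma P12_set_Q: "P12_set Q N = {}"
  using principal_curvature_12 by (force simp: P12_set_def)

lemma P23_set_Q: "P23_set Q N = {p \<in> Q. L2 p = L3 p}"
  using principal_curvature_12 principal_curvature_23 by (auto simp: P23_set_def)

lemma partially_umbilic_set_Q: "partially_umbilic_set Q N = {p \<in> Q. L2 p = L3 p}"
  by (simp add: partially_umbilic_set_def P12_set_Q P23_set_Q)

lemma foliation_domain_Q:
  "foliation_domain Q N (Suc 0) = Q"
  "foliation_domain Q N 2 = {p \<in> Q. L2 p < L3 p}"
  "foliation_domain Q N 3 = {p \<in> Q. L2 p < L3 p}"
  using L_bounds by (fastforce simp: foliation_domain_def umbilic_set_Q P12_set_Q P23_set_Q)+

text \<open>The value of the elliptic coordinate that varies along the \<open>k\<close>-th principal lines.\<close>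

definition Lk :: "nat \<Rightarrow> real^4 \<Rightarrow> real" where
  "Lk k = (if k = 1 then L1 else if k = 2 then L3 else L2)"

lemma Lk_simps [simp]: "Lk (Suc 0) = L1" "Lk 2 = L3" "Lk 3 = L2"
  by (simp_all add: Lk_def)

lemma eigenline_field_Q:
  assumes "p \<in> Q" "k \<in> {1, 2, 3}"
  shows "eigenline_field Q N k p = {v. eigdir p (Lk k p) v}"
  using assms eigenspace_eq[OF assms(1)] principal_curvature_Q[OF assms(1)] L_bounds[OF assms(1)]
  by (auto simp: eigenline_field_def)

end

section \<open>Principal lines\<close>

text \<open>In the application \<open>F s\<close> is the cubic of the moving point, evaluated at the
  fixed number \<open>l s0\<close>. Dividing it by the other two factors recovers
  \<open>l s - l s0\<close>; since these factors have nonzero limits, continuity of the other roots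
  suffices to differentiate a simple root.\<close>

lemma simple_root_has_derivative:
  fixes l a b F :: "real \<Rightarrow> real"
  assumes "open I" "s0 \<in> I"
    and F: "\<And>s. s \<in> I \<Longrightarrow> F s = (l s - l s0) * (a s - l s0) * (b s - l s0)"
    and D: "(F has_real_derivative D) (at s0)"
    and a: "isCont a s0" "a s0 \<noteq> l s0" and b: "isCont b s0" "b s0 \<noteq> l s0"
  shows "(l has_real_derivative D / ((a s0 - l s0) * (b s0 - l s0))) (at s0)"
  unfolding has_field_derivative_iff
proof (rule Lim_transform_eventually)
  have ta: "((\<lambda>s. a s - l s0) \<longlongrightarrow> a s0 - l s0) (at s0)"
    by (rule tendsto_diff[OF a(1)[unfolded isCont_def] tendsto_const])
  have tb: "((\<lambda>s. b s - l s0) \<longlongrightarrow> b s0 - l s0) (at s0)"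
    by (rule tendsto_diff[OF b(1)[unfolded isCont_def] tendsto_const])
  show "((\<lambda>s. (F s - F s0) / (s - s0) / ((a s - l s0) * (b s - l s0))) \<longlongrightarrow>
      D / ((a s0 - l s0) * (b s0 - l s0))) (at s0)"
    by (rule tendsto_divide[OF D[unfolded has_field_derivative_iff] tendsto_mult[OF ta tb]])
       (use a b in simp)
  have "\<forall>\<^sub>F s in at s0. s \<in> I" using assms(1,2) by (rule eventually_at_in_open')
  moreover have "\<forall>\<^sub>F s in at s0. a s - l s0 \<noteq> 0" using ta a by (intro tendsto_imp_eventually_ne) auto
  moreover have "\<forall>\<^sub>F s in at s0. b s - l s0 \<noteq> 0" using tb b by (intro tendsto_imp_eventually_ne) auto
  ultimately show "\<forall>\<^sub>F s in at s0. (F s - F s0) / (s - s0) / ((a s - l s0) * (b s - l s0)) =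
      (l s - l s0) / (s - s0)"
  proof eventually_elim
    case (elim s)
    then show ?case using F[of s] F[of s0] assms(2) by simp
  qed
qed

text \<open>The logarithmic derivatives satisfy \<open>x' / x = w' / (2 * w)\<close>; the relation
  is stated as a product so that \<open>x\<close> may have zeros.\<close>

lemma ratio_sqrt_constant:
  fixes x w :: "real \<Rightarrow> real"
  assumes "is_interval I"
    and "\<And>s. s \<in> I \<Longrightarrow> (x has_real_derivative x' s) (at s)"
    and "\<And>s. s \<in> I \<Longrightarrow> (w has_real_derivative w' s) (at s)"
    and "\<And>s. s \<in> I \<Longrightarrow> w s > 0" "\<And>s. s \<in> I \<Longrightarrow> 2 * x' s * w s = w' s * x s"
    and "s \<in> I" "s0 \<in> I"
  shows "x s / sqrt (w s) = x s0 / sqrt (w s0)"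
proof -
  have "\<exists>c. \<forall>s\<in>I. x s / sqrt (w s) = c"
  proof (rule has_field_derivative_zero_constant)
    show "convex I" using assms(1) by (rule is_interval_convex)
  next
    fix s assume s: "s \<in> I"
    let ?r = "sqrt (w s)"
    have r: "?r > 0" "?r * ?r = w s" using assms(4)[OF s] by auto
    have "((\<lambda>s. sqrt (w s)) has_real_derivative inverse ?r / 2 * w' s) (at s)"
      by (rule DERIV_chain2[OF DERIV_real_sqrt[OF assms(4)[OF s]] assms(3)[OF s]])
    then have "((\<lambda>s. x s / sqrt (w s)) has_real_derivative
        (x' s * ?r - x s * (inverse ?r / 2 * w' s)) / (?r * ?r)) (at s)"
      using r by (intro DERIV_divide assms(2)[OF s]) auto
    moreover have "x' s * ?r - x s * (inverse ?r / 2 * w' s) = 0"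
    proof -
      have "2 * ?r * (x' s * ?r - x s * (inverse ?r / 2 * w' s)) = 2 * x' s * (?r * ?r) - w' s * x s"
        using r(1) by (simp add: field_simps)
      also have "\<dots> = 0" unfolding r(2) using assms(5)[OF s] by simp
      finally show ?thesis using r(1) by simp
    qed
    ultimately have "((\<lambda>s. x s / sqrt (w s)) has_real_derivative 0) (at s)"
      by (simp only: div_0)
    then show "((\<lambda>s. x s / sqrt (w s)) has_real_derivative 0) (at s within I)"
      by (rule has_field_derivative_at_within)
  qed
  then show ?thesis using assms(6,7) by metis
qed

text \<open>A monic quadratic polynomial is determined by its values at two points.\<close>

lemma pair_eq_if_products_eq:
  fixes x y x' y' :: real
  assumes "(u - x) * (u - y) = (u - x') * (u - y')" "(v - x) * (v - y) = (v - x') * (v - y')"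
    and "u \<noteq> v" "x \<le> y" "x' \<le> y'"
  shows "x = x' \<and> y = y'"
proof -
  have "(u - v) * (x + y) = (u - v) * (x' + y')"
    using assms(1,2) by (simp add: algebra_simps)
  then have s: "x + y = x' + y'" using assms(3) by simp
  have e: "(u - x) * (u - y) = u^2 - u * (x + y) + x * y" for x y :: real
    by (simp add: algebra_simps power2_eq_square)
  have p: "x * y = x' * y'" using assms(1) unfolding e s by simp
  have "(x - x') * (x - y') = x * x - x * (x' + y') + x' * y'" by (simp add: algebra_simps)
  also have "\<dots> = 0" unfolding s[symmetric] p[symmetric] by (simp add: algebra_simps)
  finally have "(x - x') * (x - y') = 0" .
  then show ?thesis using s assms(4,5) by auto
qed

lemma has_vector_derivative_vector_4:
  assumes "(f1 has_real_derivative g1) (at s)" "(f2 has_real_derivative g2) (at s)"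
    "(f3 has_real_derivative g3) (at s)" "(f4 has_real_derivative g4) (at s)"
  shows "((\<lambda>s. vector [f1 s, f2 s, f3 s, f4 s] :: real^4) has_vector_derivative vector [g1, g2, g3, g4]) (at s)"
  unfolding vector_4_axis using assms
  by (auto intro!: derivative_eq_intros simp: has_real_derivative_iff_has_vector_derivative)

lemma continuous_on_vector_4:
  assumes "continuous_on S f1" "continuous_on S f2" "continuous_on S f3" "continuous_on S f4"
  shows "continuous_on S (\<lambda>s. vector [f1 s, f2 s, f3 s, f4 s] :: real^4)"
  unfolding vector_4_axis using assms by (intro continuous_intros)

lemma has_vector_derivative_vec_nth:
  assumes "(g has_vector_derivative v) F"
  shows "((\<lambda>s. g s $ i) has_vector_derivative v $ i) F"
  using bounded_linear.has_vector_derivative[OF bounded_linear_vec_nth assms] .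

text \<open>The last premise confines every integral curve through \<open>p\<close> to one explicit
  curve; it takes the place of the uniqueness of maximal solutions.\<close>

lemma leaf_eqI:
  assumes "integral_curve M N k J \<Gamma>" "p \<in> \<Gamma> ` J"
    and "\<And>g I s0 s. integral_curve M N k I g \<Longrightarrow> s0 \<in> I \<Longrightarrow> g s0 = p \<Longrightarrow> s \<in> I \<Longrightarrow> g s \<in> \<Gamma> ` J"
  shows "leaf M N k p = \<Gamma> ` J"
proof
  show "leaf M N k p \<subseteq> \<Gamma> ` J"
    unfolding leaf_def using assms(3) by fast
  show "\<Gamma> ` J \<subseteq> leaf M N k p"
    unfolding leaf_def using assms(1,2) by blast
qed

context quadric
begin

lemma curve_in_Q_tangent:
  assumes "open I" "s \<in> I" "\<And>s. s \<in> I \<Longrightarrow> g s \<in> Q" "(g has_vector_derivative v) (at s)"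
  shows "v \<bullet> lam (g s) = 0"
proof -
  have "((\<lambda>s. g s \<bullet> lam (g s)) has_derivative (\<lambda>h. g s \<bullet> lam (h *\<^sub>R v) + (h *\<^sub>R v) \<bullet> lam (g s))) (at s)"
    using assms(4) unfolding has_vector_derivative_def
    by (intro has_derivative_inner bounded_linear.has_derivative[OF bounded_linear_lam])
  moreover have "((\<lambda>s. g s \<bullet> lam (g s)) has_derivative (\<lambda>h. 0)) (at s)"
    by (rule has_derivative_transform_within_open[of "\<lambda>s. 1" _ _ _ I])
       (use assms in \<open>auto simp: Q_iff\<close>)
  ultimately have "(\<lambda>h. g s \<bullet> lam (h *\<^sub>R v) + (h *\<^sub>R v) \<bullet> lam (g s)) = (\<lambda>h. 0)"
    by (rule has_derivative_unique)
  from fun_cong[OF this, of 1] show ?thesis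
    using inner_lam_commute[of "g s" v] by simp
qed

text \<open>Tangency of the velocity follows from \<open>curve_in_Q_tangent\<close>, so only the
  coordinate equations with a common multiplier \<open>\<nu> s\<close> have to be checked.\<close>

lemma integral_curveI:
  assumes "open I" "is_interval I" "k \<in> {1, 2, 3}"
    and dom: "\<And>s. s \<in> I \<Longrightarrow> \<Gamma> s \<in> foliation_domain Q N k"
    and deriv: "\<And>s. s \<in> I \<Longrightarrow> (\<Gamma> has_vector_derivative v s) (at s)"
    and "continuous_on I v" "\<And>s. s \<in> I \<Longrightarrow> v s \<noteq> 0"
    and eig: "\<And>s i. s \<in> I \<Longrightarrow> v s $ i * (Lk k (\<Gamma> s) - ax $ i) = \<nu> s * \<Gamma> s $ i"
  shows "integral_curve Q N k I \<Gamma>"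
proof -
  have Q: "\<Gamma> s \<in> Q" if "s \<in> I" for s
    using dom[OF that] \<open>k \<in> {1, 2, 3}\<close> by (auto simp: foliation_domain_Q)
  have "v s \<in> eigenline_field Q N k (\<Gamma> s)" if "s \<in> I" for s
    using eig[OF that] curve_in_Q_tangent[OF \<open>open I\<close> that Q deriv[OF that]]
    by (auto simp: eigenline_field_Q[OF Q[OF that] \<open>k \<in> {1, 2, 3}\<close>] eigdir_def)
  then show ?thesis
    unfolding integral_curve_def using assms by blast
qed

section \<open>Variation of the elliptic coordinates along principal lines\<close>

definition dpel :: "real^4 \<Rightarrow> real^4 \<Rightarrow> real \<Rightarrow> real" where
  "dpel p v m = 2 * (p$1 * v$1 / A * ((B - m) * (C - m) * (- E - m)) +
     p$2 * v$2 / B * ((A - m) * (C - m) * (- E - m)) +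
     p$3 * v$3 / C * ((A - m) * (B - m) * (- E - m)) -
     p$4 * v$4 / E * ((A - m) * (B - m) * (C - m)))"

lemma pel_has_derivative:
  assumes "(g has_vector_derivative v) (at s)"
  shows "((\<lambda>s. pel (g s) m) has_real_derivative dpel (g s) v m) (at s)"
proof -
  have sq: "((\<lambda>s. (g s $ i)^2 / c * K) has_real_derivative 2 * (g s $ i * v $ i / c * K)) (at s)" for i c K
    using has_vector_derivative_vec_nth[OF assms, of i]
    unfolding has_real_derivative_iff_has_vector_derivative[symmetric]
    by (auto intro!: derivative_eq_intros simp: divide_inverse)
  show ?thesis
    unfolding pel_def dpel_def distrib_left right_diff_distrib
    by (intro DERIV_add DERIV_diff sq)
qed

text \<open>Splitting \<open>l - m\<close> as \<open>(l - ax$i) + (ax$i - m)\<close> in each summand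
  produces \<open>2 * \<nu> * pel p m\<close> plus the tangency condition times the product of all
  \<open>ax$i - m\<close>. In particular the derivative of \<open>pel\<close> vanishes at the roots
  other than \<open>l\<close>.\<close>

lemma dpel_eigdir:
  assumes tan: "v \<bullet> lam p = 0" and eig: "\<And>i. v$i * (l - ax$i) = \<nu> * p$i"
  shows "(l - m) * dpel p v m = 2 * \<nu> * pel p m"
proof -
  define x y z t where "x = p$1 * v$1 / A" and "y = p$2 * v$2 / B" and "z = p$3 * v$3 / C" and "t = p$4 * v$4 / E"
  have s: "x + y + z = t"
    using tan by (simp add: inner_vec_4 x_def y_def z_def t_def mult.commute)
  have step: "(l - m) * (p$i * v$i / c) = \<nu> * ((p$i)^2 / c) + p$i * v$i / c * (ax$i - m)" for i c
  proof -
    have "(l - m) * (p$i * v$i) = p$i * (v$i * (l - ax$i)) + p$i * v$i * (ax$i - m)"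
      by (simp add: algebra_simps)
    then have "(l - m) * (p$i * v$i) = \<nu> * (p$i)^2 + p$i * v$i * (ax$i - m)"
      unfolding eig by (simp add: power2_eq_square)
    then have "(l - m) * (p$i * v$i) / c = (\<nu> * (p$i)^2 + p$i * v$i * (ax$i - m)) / c" by simp
    then show ?thesis by (simp add: add_divide_distrib)
  qed
  have x: "(l - m) * x = \<nu> * ((p$1)^2 / A) + x * (A - m)"
    and y: "(l - m) * y = \<nu> * ((p$2)^2 / B) + y * (B - m)"
    and z: "(l - m) * z = \<nu> * ((p$3)^2 / C) + z * (C - m)"
    and t: "(l - m) * t = \<nu> * ((p$4)^2 / E) + t * (- E - m)"
    using step[of 1 A] step[of 2 B] step[of 3 C] step[of 4 E] by (simp_all add: x_def y_def z_def t_def)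
  have "(l - m) * dpel p v m = 2 * (((l - m) * x) * ((B - m) * (C - m) * (- E - m)) +
     ((l - m) * y) * ((A - m) * (C - m) * (- E - m)) +
     ((l - m) * z) * ((A - m) * (B - m) * (- E - m)) -
     ((l - m) * t) * ((A - m) * (B - m) * (C - m)))"
    unfolding dpel_def x_def[symmetric] y_def[symmetric] z_def[symmetric] t_def[symmetric]
    by (simp add: algebra_simps)
  also have "\<dots> = 2 * \<nu> * pel p m + 2 * (x + y + z - t) * ((A - m) * (B - m) * (C - m) * (- E - m))"
  proof -
    define P1 P2 P3 P4 where "P1 = (p$1)^2 / A" and "P2 = (p$2)^2 / B" and "P3 = (p$3)^2 / C" and "P4 = (p$4)^2 / E"
    show ?thesis
      unfolding x y z t pel_def P1_def[symmetric] P2_def[symmetric] P3_def[symmetric] P4_def[symmetric]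
      by (simp add: algebra_simps)
  qed
  finally show ?thesis using s by simp
qed

text \<open>At \<open>m = l\<close> the identity of \<open>dpel_eigdir\<close> is void. Its factor
  \<open>l - m\<close> is cancelled for \<open>m \<noteq> l\<close>, and the value at
  \<open>l\<close> follows by continuity.\<close>

lemma dpel_at_root:
  assumes tan: "v \<bullet> lam p = 0" and eig: "\<And>i. v$i * (l - ax$i) = \<nu> * p$i"
    and pel: "\<And>m. pel p m = (l - m) * (l' - m) * (l'' - m)"
  shows "dpel p v l = 2 * \<nu> * ((l' - l) * (l'' - l))"
proof -
  have "(\<lambda>m. dpel p v m) \<midarrow>l\<rightarrow> dpel p v l"
    unfolding dpel_def by (intro tendsto_intros)
  moreover have "(\<lambda>m. dpel p v m) \<midarrow>l\<rightarrow> 2 * \<nu> * ((l' - l) * (l'' - l))"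
  proof (rule Lim_transform_eventually)
    show "(\<lambda>m. 2 * \<nu> * ((l' - m) * (l'' - m))) \<midarrow>l\<rightarrow> 2 * \<nu> * ((l' - l) * (l'' - l))"
      by (intro tendsto_intros)
    have "2 * \<nu> * ((l' - m) * (l'' - m)) = dpel p v m" if "m \<noteq> l" for m
    proof -
      have "(l - m) * (2 * \<nu> * ((l' - m) * (l'' - m))) = (l - m) * dpel p v m"
        unfolding dpel_eigdir[OF tan eig] pel by (simp add: mult_ac)
      then show ?thesis using that by simp
    qed
    then show "\<forall>\<^sub>F m in at l. 2 * \<nu> * ((l' - m) * (l'' - m)) = dpel p v m"
      by (simp add: eventually_at_filter)
  qed
  ultimately show ?thesis by (rule LIM_unique)
qed

text \<open>The \<open>k\<close>-th elliptic coordinate is simple on the domain of the \<open>k\<close>-th foliation, and \<open>v\<close> moves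
  this coordinate only.\<close>

lemma integral_curve_Lk:
  assumes ic: "integral_curve Q N k I g" and k: "k \<in> {1, 2, 3}" and s: "s \<in> I"
  obtains v \<nu> where "(g has_vector_derivative v) (at s)"
    "((\<lambda>s. Lk k (g s)) has_real_derivative 2 * \<nu>) (at s)"
    "\<And>i. v$i * (Lk k (g s) - ax$i) = \<nu> * g s $ i"
proof -
  have "open I" using ic by (simp add: integral_curve_def)
  have dom: "g r \<in> foliation_domain Q N k" if "r \<in> I" for r
    using ic that by (auto simp: integral_curve_def)
  then have Q: "g r \<in> Q" if "r \<in> I" for r
    using k that by (auto simp: foliation_domain_Q)
  obtain v where v: "(g has_vector_derivative v) (at s)" "v \<in> eigenline_field Q N k (g s)"
    using ic s unfolding integral_curve_def by blast
  then obtain \<nu> where tan: "v \<bullet> lam (g s) = 0" and eig: "\<And>i. v$i * (Lk k (g s) - ax$i) = \<nu> * g s $ i"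
    by (auto simp: eigenline_field_Q[OF Q[OF s] k] eigdir_def)
  have cont: "continuous_on I g"
    using ic unfolding integral_curve_def
    by (metis continuous_at_imp_continuous_on has_vector_derivative_continuous)
  have cL: "isCont (\<lambda>s. L (g s)) s" if "continuous_on Q L" for L :: "real^4 \<Rightarrow> real"
  proof -
    have "continuous_on I (\<lambda>s. L (g s))"
      by (rule continuous_on_compose2[OF that cont]) (use Q in auto)
    then show ?thesis using \<open>open I\<close> s by (simp add: continuous_on_eq_continuous_at)
  qed
  \<comment> \<open>\<open>La\<close> and \<open>Lb\<close> are the other two elliptic coordinates;
    the domain of the foliation keeps \<open>Lk k\<close> apart from both.\<close>
  obtain La Lb where ab: "continuous_on Q La" "continuous_on Q Lb"
    "La (g s) \<noteq> Lk k (g s)" "Lb (g s) \<noteq> Lk k (g s)"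
    "\<And>p m. p \<in> Q \<Longrightarrow> pel p m = (Lk k p - m) * (La p - m) * (Lb p - m)"
  proof -
    consider "k = 1" | "k = 2" | "k = 3" using k by auto
    then show thesis
    proof cases
      case 1
      then show thesis
        using that[of L2 L3] continuous_on_L2 continuous_on_L3 L_bounds[OF Q[OF s]] by (auto simp: pel_L)
    next
      case 2
      then show thesis
        using that[of L1 L2] continuous_on_L1 continuous_on_L2 L_bounds[OF Q[OF s]] dom[OF s]
        by (auto simp: pel_L foliation_domain_Q)
    next
      case 3
      then show thesis
        using that[of L1 L3] continuous_on_L1 continuous_on_L3 L_bounds[OF Q[OF s]] dom[OF s]
        by (auto simp: pel_L foliation_domain_Q)
    qed
  qed
  have "((\<lambda>s. Lk k (g s)) has_real_derivative dpel (g s) v (Lk k (g s)) /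
      ((La (g s) - Lk k (g s)) * (Lb (g s) - Lk k (g s)))) (at s)"
    by (rule simple_root_has_derivative[OF \<open>open I\<close> s _ pel_has_derivative[OF v(1)]])
       (use ab cL Q in auto)
  moreover have "dpel (g s) v (Lk k (g s)) /
      ((La (g s) - Lk k (g s)) * (Lb (g s) - Lk k (g s))) = 2 * \<nu>"
    using dpel_at_root[OF tan eig ab(5)[OF Q[OF s]]] ab(3,4) by simp
  ultimately show thesis using that v(1) eig by metis
qed

text \<open>By \<open>integral_curve_Lk\<close> the radicand has derivative
  \<open>- 2 * e * \<nu>\<close>, which is the relation required by
  \<open>ratio_sqrt_constant\<close>. The sign \<open>e\<close> tells on which side of
  \<open>ax$i\<close> the moving elliptic coordinate stays.\<close>

lemma integral_curve_ratio:
  assumes ic: "integral_curve Q N k I g" and k: "k \<in> {1, 2, 3}" and s: "s \<in> I" "s0 \<in> I"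
    and pos: "\<And>p. p \<in> foliation_domain Q N k \<Longrightarrow> e * (ax$i - Lk k p) > 0"
  shows "g s $ i / sqrt (e * (ax$i - Lk k (g s))) = g s0 $ i / sqrt (e * (ax$i - Lk k (g s0)))"
proof -
  have "\<forall>s\<in>I. \<exists>v \<nu>. (g has_vector_derivative v) (at s) \<and>
    ((\<lambda>s. Lk k (g s)) has_real_derivative 2 * \<nu>) (at s) \<and>
    (\<forall>i. v$i * (Lk k (g s) - ax$i) = \<nu> * g s $ i)"
    using integral_curve_Lk[OF ic k] by metis
  then obtain v \<nu> where v: "\<And>s. s \<in> I \<Longrightarrow> (g has_vector_derivative v s) (at s)"
    and \<nu>: "\<And>s. s \<in> I \<Longrightarrow> ((\<lambda>s. Lk k (g s)) has_real_derivative 2 * \<nu> s) (at s)"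
    and eig: "\<And>s i. s \<in> I \<Longrightarrow> v s $ i * (Lk k (g s) - ax$i) = \<nu> s * g s $ i"
    by metis
  show ?thesis
  proof (rule ratio_sqrt_constant[where I = I and x' = "\<lambda>s. v s $ i" and w' = "\<lambda>s. e * (0 - 2 * \<nu> s)"])
    show "is_interval I" using ic by (simp add: integral_curve_def)
  next
    fix s assume s: "s \<in> I"
    show "((\<lambda>s. g s $ i) has_real_derivative v s $ i) (at s)"
      using has_vector_derivative_vec_nth[OF v[OF s]]
      by (simp add: has_real_derivative_iff_has_vector_derivative)
    show "((\<lambda>s. e * (ax$i - Lk k (g s))) has_real_derivative e * (0 - 2 * \<nu> s)) (at s)"
      by (intro DERIV_cmult DERIV_diff DERIV_const \<nu>[OF s])
    show "0 < e * (ax$i - Lk k (g s))"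
      using ic s by (intro pos) (auto simp: integral_curve_def)
    have "2 * v s $ i * (e * (ax$i - Lk k (g s))) = - 2 * e * (v s $ i * (Lk k (g s) - ax$i))"
      by (simp add: algebra_simps)
    then show "2 * v s $ i * (e * (ax$i - Lk k (g s))) = e * (0 - 2 * \<nu> s) * g s $ i"
      unfolding eig[OF s] by simp
  qed (fact s)+
qed

section \<open>Leaves of the first foliation\<close>

definition curve1 :: "real \<Rightarrow> real \<Rightarrow> real \<Rightarrow> real \<Rightarrow> real \<Rightarrow> real^4" where
  "curve1 X Y Z T s =
     vector [X * sqrt (A + E + s^2), Y * sqrt (B + E + s^2), Z * sqrt (C + E + s^2), T * s]"

lemma curve1_radicand: "A + E + s^2 > 0" "B + E + s^2 > 0" "C + E + s^2 > 0"
  using ABCE by (auto intro: add_pos_nonneg)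

text \<open>With \<open>L1 = - E - s^2\<close> the radicands in \<open>curve1\<close> are
  \<open>A - L1\<close>, \<open>B - L1\<close>, \<open>C - L1\<close>, while \<open>- E - L1\<close>
  is the square of \<open>s\<close>. So the fourth coordinate can be linear in \<open>s\<close>, and
  the curve crosses \<open>t = 0\<close>, where \<open>L1\<close> turns back, smoothly. The last
  four premises are the equations of \<open>ell_coords\<close> without the factor of
  \<open>l1\<close>.\<close>

lemma ell_curve1:
  assumes "C \<le> l2" "l2 \<le> B" "B \<le> l3" "l3 \<le> A"
    and "X^2 * ((A - B) * (A - C) * (A + E)) = A * ((A - l2) * (A - l3))"
    and "Y^2 * ((A - B) * (B - C) * (B + E)) = B * ((B - l2) * (l3 - B))"
    and "Z^2 * ((A - C) * (B - C) * (C + E)) = C * ((l2 - C) * (l3 - C))"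
    and "T^2 * ((A + E) * (B + E) * (C + E)) = E * ((l2 + E) * (l3 + E))"
  shows "ell (curve1 X Y Z T s) (- E - s^2) l2 l3"
proof -
  have sq: "(a * sqrt w)^2 * k = (a^2 * k) * w" if "w > 0" for a w k :: real
    using that by (simp add: power_mult_distrib)
  have "(T * s)^2 * k = (T^2 * k) * s^2" for k by (simp add: power_mult_distrib)
  note sq4 = this
  show ?thesis
  proof (rule ellI, goal_cases)
    case 6
    show ?case
      unfolding curve1_def vector_4 sq[OF curve1_radicand(1)] assms by (simp add: algebra_simps)
  next
    case 7
    show ?case
      unfolding curve1_def vector_4 sq[OF curve1_radicand(2)] assms by (simp add: algebra_simps)
  next
    case 8
    show ?case
      unfolding curve1_def vector_4 sq[OF curve1_radicand(3)] assms by (simp add: algebra_simps)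
  next
    case 9
    show ?case
      unfolding curve1_def vector_4 sq4 assms by (simp add: algebra_simps)
  qed (use assms in auto)
qed

lemma sqrt_has_derivative:
  fixes w :: "real \<Rightarrow> real"
  assumes "(w has_real_derivative w') (at s)" "w s > 0"
  shows "((\<lambda>s. X * sqrt (w s)) has_real_derivative X * w' / (2 * sqrt (w s))) (at s)"
proof -
  have "((\<lambda>s. X * sqrt (w s)) has_real_derivative X * (inverse (sqrt (w s)) / 2 * w')) (at s)"
    by (intro DERIV_cmult DERIV_chain2[OF DERIV_real_sqrt[OF assms(2)] assms(1)])
  then show ?thesis by (rule DERIV_cong) (use assms(2) in \<open>simp add: field_simps\<close>)
qed

lemma integral_curve_curve1:
  assumes e: "\<And>s. ell (curve1 X Y Z T s) (- E - s^2) l2 l3" and "T \<noteq> 0"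
  shows "integral_curve Q N (Suc 0) UNIV (curve1 X Y Z T)"
proof -
  let ?G = "curve1 X Y Z T"
  define v :: "real \<Rightarrow> real^4" where
    "v = (\<lambda>s. vector [X * (2 * s) / (2 * sqrt (A + E + s^2)), Y * (2 * s) / (2 * sqrt (B + E + s^2)),
       Z * (2 * s) / (2 * sqrt (C + E + s^2)), T])"
  note L = L_eqI[OF e]
  have nz: "sqrt (A + E + s^2) \<noteq> 0" "sqrt (B + E + s^2) \<noteq> 0" "sqrt (C + E + s^2) \<noteq> 0" for s
    using curve1_radicand[of s] by auto
  show ?thesis
  \<comment> \<open>The multiplier is half the derivative of \<open>L1 = - E - s^2\<close>.\<close>
  proof (rule integral_curveI[where v = v and \<nu> = "\<lambda>s. - s"])
    show "?G s \<in> foliation_domain Q N (Suc 0)" for s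
      using ell_in_Q[OF e] by (simp add: foliation_domain_Q)
    show "(?G has_vector_derivative v s) (at s)" for s
      unfolding curve1_def v_def
      by (intro has_vector_derivative_vector_4 sqrt_has_derivative curve1_radicand)
         (auto intro!: derivative_eq_intros)
    show "continuous_on UNIV v"
      unfolding v_def by (intro continuous_on_vector_4 continuous_intros) (use nz in auto)
    have "v s $ 4 = T" for s by (simp add: v_def)
    then show "v s \<noteq> 0" for s using \<open>T \<noteq> 0\<close> by (metis zero_index)
    have c: "X * (2 * s) / (2 * sqrt w) * (- E - s^2 - a) = - s * (X * sqrt w)"
      if "w = a + E + s^2" "w > 0" for X a w s :: real
    proof -
      have "- E - s^2 - a = - (sqrt w * sqrt w)" using that by simp
      then show ?thesis using that by (simp only:) (simp add: field_simps)
    qed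
    show "v s $ i * (Lk (Suc 0) (?G s) - ax $ i) = - s * ?G s $ i" for s i
    proof -
      have "v s $ i * (- E - s^2 - ax $ i) = - s * ?G s $ i"
        using exhaust_4[of i] c[OF refl curve1_radicand(1)[of s], of X] c[OF refl curve1_radicand(2)[of s], of Y]
          c[OF refl curve1_radicand(3)[of s], of Z]
        by (elim disjE) (simp_all add: v_def curve1_def power2_eq_square)
      then show ?thesis by (simp add: L)
    qed
  qed auto
qed

text \<open>\<open>X\<close>, \<open>Y\<close>, \<open>Z\<close> are the first integrals of the
  leaf, signs included. \<open>T\<close> is positive because the parameter \<open>s\<close> supplies
  the sign of the fourth coordinate.\<close>

lemma leaf_curve1:
  assumes p: "p \<in> Q"
  obtains X Y Z T where "T > 0" "leaf Q N (Suc 0) p = range (curve1 X Y Z T)"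
    "p \<in> range (curve1 X Y Z T)" "\<And>s. ell (curve1 X Y Z T s) (- E - s^2) (L2 p) (L3 p)"
proof -
  note b = L_bounds[OF p] and e = ell_L[OF p]
  define X Y Z where "X = p$1 / sqrt (A - L1 p)" and "Y = p$2 / sqrt (B - L1 p)" and "Z = p$3 / sqrt (C - L1 p)"
  define T where "T = sqrt (E * ((L2 p + E) * (L3 p + E)) / ((A + E) * (B + E) * (C + E)))"
  have w: "A - L1 p > 0" "B - L1 p > 0" "C - L1 p > 0" if "p \<in> Q" for p
    using L_bounds[OF that] ABCE by auto
  have T: "T > 0" "T^2 * ((A + E) * (B + E) * (C + E)) = E * ((L2 p + E) * (L3 p + E))"
  proof -
    have "E * ((L2 p + E) * (L3 p + E)) > 0" "(A + E) * (B + E) * (C + E) > 0"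
      using b ABCE by (auto intro!: mult_pos_pos)
    then show "T > 0" "T^2 * ((A + E) * (B + E) * (C + E)) = E * ((L2 p + E) * (L3 p + E))"
      by (auto simp: T_def)
  qed
  have sq: "(x / sqrt u)^2 * k = m" if "x^2 * k = u * m" "u > 0" for x u k m :: real
    using that by (simp add: power_divide)
  have sqx: "(p$1 / sqrt (A - L1 p))^2 * ((A - B) * (A - C) * (A + E)) = A * ((A - L2 p) * (A - L3 p))"
    and sqy: "(p$2 / sqrt (B - L1 p))^2 * ((A - B) * (B - C) * (B + E)) = B * ((B - L2 p) * (L3 p - B))"
    and sqz: "(p$3 / sqrt (C - L1 p))^2 * ((A - C) * (B - C) * (C + E)) = C * ((L2 p - C) * (L3 p - C))"
    if "p \<in> Q" for p
    using ell_coords[OF ell_L[OF that]] w[OF that] by ((intro sq; simp add: mult_ac)+)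
  note X = sqx[OF p, folded X_def] and Y = sqy[OF p, folded Y_def] and Z = sqz[OF p, folded Z_def]
  have ell: "ell (curve1 X Y Z T s) (- E - s^2) (L2 p) (L3 p)" for s
    by (rule ell_curve1[OF _ _ _ _ X Y Z T(2)]) (use b in auto)
  have on: "q \<in> range (curve1 X Y Z T)"
    if q: "q \<in> Q" "q$1 / sqrt (A - L1 q) = X" "q$2 / sqrt (B - L1 q) = Y" "q$3 / sqrt (C - L1 q) = Z" for q
  proof -
    note eq = ell_L[OF q(1)]
    \<comment> \<open>Up to constants, the squares of \<open>X\<close> and \<open>Z\<close> are the
      values at \<open>A\<close> and \<open>C\<close> of the quadratic polynomial with roots
      \<open>L2\<close>, \<open>L3\<close>, which recovers both roots.\<close>
    have sq1: "(A - L2 q) * (A - L3 q) = (A - L2 p) * (A - L3 p)"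
      using sqx[OF q(1), unfolded q(2)] X ABCE by simp
    have "(L2 q - C) * (L3 q - C) = (L2 p - C) * (L3 p - C)"
      using sqz[OF q(1), unfolded q(4)] Z ABCE by simp
    then have sq2: "(C - L2 q) * (C - L3 q) = (C - L2 p) * (C - L3 p)" by (simp add: algebra_simps)
    have L: "L2 q = L2 p" "L3 q = L3 p"
      using pair_eq_if_products_eq[OF sq1 sq2] ABCE b L_bounds[OF q(1)] by auto
    define s where "s = q$4 / T"
    have "s^2 = - E - L1 q"
    proof -
      have "(q$4)^2 * ((A + E) * (B + E) * (C + E)) = (- E - L1 q) * (T^2 * ((A + E) * (B + E) * (C + E)))"
        unfolding T(2) using ell_coords(4)[OF eq] L by (simp add: mult_ac)
      then have "(q$4)^2 * ((A + E) * (B + E) * (C + E)) = ((- E - L1 q) * T^2) * ((A + E) * (B + E) * (C + E))"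
        by (simp add: mult_ac)
      moreover have "(A + E) * (B + E) * (C + E) \<noteq> 0" using ABCE by auto
      ultimately have "(q$4)^2 = (- E - L1 q) * T^2" by simp
      then show ?thesis using T(1) by (simp add: s_def power_divide)
    qed
    then have w': "A + E + s^2 = A - L1 q" "B + E + s^2 = B - L1 q" "C + E + s^2 = C - L1 q" by auto
    have "T * s = q$4" using T(1) by (simp add: s_def)
    then have "curve1 X Y Z T s = q"
      unfolding vec_eq_iff forall_4 curve1_def vector_4 w' q(2-4)[symmetric]
      using w[OF q(1)] by simp
    then show ?thesis by (metis rangeI)
  qed
  have p_on: "p \<in> range (curve1 X Y Z T)" using on[OF p] by (simp add: X_def Y_def Z_def)
  have "leaf Q N (Suc 0) p = range (curve1 X Y Z T)"
  proof (rule leaf_eqI)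
    show "integral_curve Q N (Suc 0) UNIV (curve1 X Y Z T)"
      using integral_curve_curve1[OF ell] T(1) by simp
    show "p \<in> range (curve1 X Y Z T)" by (rule p_on)
  next
    fix g I s0 s assume ic: "integral_curve Q N (Suc 0) I g" and s: "s0 \<in> I" "g s0 = p" "s \<in> I"
    have Qs: "g s \<in> Q" using ic s by (auto simp: integral_curve_def foliation_domain_Q)
    have *: "g s $ i / sqrt (1 * (ax$i - Lk (Suc 0) (g s))) = g s0 $ i / sqrt (1 * (ax$i - Lk (Suc 0) (g s0)))"
      if "i \<noteq> 4" for i
    proof (rule integral_curve_ratio[OF ic _ s(3,1)])
      fix p assume "p \<in> foliation_domain Q N (Suc 0)"
      then have "p \<in> Q" by (simp add: foliation_domain_Q)
      then show "0 < 1 * (ax $ i - Lk (Suc 0) p)" using w[of p] that exhaust_4[of i] by auto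
    qed simp
    show "g s \<in> range (curve1 X Y Z T)"
      by (rule on[OF Qs]) (use *[of 1] *[of 2] *[of 3] s(2) in \<open>simp_all add: X_def Y_def Z_def\<close>)
  qed
  then show thesis using that T(1) p_on ell by blast
qed

lemma diffeomorphic_curve1:
  assumes "T \<noteq> 0"
  shows "diffeomorphic (range (curve1 X Y Z T)) (UNIV :: real set)"
proof (rule diffeomorphicI[where f = "\<lambda>q. q$4 / T" and g = "curve1 X Y Z T"])
  show "smooth_map (range (curve1 X Y Z T)) (\<lambda>q. q$4 / T)"
    using assms by (intro smooth_mapI[of _ UNIV] smooth_on_divide smooth_on_linear bounded_linear_vec_nth smooth_on_const) auto
  have id: "smooth_on (\<lambda>s. s) (UNIV :: real set)"
    by (intro smooth_on_linear bounded_linear_ident) auto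
  show "smooth_map UNIV (curve1 X Y Z T)"
    unfolding curve1_def
    by (intro smooth_mapI[of _ UNIV] smooth_on_vector_4 smooth_on_mult smooth_on_sqrt smooth_on_add
        smooth_on_power id smooth_on_const curve1_radicand) auto
qed (use assms in \<open>auto simp: curve1_def\<close>)

lemma leaves_1_diffeomorphic:
  assumes "L \<in> leaves Q N 1"
  shows "diffeomorphic L (UNIV :: real set)"
proof -
  obtain p where p: "p \<in> Q" "L = leaf Q N (Suc 0) p"
    using assms by (auto simp: leaves_def foliation_domain_Q)
  from leaf_curve1[OF p(1)] show ?thesis
    unfolding p(2) using diffeomorphic_curve1 by (metis less_irrefl)
qed

end

section \<open>Leaves of the second and third foliations\<close>

lemma sincos_or_arcsin:
  fixes u y Y w :: real
  assumes "u^2 = 1 - w" "y^2 = Y^2 * w" "Y \<noteq> 0 \<or> w > 0"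
  obtains x where "x \<in> (if Y = 0 then {- pi / 2<..<pi / 2} else UNIV)"
    "sin x = u" "y = Y * cos x" "(cos x)^2 = w"
proof (cases "Y = 0")
  case True
  \<comment> \<open>This is the degenerate oval: \<open>w > 0\<close> keeps \<open>u\<close>
    strictly between -1 and 1, so the arcsine lies in the open interval.\<close>
  then have "w > 0" "y = 0" using assms by auto
  then have u: "\<bar>u\<bar> < 1" using assms(1) by (simp add: abs_square_less_1[symmetric])
  then have s: "sin (arcsin u) = u" by (intro sin_arcsin) auto
  have "- pi / 2 < arcsin u \<and> arcsin u < pi / 2"
    using arcsin_lt_bounded[of u] u by auto
  moreover have "(cos (arcsin u))^2 = w"
    using sin_cos_squared_add2[of "arcsin u"] s assms(1) by (simp add: cos_squared_eq)
  ultimately show thesis using that[of "arcsin u"] s True \<open>y = 0\<close> by auto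
next
  case False
  then have "(y / Y)^2 + u^2 = 1" using assms by (simp add: power_divide)
  then obtain t where t: "y / Y = cos t" "u = sin t" using sincos_total_2pi by metis
  have "(cos t)^2 = w" using t(2) assms(1) by (simp add: cos_squared_eq)
  moreover have "y = Y * cos t" using t(1) False by (simp add: field_simps)
  ultimately show thesis using that[of t] t False by auto
qed

lemma scaled_eq:
  fixes x y :: real
  assumes "x * (D * k) = e * w" "y * k = e" "D \<noteq> 0" "k \<noteq> 0"
  shows "x = y * (w / D)"
proof -
  have "(x * D) * k = (y * w) * k" using assms(1) unfolding assms(2)[symmetric] by (simp add: mult_ac)
  then show ?thesis using assms(3,4) by (simp add: eq_divide_eq)
qed

lemma compact_periodic_range:
  fixes f :: "real \<Rightarrow> 'a::topological_space"
  assumes "continuous_on UNIV f" "\<And>x y. sin x = sin y \<Longrightarrow> cos x = cos y \<Longrightarrow> f x = f y"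
  shows "compact (range f)"
proof -
  have "range f = f ` {0..2 * pi}"
  proof (intro equalityI subsetI)
    fix z assume "z \<in> range f"
    then obtain x where x: "z = f x" by auto
    obtain t where t: "0 \<le> t" "t < 2 * pi" "cos x = cos t" "sin x = sin t"
      using sincos_total_2pi[of "cos x" "sin x"] by auto
    then have "f x = f t" using assms(2) by blast
    then show "z \<in> f ` {0..2 * pi}" using x t by auto
  qed auto
  moreover have "compact (f ` {0..2 * pi})"
    by (intro compact_continuous_image continuous_on_subset[OF assms(1)]) auto
  ultimately show ?thesis by simp
qed

abbreviation signs :: "real set" where "signs \<equiv> {1, - 1}"

lemma sin_cos_sign_pi_half:
  assumes "s \<in> signs"
  shows "sin (s * pi / 2) = s" "cos (s * pi / 2) = 0"
  using assms by auto

lemma cos_nonzero_band: "x \<in> {- pi / 2<..<pi / 2} \<Longrightarrow> cos x \<noteq> 0"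
  using cos_gt_zero_pi[of x] by auto

text \<open>If \<open>r\<close> moves with derivative \<open>2 * k\<close>, the factor in front of
  \<open>r - a\<close> is the derivative of \<open>X * sqrt (e * (a - r))\<close>. So this is the
  equation of a principal direction with multiplier \<open>k\<close>.\<close>

lemma sqrt_line_eq:
  fixes X w a :: real
  assumes "w > 0" "w = e * (a - r)" "e^2 = 1"
  shows "X * (- e * (2 * k)) / (2 * sqrt w) * (r - a) = k * (X * sqrt w)"
proof -
  have "r - a = - (e * (sqrt w * sqrt w))"
  proof -
    have "e * (sqrt w * sqrt w) = e^2 * (a - r)" using assms(1,2) by (simp add: power2_eq_square)
    then show ?thesis using assms(3) by simp
  qed
  moreover have "X * (- e * (2 * k)) / (2 * sqrt w) * (- (e * (sqrt w * sqrt w))) = e^2 * (k * (X * sqrt w))"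
    using assms(1) by (simp add: field_simps power2_eq_square)
  ultimately show ?thesis using assms(3) by simp
qed

context quadric
begin

text \<open>The moving elliptic coordinate on a line of the second foliation. Both
  \<open>A - r2 x\<close> and \<open>r2 x - B\<close> are \<open>A - B\<close> times a square, so
  the first two coordinates, whose factors vanish in turn, become multiples of \<open>sin x\<close>
  and \<open>cos x\<close>. On the third foliation \<open>r3\<close> does the same between
  \<open>C\<close> and \<open>B\<close> for the third and second coordinates.\<close>

definition r2 :: "real \<Rightarrow> real" where "r2 x = B + (A - B) * (cos x)^2"
definition r3 :: "real \<Rightarrow> real" where "r3 x = B - (B - C) * (cos x)^2"

lemma r2_bounds: "B \<le> r2 x" "r2 x \<le> A" "A - r2 x = (A - B) * (sin x)^2"
proof -
  show "B \<le> r2 x" using ABCE by (simp add: r2_def)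
  show e: "A - r2 x = (A - B) * (sin x)^2" by (simp add: r2_def sin_squared_eq algebra_simps)
  have "(A - B) * (sin x)^2 \<ge> 0" using ABCE by simp
  then show "r2 x \<le> A" using e by linarith
qed

lemma r3_bounds: "C \<le> r3 x" "r3 x \<le> B" "r3 x - C = (B - C) * (sin x)^2"
proof -
  show "r3 x \<le> B" using ABCE by (simp add: r3_def)
  show e: "r3 x - C = (B - C) * (sin x)^2" by (simp add: r3_def sin_squared_eq algebra_simps)
  have "(B - C) * (sin x)^2 \<ge> 0" using ABCE by simp
  then show "C \<le> r3 x" using e by linarith
qed

lemma r2_has_derivative: "(r2 has_real_derivative - (2 * ((A - B) * sin x * cos x))) (at x)"
  unfolding r2_def by (auto intro!: derivative_eq_intros simp: algebra_simps)

lemma r3_has_derivative: "(r3 has_real_derivative 2 * ((B - C) * sin x * cos x)) (at x)"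
  unfolding r3_def by (auto intro!: derivative_eq_intros simp: algebra_simps)

definition curve2 :: "real \<Rightarrow> real \<Rightarrow> real \<Rightarrow> real \<Rightarrow> real \<Rightarrow> real^4" where
  "curve2 X Y Z T x = vector [X * sin x, Y * cos x, Z * sqrt (r2 x - C), T * sqrt (r2 x + E)]"

definition curve3 :: "real \<Rightarrow> real \<Rightarrow> real \<Rightarrow> real \<Rightarrow> real \<Rightarrow> real^4" where
  "curve3 X Y Z T x = vector [X * sqrt (A - r3 x), Y * cos x, Z * sin x, T * sqrt (r3 x + E)]"

lemma radicands_23: "r2 x - C > 0" "r2 x + E > 0" "A - r3 x > 0" "r3 x + E > 0"
  using r2_bounds[of x] r3_bounds[of x] ABCE by auto

lemma isCont_r23: "isCont r2 x" "isCont r3 x"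
  using r2_has_derivative r3_has_derivative DERIV_isCont by blast+

lemma continuous_on_r23 [continuous_intros]: "continuous_on S r2" "continuous_on S r3"
  using isCont_r23 by (auto intro: continuous_at_imp_continuous_on)

lemma continuous_on_curve2: "continuous_on S (curve2 X Y Z T)"
  unfolding curve2_def[abs_def] by (intro continuous_on_vector_4 continuous_intros)

lemma continuous_on_curve3: "continuous_on S (curve3 X Y Z T)"
  unfolding curve3_def[abs_def] by (intro continuous_on_vector_4 continuous_intros)

lemma ell_curve2:
  assumes "l1 \<le> - E" "C \<le> l2" "l2 \<le> B"
    and "X^2 * ((A - C) * (A + E)) = A * ((A - l1) * (A - l2))"
    and "Y^2 * ((B - C) * (B + E)) = B * ((B - l1) * (B - l2))"
    and "Z^2 * ((A - C) * (B - C) * (C + E)) = C * ((C - l1) * (l2 - C))"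
    and "T^2 * ((A + E) * (B + E) * (C + E)) = E * ((- E - l1) * (l2 + E))"
  shows "ell (curve2 X Y Z T x) l1 l2 (r2 x)"
proof -
  have sq: "(a * sqrt w)^2 * k = (a^2 * k) * w" if "w > 0" for a w k :: real
    using that by (simp add: power_mult_distrib)
  have sq': "(a * f)^2 * (D * k * k') = (a^2 * (k * k')) * (D * f^2)" for a f D k k' :: real
    by (simp add: power_mult_distrib mult_ac)
  show ?thesis
  proof (rule ellI, goal_cases)
    case 6
    show ?case
      unfolding curve2_def vector_4 sq' assms r2_bounds(3) by (simp add: mult_ac)
  next
    case 7
    have "r2 x - B = (A - B) * (cos x)^2" by (simp add: r2_def)
    then show ?case
      unfolding curve2_def vector_4 sq' assms by (simp add: mult_ac)
  next
    case 8
    show ?case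
      unfolding curve2_def vector_4 sq[OF radicands_23(1)] assms by (simp add: mult_ac)
  next
    case 9
    show ?case
      unfolding curve2_def vector_4 sq[OF radicands_23(2)] assms by (simp add: mult_ac)
  qed (use assms r2_bounds in auto)
qed

lemma ell_curve3:
  assumes "l1 \<le> - E" "B \<le> l3" "l3 \<le> A"
    and "X^2 * ((A - B) * (A - C) * (A + E)) = A * ((A - l1) * (A - l3))"
    and "Y^2 * ((A - B) * (B + E)) = B * ((B - l1) * (l3 - B))"
    and "Z^2 * ((A - C) * (C + E)) = C * ((C - l1) * (l3 - C))"
    and "T^2 * ((A + E) * (B + E) * (C + E)) = E * ((- E - l1) * (l3 + E))"
  shows "ell (curve3 X Y Z T x) l1 (r3 x) l3"
proof -
  have sq: "(a * sqrt w)^2 * k = (a^2 * k) * w" if "w > 0" for a w k :: real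
    using that by (simp add: power_mult_distrib)
  have sq': "(a * f)^2 * (k * D * k') = (a^2 * (k * k')) * (D * f^2)" for a f D k k' :: real
    by (simp add: power_mult_distrib mult_ac)
  show ?thesis
  proof (rule ellI, goal_cases)
    case 6
    show ?case
      unfolding curve3_def vector_4 sq[OF radicands_23(3)] assms by (simp add: mult_ac)
  next
    case 7
    have "B - r3 x = (B - C) * (cos x)^2" by (simp add: r3_def)
    then show ?case
      unfolding curve3_def vector_4 sq' assms by (simp add: mult_ac)
  next
    case 8
    show ?case
      unfolding curve3_def vector_4 sq' assms r3_bounds(3) by (simp add: mult_ac)
  next
    case 9
    show ?case
      unfolding curve3_def vector_4 sq[OF radicands_23(4)] assms by (simp add: mult_ac)
  qed (use assms r3_bounds in auto)
qed

text \<open>Where \<open>cos x = 0\<close> the moving coordinate is \<open>B\<close>: the point is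
  partially umbilic unless \<open>l2 < B\<close>, and the velocity vanishes unless
  \<open>Y \<noteq> 0\<close>. The last premise rules out both.\<close>

lemma integral_curve_curve2:
  assumes e: "\<And>x. ell (curve2 X Y Z T x) l1 l2 (r2 x)" and "X \<noteq> 0" and J: "open J" "is_interval J"
    and nd: "\<And>x. x \<in> J \<Longrightarrow> (l2 < B \<and> Y \<noteq> 0) \<or> cos x \<noteq> 0"
  shows "integral_curve Q N 2 J (curve2 X Y Z T)"
proof -
  let ?G = "curve2 X Y Z T"
  define k where "k x = - ((A - B) * sin x * cos x)" for x
  define v :: "real \<Rightarrow> real^4" where
    "v = (\<lambda>x. vector [X * cos x, - (Y * sin x), Z * (2 * k x) / (2 * sqrt (r2 x - C)), T * (2 * k x) / (2 * sqrt (r2 x + E))])"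
  note L = L_eqI[OF e]
  have nz: "sqrt (r2 x - C) \<noteq> 0" "sqrt (r2 x + E) \<noteq> 0" for x
    using radicands_23[of x] by auto
  have dr: "(r2 has_real_derivative 2 * k x) (at x)" for x
    using r2_has_derivative[of x] by (simp add: k_def)
  show ?thesis
  proof (rule integral_curveI[where v = v and \<nu> = k])
    show "?G x \<in> foliation_domain Q N 2" if "x \<in> J" for x
    proof -
      have "l2 \<le> B" using e[of x] by (simp add: ell_def)
      moreover have "r2 x > B" if "cos x \<noteq> 0" using that ABCE by (simp add: r2_def)
      ultimately have "l2 < r2 x" using nd[OF that] r2_bounds[of x] by fastforce
      then show ?thesis using ell_in_Q[OF e] L by (simp add: foliation_domain_Q)
    qed
    show "(?G has_vector_derivative v x) (at x)" for x
      unfolding curve2_def v_def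
      by (intro has_vector_derivative_vector_4 sqrt_has_derivative radicands_23)
         (auto intro!: derivative_eq_intros dr)
    have "continuous_on J k" unfolding k_def by (intro continuous_intros)
    then show "continuous_on J v"
      unfolding v_def by (intro continuous_on_vector_4 continuous_intros) (use nz in auto)
    have "v x $ 1 \<noteq> 0 \<or> v x $ 2 \<noteq> 0" if "x \<in> J" for x
      using nd[OF that] \<open>X \<noteq> 0\<close> sin_zero_abs_cos_one[of x] by (auto simp: v_def)
    then show "v x \<noteq> 0" if "x \<in> J" for x using that by (metis zero_index)
    show "v x $ i * (Lk 2 (?G x) - ax $ i) = k x * ?G x $ i" for x i
    proof -
      have "v x $ 3 * (r2 x - C) = k x * ?G x $ 3"
        using sqrt_line_eq[OF radicands_23(1)[of x], of "- 1" C "r2 x" Z "k x"]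
        by (simp add: v_def curve2_def)
      moreover have "v x $ 4 * (r2 x - (- E)) = k x * ?G x $ 4"
        using sqrt_line_eq[OF radicands_23(2)[of x], of "- 1" "- E" "r2 x" T "k x"]
        by (simp add: v_def curve2_def)
      moreover have "v x $ 1 * (r2 x - A) = k x * ?G x $ 1"
      proof -
        have "r2 x - A = - ((A - B) * (sin x)^2)" using r2_bounds(3)[of x] by linarith
        then show ?thesis by (simp add: v_def curve2_def k_def power2_eq_square mult_ac)
      qed
      moreover have "v x $ 2 * (r2 x - B) = k x * ?G x $ 2"
        by (simp add: v_def curve2_def k_def r2_def power2_eq_square mult_ac)
      ultimately have "v x $ i * (r2 x - ax $ i) = k x * ?G x $ i"
        using exhaust_4[of i] by (elim disjE) simp_all
      then show ?thesis by (simp add: L)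
    qed
  qed (use J in auto)
qed

lemma integral_curve_curve3:
  assumes e: "\<And>x. ell (curve3 X Y Z T x) l1 (r3 x) l3" and "Z \<noteq> 0" and J: "open J" "is_interval J"
    and nd: "\<And>x. x \<in> J \<Longrightarrow> (l3 > B \<and> Y \<noteq> 0) \<or> cos x \<noteq> 0"
  shows "integral_curve Q N 3 J (curve3 X Y Z T)"
proof -
  let ?G = "curve3 X Y Z T"
  define k where "k x = (B - C) * sin x * cos x" for x
  define v :: "real \<Rightarrow> real^4" where
    "v = (\<lambda>x. vector [X * (- (2 * k x)) / (2 * sqrt (A - r3 x)), - (Y * sin x), Z * cos x, T * (2 * k x) / (2 * sqrt (r3 x + E))])"
  note L = L_eqI[OF e]
  have nz: "sqrt (A - r3 x) \<noteq> 0" "sqrt (r3 x + E) \<noteq> 0" for x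
    using radicands_23[of x] by auto
  have dr: "(r3 has_real_derivative 2 * k x) (at x)" for x
    using r3_has_derivative[of x] by (simp add: k_def)
  show ?thesis
  proof (rule integral_curveI[where v = v and \<nu> = k])
    show "?G x \<in> foliation_domain Q N 3" if "x \<in> J" for x
    proof -
      have "l3 \<ge> B" using e[of x] by (simp add: ell_def)
      moreover have "r3 x < B" if "cos x \<noteq> 0" using that ABCE by (simp add: r3_def)
      ultimately have "r3 x < l3" using nd[OF that] r3_bounds[of x] by fastforce
      then show ?thesis using ell_in_Q[OF e] L by (simp add: foliation_domain_Q)
    qed
    show "(?G has_vector_derivative v x) (at x)" for x
      unfolding curve3_def v_def
      by (intro has_vector_derivative_vector_4 sqrt_has_derivative radicands_23)
         (auto intro!: derivative_eq_intros dr)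
    have "continuous_on J k" unfolding k_def by (intro continuous_intros)
    then show "continuous_on J v"
      unfolding v_def by (intro continuous_on_vector_4 continuous_intros) (use nz in auto)
    have "v x $ 3 \<noteq> 0 \<or> v x $ 2 \<noteq> 0" if "x \<in> J" for x
      using nd[OF that] \<open>Z \<noteq> 0\<close> sin_zero_abs_cos_one[of x] by (auto simp: v_def)
    then show "v x \<noteq> 0" if "x \<in> J" for x using that by (metis zero_index)
    show "v x $ i * (Lk 3 (?G x) - ax $ i) = k x * ?G x $ i" for x i
    proof -
      have "v x $ 1 * (r3 x - A) = k x * ?G x $ 1"
        using sqrt_line_eq[OF radicands_23(3)[of x], of "1" A "r3 x" X "k x"]
        by (simp add: v_def curve3_def)
      moreover have "v x $ 4 * (r3 x - (- E)) = k x * ?G x $ 4"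
        using sqrt_line_eq[OF radicands_23(4)[of x], of "- 1" "- E" "r3 x" T "k x"]
        by (simp add: v_def curve3_def)
      moreover have "v x $ 3 * (r3 x - C) = k x * ?G x $ 3"
        unfolding r3_bounds(3) by (simp add: v_def curve3_def k_def power2_eq_square mult_ac)
      moreover have "v x $ 2 * (r3 x - B) = k x * ?G x $ 2"
        by (simp add: v_def curve3_def k_def r3_def power2_eq_square mult_ac)
      ultimately have "v x $ i * (r3 x - ax $ i) = k x * ?G x $ i"
        using exhaust_4[of i] by (elim disjE) simp_all
      then show ?thesis by (simp add: L)
    qed
  qed (use J in auto)
qed

abbreviation arc :: "bool \<Rightarrow> real set" where
  "arc bd \<equiv> if bd then {- pi / 2<..<pi / 2} else UNIV"

text \<open>The leaf of \<open>p\<close> is an oval, unless the coordinate \<open>f\<close> that is constant on it equals \<open>B\<close>: then it is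
  half of a degenerate oval and joins two partially umbilic points, which lie on the same side of
  \<open>x\<^sub>i = 0\<close> but on different sides of \<open>x\<^sub>j = 0\<close>.\<close>

definition arc_leaf :: "nat \<Rightarrow> (real^4 \<Rightarrow> real) \<Rightarrow> 4 \<Rightarrow> 4 \<Rightarrow> real^4 \<Rightarrow> bool" where
  "arc_leaf k f i j p \<longleftrightarrow> (\<exists>\<Gamma>. continuous_on UNIV \<Gamma> \<and> leaf Q N k p = \<Gamma> ` arc (f p = B) \<and>
     p \<in> leaf Q N k p \<and> integral_curve Q N k (arc (f p = B)) \<Gamma> \<and> compact (range \<Gamma>) \<and>
     (\<forall>x. \<Gamma> x \<in> Q \<and> f (\<Gamma> x) = f p \<and> sgn (\<Gamma> x $ i) = sgn (p$i)) \<and>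
     (f p = B \<longrightarrow> (\<forall>s\<in>signs. L2 (\<Gamma> (s * pi / 2)) = L3 (\<Gamma> (s * pi / 2)) \<and> sgn (\<Gamma> (s * pi / 2) $ j) = s)))"

text \<open>The moving coordinate \<open>L3\<close> stays in \<open>[B, A]\<close>. So the third and
  fourth coordinates give first integrals \<open>Z\<close> and \<open>T\<close> with their signs,
  while sine and cosine supply the signs of the first two, and \<open>X\<close>, \<open>Y\<close>
  are only amplitudes. The oval degenerates when \<open>Y = 0\<close>, that is for
  \<open>L2 p = B\<close>.\<close>

lemma leaf_curve2:
  assumes p: "p \<in> Q" "L2 p < L3 p"
  shows "arc_leaf 2 L2 3 1 p"
proof -
  note b = L_bounds[OF p(1)]
  define X where "X = sqrt (A * ((A - L1 p) * (A - L2 p)) / ((A - C) * (A + E)))"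
  define Y where "Y = sqrt (B * ((B - L1 p) * (B - L2 p)) / ((B - C) * (B + E)))"
  define Z T where "Z = p$3 / sqrt (L3 p - C)" and "T = p$4 / sqrt (L3 p + E)"
  have w: "L3 p - C > 0" "L3 p + E > 0" if "p \<in> Q" for p
    using L_bounds[OF that] ABCE by auto
  have k: "A * ((A - L1 p) * (A - L2 p)) > 0" "(A - C) * (A + E) > 0" "B > 0" "B - L1 p > 0"
    "(B - C) * (B + E) > 0" "B * ((B - L1 p) * (B - L2 p)) \<ge> 0"
    using b ABCE by (auto intro!: mult_pos_pos mult_nonneg_nonneg)
  have X: "X > 0" "X^2 * ((A - C) * (A + E)) = A * ((A - L1 p) * (A - L2 p))"
    using k by (auto simp: X_def)
  have Y: "Y = 0 \<longleftrightarrow> L2 p = B" "Y^2 * ((B - C) * (B + E)) = B * ((B - L1 p) * (B - L2 p))"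
    using k by (auto simp: Y_def)
  have sq: "(x / sqrt u)^2 * k = m" if "x^2 * k = u * m" "u > 0" for x u k m :: real
    using that by (simp add: power_divide)
  have sqz: "(p$3 / sqrt (L3 p - C))^2 * ((A - C) * (B - C) * (C + E)) = C * ((C - L1 p) * (L2 p - C))"
    and sqt: "(p$4 / sqrt (L3 p + E))^2 * ((A + E) * (B + E) * (C + E)) = E * ((- E - L1 p) * (L2 p + E))"
    if "p \<in> Q" for p
    using ell_coords(3,4)[OF ell_L[OF that]] w[OF that] by ((intro sq; simp add: mult_ac)+)
  note Z = sqz[OF p(1), folded Z_def] and T = sqt[OF p(1), folded T_def]
  have ell: "ell (curve2 X Y Z T x) (L1 p) (L2 p) (r2 x)" for x
    by (rule ell_curve2[OF _ _ _ X(2) Y(2) Z T]) (use b in auto)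
  have on: "q \<in> curve2 X Y Z T ` arc (L2 p = B)"
    if q: "q \<in> Q" "q$3 / sqrt (L3 q - C) = Z" "q$4 / sqrt (L3 q + E) = T" "L2 q < L3 q" for q
  proof -
    note eq = ell_L[OF q(1)] and bq = L_bounds[OF q(1)]
    \<comment> \<open>The two first integrals fix the quadratic polynomial with roots
      \<open>L1\<close>, \<open>L2\<close> at the points \<open>C\<close> and
      \<open>- E\<close>.\<close>
    have "(C - L1 q) * (L2 q - C) = (C - L1 p) * (L2 p - C)"
      using sqz[OF q(1), unfolded q(2)] Z ABCE by simp
    then have sq1: "(C - L1 q) * (C - L2 q) = (C - L1 p) * (C - L2 p)" by (simp add: algebra_simps)
    have "(- E - L1 q) * (L2 q + E) = (- E - L1 p) * (L2 p + E)"
      using sqt[OF q(1), unfolded q(3)] T ABCE by simp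
    then have sq2: "(- E - L1 q) * (- E - L2 q) = (- E - L1 p) * (- E - L2 p)" by (simp add: algebra_simps)
    have L: "L1 q = L1 p" "L2 q = L2 p"
      using pair_eq_if_products_eq[OF sq1 sq2] ABCE b bq by auto
    \<comment> \<open>The value of \<open>(cos x)^2\<close> for which
      \<open>r2 x = L3 q\<close>.\<close>
    define w where "w = (L3 q - B) / (A - B)"
    have "(q$1)^2 = X^2 * ((A - L3 q) / (A - B))"
      using ell_coords(1)[OF eq] L ABCE by (intro scaled_eq[OF _ X(2)]) (simp_all add: mult_ac)
    moreover have "(A - L3 q) / (A - B) = 1 - w" using ABCE by (simp add: w_def field_simps)
    ultimately have 1: "(q$1 / X)^2 = 1 - w" using X(1) by (simp add: power_divide)
    have 2: "(q$2)^2 = Y^2 * w"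
      unfolding w_def using ell_coords(2)[OF eq] L ABCE by (intro scaled_eq[OF _ Y(2)]) (simp_all add: mult_ac)
    have "Y \<noteq> 0 \<or> w > 0" using q(4) Y(1) L ABCE by (auto simp: w_def)
    from sincos_or_arcsin[OF 1 2 this] obtain x where
      th: "x \<in> arc (Y = 0)" "sin x = q$1 / X" "q$2 = Y * cos x" "(cos x)^2 = w" by metis
    have r: "r2 x = L3 q" using ABCE by (simp add: r2_def th(4) w_def)
    have x: "q$1 = X * sin x" using X(1) th(2) by simp
    have zt: "Z * sqrt (L3 q - C) = q$3" "T * sqrt (L3 q + E) = q$4"
      using w[OF q(1)] q(2,3) by (auto simp: field_simps)
    have "q = curve2 X Y Z T x"
      unfolding vec_eq_iff forall_4 curve2_def vector_4 r zt by (intro conjI x th(3) refl)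
    then show ?thesis using th(1) Y(1) by auto
  qed
  have p_on: "p \<in> curve2 X Y Z T ` arc (L2 p = B)" using on[OF p(1)] p(2) by (simp add: Z_def T_def)
  have ic: "integral_curve Q N 2 (arc (L2 p = B)) (curve2 X Y Z T)"
    using Y(1) X(1) b cos_nonzero_band by (intro integral_curve_curve2[OF ell]) (auto simp: is_interval_oo split: if_splits)
  have "leaf Q N 2 p = curve2 X Y Z T ` arc (L2 p = B)"
  proof (rule leaf_eqI[OF ic p_on])
    fix g I s0 s assume ic: "integral_curve Q N 2 I g" and s: "s0 \<in> I" "g s0 = p" "s \<in> I"
    have dom: "g s \<in> Q" "L2 (g s) < L3 (g s)" using ic s by (auto simp: integral_curve_def foliation_domain_Q)
    have *: "g s $ i / sqrt (- 1 * (ax$i - Lk 2 (g s))) = g s0 $ i / sqrt (- 1 * (ax$i - Lk 2 (g s0)))"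
      if "i = 3 \<or> i = 4" for i
    proof (rule integral_curve_ratio[OF ic _ s(3,1)])
      fix p assume "p \<in> foliation_domain Q N 2"
      then have "p \<in> Q" by (simp add: foliation_domain_Q)
      then show "0 < - 1 * (ax $ i - Lk 2 p)" using w[of p] that by auto
    qed simp
    show "g s \<in> curve2 X Y Z T ` arc (L2 p = B)"
      by (rule on[OF dom(1) _ _ dom(2)]) (use *[of 3] *[of 4] s(2) in \<open>simp_all add: Z_def T_def add.commute\<close>)
  qed
  moreover have "sgn Z = sgn (p$3)" using w[OF p(1)] by (simp add: Z_def sgn_divide)
  then have "sgn (curve2 X Y Z T x $ 3) = sgn (p$3)" for x
    using radicands_23(1)[of x] by (simp add: curve2_def sgn_mult)
  \<comment> \<open>At both ends of the arc \<open>r2\<close> is \<open>B\<close>; in the degenerate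
    case \<open>L2\<close> is \<open>B\<close> as well, so the ends are partially umbilic.\<close>
  moreover have "L3 (curve2 X Y Z T (s * pi / 2)) = B" if "s \<in> signs" for s
    unfolding L_eqI(3)[OF ell] r2_def using sin_cos_sign_pi_half[OF that] by simp
  moreover have "sgn (curve2 X Y Z T (s * pi / 2) $ 1) = s" if "s \<in> signs" for s
    using sin_cos_sign_pi_half[OF that] X(1) that by (auto simp: curve2_def sgn_mult)
  moreover have "compact (range (curve2 X Y Z T))"
    by (intro compact_periodic_range continuous_on_curve2) (simp add: curve2_def r2_def)
  ultimately show ?thesis
    unfolding arc_leaf_def using p_on ic ell_in_Q[OF ell] L_eqI(2)[OF ell]
    by (intro exI[of _ "curve2 X Y Z T"]) (simp add: continuous_on_curve2)
qed

text \<open>The moving coordinate is \<open>L2\<close>, in \<open>[C, B]\<close>. The first and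
  fourth coordinates give the first integrals, with \<open>e = 1\<close> and \<open>e = - 1\<close>,
  because \<open>A\<close> lies above this interval and \<open>- E\<close> below it. Degeneration
  occurs for \<open>L3 p = B\<close>.\<close>

lemma leaf_curve3:
  assumes p: "p \<in> Q" "L2 p < L3 p"
  shows "arc_leaf 3 L3 1 3 p"
proof -
  note b = L_bounds[OF p(1)]
  define Z where "Z = sqrt (C * ((C - L1 p) * (L3 p - C)) / ((A - C) * (C + E)))"
  define Y where "Y = sqrt (B * ((B - L1 p) * (L3 p - B)) / ((A - B) * (B + E)))"
  define X T where "X = p$1 / sqrt (A - L2 p)" and "T = p$4 / sqrt (L2 p + E)"
  have w: "A - L2 p > 0" "L2 p + E > 0" if "p \<in> Q" for p
    using L_bounds[OF that] ABCE by auto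
  have k: "C * ((C - L1 p) * (L3 p - C)) > 0" "(A - C) * (C + E) > 0" "B > 0" "B - L1 p > 0"
    "(A - B) * (B + E) > 0" "B * ((B - L1 p) * (L3 p - B)) \<ge> 0"
    using b ABCE by (auto intro!: mult_pos_pos mult_nonneg_nonneg)
  have Z: "Z > 0" "Z^2 * ((A - C) * (C + E)) = C * ((C - L1 p) * (L3 p - C))"
    using k by (auto simp: Z_def)
  have Y: "Y = 0 \<longleftrightarrow> L3 p = B" "Y^2 * ((A - B) * (B + E)) = B * ((B - L1 p) * (L3 p - B))"
    using k by (auto simp: Y_def)
  have sq: "(x / sqrt u)^2 * k = m" if "x^2 * k = u * m" "u > 0" for x u k m :: real
    using that by (simp add: power_divide)
  have sqx: "(p$1 / sqrt (A - L2 p))^2 * ((A - B) * (A - C) * (A + E)) = A * ((A - L1 p) * (A - L3 p))"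
    and sqt: "(p$4 / sqrt (L2 p + E))^2 * ((A + E) * (B + E) * (C + E)) = E * ((- E - L1 p) * (L3 p + E))"
    if "p \<in> Q" for p
    using ell_coords(1,4)[OF ell_L[OF that]] w[OF that] by ((intro sq; simp add: mult_ac)+)
  note X = sqx[OF p(1), folded X_def] and T = sqt[OF p(1), folded T_def]
  have ell: "ell (curve3 X Y Z T x) (L1 p) (r3 x) (L3 p)" for x
    by (rule ell_curve3[OF _ _ _ X Y(2) Z(2) T]) (use b in auto)
  have on: "q \<in> curve3 X Y Z T ` arc (L3 p = B)"
    if q: "q \<in> Q" "q$1 / sqrt (A - L2 q) = X" "q$4 / sqrt (L2 q + E) = T" "L2 q < L3 q" for q
  proof -
    note eq = ell_L[OF q(1)] and bq = L_bounds[OF q(1)]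
    have sq1: "(A - L1 q) * (A - L3 q) = (A - L1 p) * (A - L3 p)"
      using sqx[OF q(1), unfolded q(2)] X ABCE by simp
    have "(- E - L1 q) * (L3 q + E) = (- E - L1 p) * (L3 p + E)"
      using sqt[OF q(1), unfolded q(3)] T ABCE by simp
    then have sq2: "(- E - L1 q) * (- E - L3 q) = (- E - L1 p) * (- E - L3 p)" by (simp add: algebra_simps)
    have L: "L1 q = L1 p" "L3 q = L3 p"
      using pair_eq_if_products_eq[OF sq1 sq2] ABCE b bq by auto
    define w where "w = (B - L2 q) / (B - C)"
    have "(q$3)^2 = Z^2 * ((L2 q - C) / (B - C))"
      using ell_coords(3)[OF eq] L ABCE by (intro scaled_eq[OF _ Z(2)]) (simp_all add: mult_ac)
    moreover have "(L2 q - C) / (B - C) = 1 - w" using ABCE by (simp add: w_def field_simps)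
    ultimately have 1: "(q$3 / Z)^2 = 1 - w" using Z(1) by (simp add: power_divide)
    have 2: "(q$2)^2 = Y^2 * w"
      unfolding w_def using ell_coords(2)[OF eq] L ABCE by (intro scaled_eq[OF _ Y(2)]) (simp_all add: mult_ac)
    have "Y \<noteq> 0 \<or> w > 0" using q(4) Y(1) L ABCE by (auto simp: w_def)
    from sincos_or_arcsin[OF 1 2 this] obtain x where
      th: "x \<in> arc (Y = 0)" "sin x = q$3 / Z" "q$2 = Y * cos x" "(cos x)^2 = w" by metis
    have r: "r3 x = L2 q" using ABCE by (simp add: r3_def th(4) w_def)
    have z: "q$3 = Z * sin x" using Z(1) th(2) by simp
    have xt: "X * sqrt (A - L2 q) = q$1" "T * sqrt (L2 q + E) = q$4"
      using w[OF q(1)] q(2,3) by (auto simp: field_simps)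
    have "q = curve3 X Y Z T x"
      unfolding vec_eq_iff forall_4 curve3_def vector_4 r xt by (intro conjI z th(3) refl)
    then show ?thesis using th(1) Y(1) by auto
  qed
  have p_on: "p \<in> curve3 X Y Z T ` arc (L3 p = B)" using on[OF p(1)] p(2) by (simp add: X_def T_def)
  have ic: "integral_curve Q N 3 (arc (L3 p = B)) (curve3 X Y Z T)"
    using Y(1) Z(1) b cos_nonzero_band by (intro integral_curve_curve3[OF ell]) (auto simp: is_interval_oo split: if_splits)
  have "leaf Q N 3 p = curve3 X Y Z T ` arc (L3 p = B)"
  proof (rule leaf_eqI[OF ic p_on])
    fix g I s0 s assume ic: "integral_curve Q N 3 I g" and s: "s0 \<in> I" "g s0 = p" "s \<in> I"
    have dom: "g s \<in> Q" "L2 (g s) < L3 (g s)" using ic s by (auto simp: integral_curve_def foliation_domain_Q)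
    have *: "g s $ i / sqrt (e * (ax$i - Lk 3 (g s))) = g s0 $ i / sqrt (e * (ax$i - Lk 3 (g s0)))"
      if "i = 1 \<and> e = 1 \<or> i = 4 \<and> e = - 1" for i e
    proof (rule integral_curve_ratio[OF ic _ s(3,1)])
      fix p assume "p \<in> foliation_domain Q N 3"
      then have "p \<in> Q" by (simp add: foliation_domain_Q)
      then show "0 < e * (ax $ i - Lk 3 p)" using w[of p] that by auto
    qed simp
    show "g s \<in> curve3 X Y Z T ` arc (L3 p = B)"
      by (rule on[OF dom(1) _ _ dom(2)]) (use *[of 1 1] *[of 4 "- 1"] s(2) in \<open>simp_all add: X_def T_def add.commute\<close>)
  qed
  moreover have "sgn X = sgn (p$1)" using w[OF p(1)] by (simp add: X_def sgn_divide)
  then have "sgn (curve3 X Y Z T x $ 1) = sgn (p$1)" for x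
    using radicands_23(3)[of x] by (simp add: curve3_def sgn_mult)
  moreover have "L2 (curve3 X Y Z T (s * pi / 2)) = B" if "s \<in> signs" for s
    unfolding L_eqI(2)[OF ell] r3_def using sin_cos_sign_pi_half[OF that] by simp
  moreover have "sgn (curve3 X Y Z T (s * pi / 2) $ 3) = s" if "s \<in> signs" for s
    using sin_cos_sign_pi_half[OF that] Z(1) that by (auto simp: curve3_def sgn_mult)
  moreover have "compact (range (curve3 X Y Z T))"
    by (intro compact_periodic_range continuous_on_curve3) (simp add: curve3_def r3_def)
  ultimately show ?thesis
    unfolding arc_leaf_def using p_on ic ell_in_Q[OF ell] L_eqI(3)[OF ell]
    by (intro exI[of _ "curve3 X Y Z T"]) (simp add: continuous_on_curve3)
qed

end

section \<open>Partially umbilic curves and bands\<close>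

lemma component_if_clopen:
  assumes "connected P" "P \<noteq> {}" "P = U \<inter> O'" "open O'" "P = U \<inter> K" "closed K"
  shows "P \<in> components U"
  unfolding in_components_maximal
proof (intro conjI allI impI)
  fix d assume d: "d \<noteq> {} \<and> P \<subseteq> d \<and> d \<subseteq> U \<and> connected d"
  then have "P = d \<inter> O'" "P = d \<inter> K" using assms by auto
  then have "openin (top_of_set d) P" "closedin (top_of_set d) P"
    using assms by (auto simp: openin_open closedin_closed)
  then show "d = P" using d assms(2) by (metis connected_clopen)
qed (use assms in auto)

definition emb :: "4 \<Rightarrow> 4 \<Rightarrow> real \<Rightarrow> real \<Rightarrow> real \<Rightarrow> real^4" where
  "emb i j u v t = u *\<^sub>R axis i 1 + v *\<^sub>R axis j 1 + t *\<^sub>R axis 4 1"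

lemma emb_nth:
  assumes "i \<noteq> j" "i \<noteq> 4" "j \<noteq> 4"
  shows "emb i j u v t $ i = u" "emb i j u v t $ j = v" "emb i j u v t $ 4 = t"
  using assms by (simp_all add: emb_def axis_def)

lemma emb_vector: "emb 1 3 u v t = vector [u, 0, v, t]" "emb 3 1 u v t = vector [v, 0, u, t]"
  by (simp_all add: emb_def vec_eq_iff forall_4 axis_def)

text \<open>The quadric in the hyperplane \<open>y = 0\<close>, solved for coordinate
  \<open>j\<close> in terms of coordinate \<open>i\<close> and \<open>t\<close>; \<sigma> is the
  sign of the root. Variable indices cover both kinds of bands, \<open>(1, 3)\<close> and
  \<open>(3, 1)\<close>.\<close>

definition band_graph :: "4 \<Rightarrow> 4 \<Rightarrow> real \<Rightarrow> real \<Rightarrow> real \<Rightarrow> real \<Rightarrow> real \<times> real \<Rightarrow> real^4" where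
  "band_graph i j \<sigma> \<kappa> m n = (\<lambda>(u, t). emb i j u (\<sigma> * sqrt (\<kappa> * (1 - u^2 / m + t^2 / n))) t)"

definition band_set :: "4 \<Rightarrow> 4 \<Rightarrow> real \<Rightarrow> real \<Rightarrow> real \<Rightarrow> real \<Rightarrow> real \<Rightarrow> real \<Rightarrow> (real^4) set" where
  "band_set i j \<sigma> \<kappa> m n al be = band_graph i j \<sigma> \<kappa> m n ` {(u, t). u^2 < al + be * t^2}"

lemma smooth_on_fst_snd:
  "open U \<Longrightarrow> smooth_on (\<lambda>x. fst x :: real) (U :: (real \<times> real) set)"
  "open U \<Longrightarrow> smooth_on (\<lambda>x. snd x :: real) (U :: (real \<times> real) set)"
  by (simp_all add: smooth_on_linear bounded_linear_fst bounded_linear_snd)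

lemma smooth_on_nth: "open U \<Longrightarrow> smooth_on (\<lambda>p. p $ i) (U :: (real^4) set)"
  by (simp add: smooth_on_linear bounded_linear_vec_nth)

text \<open>Over each \<open>t\<close> the band is the interval \<open>\<bar>u\<bar> < R t\<close>.
  An affine rescaling carries it onto \<open>(0, 1)\<close>, smoothly in \<open>t\<close> because
  \<open>al > 0\<close> keeps \<open>R\<close> positive.\<close>

lemma open_band_band_set:
  assumes ij: "i \<noteq> j" "i \<noteq> 4" "j \<noteq> 4" and "al > 0" "be \<ge> 0" "\<kappa> > 0" "m > 0" "n > 0"
    and rad: "\<And>u t. u^2 \<le> al + be * t^2 \<Longrightarrow> \<kappa> * (1 - u^2 / m + t^2 / n) > 0"
  shows "open_band (band_set i j \<sigma> \<kappa> m n al be)"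
  unfolding open_band_def
proof (rule diffeomorphicI)
  let ?W = "band_set i j \<sigma> \<kappa> m n al be" and ?T = "(UNIV :: real set) \<times> {0<..<1::real}"
  define R where "R t = sqrt (al + be * t^2)" for t
  have pos: "al + be * t^2 > 0" for t using assms by (intro add_pos_nonneg) auto
  have R: "R t > 0" "(R t)^2 = al + be * t^2" for t using pos[of t] by (auto simp: R_def)
  define f where "f p = (p$4, (p$i / R (p$4) + 1) * (1/2))" for p :: "real^4"
  define g where "g = (\<lambda>x. emb i j ((2 * snd x - 1) * R (fst x))
      (\<sigma> * sqrt (\<kappa> * (1 - ((2 * snd x - 1) * R (fst x))^2 / m + (fst x)^2 / n))) (fst x))"
  have bnd: "((2 * w - 1) * R t)^2 < al + be * t^2" if "w \<in> {0<..<1}" for w t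
  proof -
    have "(2 * w - 1)^2 < 1" using that by (simp add: abs_square_less_1 abs_less_iff)
    then have "(2 * w - 1)^2 * (R t)^2 < 1 * (R t)^2" using R(1)[of t] by (intro mult_strict_right_mono) auto
    then show ?thesis by (simp add: power_mult_distrib R(2))
  qed
  show "smooth_map ?W f"
    unfolding f_def R_def
    by (intro smooth_mapI[of _ UNIV] smooth_on_Pair smooth_on_mult smooth_on_add smooth_on_divide
        smooth_on_sqrt smooth_on_power smooth_on_const smooth_on_nth) (use pos in \<open>auto simp: less_imp_neq[symmetric]\<close>)
  have "smooth_on g ?T"
    unfolding g_def emb_def R_def
  proof (intro smooth_on_mult smooth_on_add smooth_on_divide smooth_on_diff smooth_on_scaleR
        smooth_on_sqrt smooth_on_power smooth_on_const smooth_on_fst_snd)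
    fix x assume "x \<in> ?T"
    then show "0 < \<kappa> * (1 - ((2 * snd x - 1) * sqrt (al + be * (fst x)^2))^2 / m + (fst x)^2 / n)"
      using bnd[of "snd x" "fst x"] by (intro rad) (auto simp: R_def)
  qed (use assms pos in \<open>auto intro: open_Times\<close>)
  then show "smooth_map ?T g" by (rule smooth_mapI) simp
  show "f ` ?W \<subseteq> ?T"
  proof
    fix y assume "y \<in> f ` ?W"
    then obtain u t where u: "u^2 < al + be * t^2" "y = (t, (u / R t + 1) * (1/2))"
      by (auto simp: f_def band_set_def band_graph_def emb_nth[OF ij])
    have "\<bar>u\<bar> < R t" using u(1) R[of t] by (metis abs_of_pos power2_less_imp_less power2_abs less_imp_le)
    then have "\<bar>u / R t\<bar> < 1" using R(1)[of t] by simp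
    then have "- 1 < u / R t" "u / R t < 1" by linarith+
    then show "y \<in> ?T" using u(2) by auto
  qed
  show "g ` ?T \<subseteq> ?W"
    using bnd by (auto simp: g_def band_set_def band_graph_def)
  show "g (f p) = p" if p: "p \<in> ?W" for p
  proof -
    obtain u t where u: "p = band_graph i j \<sigma> \<kappa> m n (u, t)" using p by (auto simp: band_set_def)
    have "(2 * ((u / R t + 1) * (1/2)) - 1) * R t = u" using R(1)[of t] by (simp add: field_simps)
    then show ?thesis by (simp add: u f_def g_def band_graph_def emb_nth[OF ij])
  qed
  show "f (g x) = x" if "x \<in> ?T" for x
    using R(1)[of "fst x"] by (auto simp: f_def g_def emb_nth[OF ij] prod_eq_iff)
qed

lemma continuous_on_band_graph: "continuous_on S (band_graph i j \<sigma> \<kappa> m n)"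
  unfolding band_graph_def emb_def case_prod_unfold divide_inverse
  by (intro continuous_intros)

text \<open>The coordinates \<open>(p$i, p$4)\<close> form a continuous left inverse of the graph
  map. So the graph over the closed region is closed, and removing the band leaves the image of the
  boundary.\<close>

lemma closure_band_set:
  assumes ij: "i \<noteq> j" "i \<noteq> 4" "j \<noteq> 4" and "al > 0" "be \<ge> 0"
  shows "closure (band_set i j \<sigma> \<kappa> m n al be) - band_set i j \<sigma> \<kappa> m n al be =
    band_graph i j \<sigma> \<kappa> m n ` {(u, t). u^2 = al + be * t^2}"
proof -
  let ?h = "band_graph i j \<sigma> \<kappa> m n"
  have inv: "?h (u, t) $ i = u" "?h (u, t) $ 4 = t" for u t
    by (simp_all add: band_graph_def emb_nth[OF ij])
  have cl: "closure (band_set i j \<sigma> \<kappa> m n al be) = ?h ` {(u, t). u^2 \<le> al + be * t^2}"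
  proof
    have eq: "?h ` {(u, t). u^2 \<le> al + be * t^2} = {p. p = ?h (p$i, p$4)} \<inter> {p. (p$i)^2 \<le> al + be * (p$4)^2}"
      using inv by (auto simp: image_iff)
    have "continuous_on UNIV (\<lambda>p. ?h (p$i, p$4))"
      by (rule continuous_on_compose2[OF continuous_on_band_graph[of UNIV]]) (auto intro!: continuous_intros)
    then have "closed (?h ` {(u, t). u^2 \<le> al + be * t^2})"
      unfolding eq by (intro closed_Int closed_Collect_eq closed_Collect_le continuous_intros)
    then show "closure (band_set i j \<sigma> \<kappa> m n al be) \<subseteq> ?h ` {(u, t). u^2 \<le> al + be * t^2}"
      by (rule closure_minimal[rotated]) (force simp: band_set_def)
    have "{(u, t). u^2 \<le> al + be * t^2} \<subseteq> closure {(u, t). u^2 < al + be * t^2}"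
    proof clarify
      fix u t :: real assume u: "u^2 \<le> al + be * t^2"
      have pos: "al + be * t^2 > 0" using assms by (intro add_pos_nonneg) auto
      \<comment> \<open>Shrinking \<open>u\<close> by factors that tend to 1 moves points of the
        closed region into the open one.\<close>
      define x where "x k = ((1 - inverse (real (Suc k))) * u, t)" for k
      have "(\<lambda>k. (1 - inverse (real (Suc k))) * u) \<longlonglongrightarrow> (1 - 0) * u"
        by (intro tendsto_intros LIMSEQ_inverse_real_of_nat)
      then have "x \<longlonglongrightarrow> (u, t)" unfolding x_def by (intro tendsto_Pair) auto
      moreover have "x k \<in> {(u, t). u^2 < al + be * t^2}" for k
      proof -
        let ?c = "1 - inverse (real (Suc k))"
        have "0 \<le> ?c" "?c < 1" by (auto simp: field_simps)
        then have c: "?c^2 < 1" by (simp add: abs_square_less_1)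
        have "(?c * u)^2 = ?c^2 * u^2" by (simp add: power_mult_distrib)
        also have "\<dots> \<le> ?c^2 * (al + be * t^2)" using u by (intro mult_left_mono) auto
        also have "\<dots> < 1 * (al + be * t^2)" using c pos by (intro mult_strict_right_mono) auto
        finally show ?thesis by (simp add: x_def)
      qed
      ultimately show "(u, t) \<in> closure {(u, t). u^2 < al + be * t^2}"
        unfolding closure_sequential by blast
    qed
    then have "?h ` {(u, t). u^2 \<le> al + be * t^2} \<subseteq> ?h ` closure {(u, t). u^2 < al + be * t^2}"
      by (rule image_mono)
    also have "\<dots> \<subseteq> closure (band_set i j \<sigma> \<kappa> m n al be)"
      by (rule image_closure_subset[OF continuous_on_band_graph closed_closure])
         (simp add: band_set_def closure_subset)
    finally show "?h ` {(u, t). u^2 \<le> al + be * t^2} \<subseteq> closure (band_set i j \<sigma> \<kappa> m n al be)" .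
  qed
  have "inj ?h" using inv by (metis injI prod.collapse)
  then show ?thesis
    unfolding cl unfolding band_set_def by (subst image_set_diff[symmetric]) (auto intro!: arg_cong[where f = "image ?h"])
qed

context quadric
begin

text \<open>In the hyperplane \<open>y = 0\<close>, the partially umbilic points are given by either of the equations
  \<open>x\<^sup>2 = al1 + be1 t\<^sup>2\<close> and \<open>z\<^sup>2 = al3 + be3 t\<^sup>2\<close>.\<close>

definition "al1 = A * (A - B) / (A - C)"
definition "be1 = A * (A - B) * (C + E) / (E * (B + E) * (A - C))"
definition "al3 = C * (B - C) / (A - C)"
definition "be3 = C * (B - C) * (A + E) / (E * (B + E) * (A - C))"

lemma al_be_pos: "al1 > 0" "be1 > 0" "al3 > 0" "be3 > 0"
  using ABCE by (auto simp: al1_def be1_def al3_def be3_def intro!: divide_pos_pos mult_pos_pos)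

lemma al_be_radicand_pos: "al1 + be1 * t^2 > 0" "al3 + be3 * t^2 > 0"
  using al_be_pos by (auto intro!: add_pos_nonneg)

lemma al_be_relations:
  "al3 = C * (1 - al1 / A)" "be3 = C * (1 / E - be1 / A)"
  "al1 = A * (1 - al3 / C)" "be1 = A * (1 / E - be3 / C)"
  using ABCE unfolding al1_def be1_def al3_def be3_def
  by (simp_all add: divide_simps) (simp_all add: algebra_simps)

text \<open>Where \<open>x^2 = al1 + be1 * t^2\<close>, the quadric gives
  \<open>z^2 = al3 + be3 * t^2\<close>: the two descriptions of the partially umbilic points
  agree.\<close>

lemma radicand_1: "C * (1 - (al1 + be1 * t^2) / A + t^2 / E) = al3 + be3 * t^2"
  unfolding al_be_relations(1,2) by (simp add: algebra_simps add_divide_distrib)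

lemma radicand_3: "A * (1 - (al3 + be3 * t^2) / C + t^2 / E) = al1 + be1 * t^2"
  unfolding al_be_relations(3,4) by (simp add: algebra_simps add_divide_distrib)

text \<open>The radicand decreases in \<open>u^2\<close>, and on the edge of the band it is positive
  by \<open>radicand_1\<close>.\<close>

lemma radicand_pos_1:
  assumes "u^2 \<le> al1 + be1 * t^2"
  shows "C * (1 - u^2 / A + t^2 / E) > 0"
proof -
  have "al3 + be3 * t^2 \<le> C * (1 - u^2 / A + t^2 / E)"
    unfolding radicand_1[symmetric] using assms ABCE by (intro mult_left_mono add_right_mono diff_left_mono divide_right_mono) auto
  then show ?thesis using al_be_radicand_pos(2)[of t] by linarith
qed

lemma radicand_pos_3:
  assumes "u^2 \<le> al3 + be3 * t^2"
  shows "A * (1 - u^2 / C + t^2 / E) > 0"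
proof -
  have "al1 + be1 * t^2 \<le> A * (1 - u^2 / C + t^2 / E)"
    unfolding radicand_3[symmetric] using assms ABCE by (intro mult_left_mono add_right_mono diff_left_mono divide_right_mono) auto
  then show ?thesis using al_be_radicand_pos(1)[of t] by linarith
qed

text \<open>The deviation from the partially umbilic curves is a multiple of \<open>l - B\<close>,
  with opposite signs in the two equations. As \<open>l \<ge> B\<close> if \<open>L2 p = B\<close>
  and \<open>l \<le> B\<close> if \<open>L3 p = B\<close>, the side of the curves shows which
  elliptic coordinate equals \<open>B\<close>; \<open>plane_iff\<close> records this.\<close>

lemma plane_gap:
  assumes p: "p \<in> Q" and l: "L2 p = B \<and> l = L3 p \<or> L3 p = B \<and> l = L2 p"
  shows "(p$1)^2 = al1 + be1 * (p$4)^2 - A * ((l - B) * (B - L1 p)) / ((A - C) * (B + E))"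
    and "(p$3)^2 = al3 + be3 * (p$4)^2 + C * ((l - B) * (B - L1 p)) / ((A - C) * (B + E))"
proof -
  note c = plane_coords[OF ell_L[OF p] l]
  show "(p$1)^2 = al1 + be1 * (p$4)^2 - A * ((l - B) * (B - L1 p)) / ((A - C) * (B + E))"
    unfolding c(1,3) al1_def be1_def using ABCE by (simp add: divide_simps) (simp add: algebra_simps)
  show "(p$3)^2 = al3 + be3 * (p$4)^2 + C * ((l - B) * (B - L1 p)) / ((A - C) * (B + E))"
    unfolding c(2,3) al3_def be3_def using ABCE by (simp add: divide_simps) (simp add: algebra_simps)
qed

lemma y_zero_iff:
  assumes "p \<in> Q"
  shows "p$2 = 0 \<longleftrightarrow> L2 p = B \<or> L3 p = B"
proof -
  note e = ell_L[OF assms] and b = L_bounds[OF assms]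
  have "(p$2)^2 * ((A - B) * (B - C) * (B + E)) = 0 \<longleftrightarrow> L2 p = B \<or> L3 p = B"
    unfolding ell_coords(2)[OF e] using b ABCE by auto
  then show ?thesis using ABCE by auto
qed

lemma plane_iff:
  assumes p: "p \<in> Q" and y: "p$2 = 0"
  shows "(p$1)^2 < al1 + be1 * (p$4)^2 \<longleftrightarrow> L2 p = B \<and> L2 p < L3 p"
    and "(p$3)^2 < al3 + be3 * (p$4)^2 \<longleftrightarrow> L3 p = B \<and> L2 p < L3 p"
    and "(p$1)^2 = al1 + be1 * (p$4)^2 \<longleftrightarrow> L2 p = L3 p"
    and "(p$3)^2 = al3 + be3 * (p$4)^2 \<longleftrightarrow> L2 p = L3 p"
proof -
  note b = L_bounds[OF p]
  obtain l where l: "L2 p = B \<and> l = L3 p \<or> L3 p = B \<and> l = L2 p"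
    using y y_zero_iff[OF p] by blast
  define k where "k = (B - L1 p) / ((A - C) * (B + E))"
  have k: "k > 0" using b ABCE unfolding k_def by (intro divide_pos_pos mult_pos_pos) auto
  have x: "(p$1)^2 = al1 + be1 * (p$4)^2 - A * k * (l - B)"
    using plane_gap(1)[OF p l] by (simp add: k_def mult_ac)
  have z: "(p$3)^2 = al3 + be3 * (p$4)^2 + C * k * (l - B)"
    using plane_gap(2)[OF p l] by (simp add: k_def mult_ac)
  have Ak: "A * k > 0" "C * k > 0" using k ABCE by auto
  show "(p$1)^2 < al1 + be1 * (p$4)^2 \<longleftrightarrow> L2 p = B \<and> L2 p < L3 p"
    unfolding x using l b Ak by (auto simp: zero_less_mult_iff mult_less_0_iff)
  show "(p$3)^2 < al3 + be3 * (p$4)^2 \<longleftrightarrow> L3 p = B \<and> L2 p < L3 p"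
    unfolding z using l b Ak by (auto simp: zero_less_mult_iff mult_less_0_iff)
  show "(p$1)^2 = al1 + be1 * (p$4)^2 \<longleftrightarrow> L2 p = L3 p"
    unfolding x using l b Ak by auto
  show "(p$3)^2 = al3 + be3 * (p$4)^2 \<longleftrightarrow> L2 p = L3 p"
    unfolding z using l b Ak by auto
qed

section \<open>The four partially umbilic curves\<close>

lemma Q_plane_iff:
  assumes "p$2 = 0"
  shows "p \<in> Q \<longleftrightarrow> (p$3)^2 = C * (1 - (p$1)^2 / A + (p$4)^2 / E)"
    and "p \<in> Q \<longleftrightarrow> (p$1)^2 = A * (1 - (p$3)^2 / C + (p$4)^2 / E)"
  using assms ABCE by (auto simp: Q_iff_coords field_simps)

definition pcurve :: "real \<Rightarrow> real \<Rightarrow> real \<Rightarrow> real^4" where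
  "pcurve s r t = vector [s * sqrt (al1 + be1 * t^2), 0, r * sqrt (al3 + be3 * t^2), t]"

lemma signs_sq: "s \<in> signs \<Longrightarrow> s^2 = 1"
  by auto

lemma pcurve_umbilic:
  assumes "s \<in> signs" "r \<in> signs"
  shows "pcurve s r t \<in> Q" "L2 (pcurve s r t) = L3 (pcurve s r t)"
proof -
  have y: "pcurve s r t $ 2 = 0" by (simp add: pcurve_def)
  have x: "(pcurve s r t $ 1)^2 = al1 + be1 * (pcurve s r t $ 4)^2"
    and z: "(pcurve s r t $ 3)^2 = al3 + be3 * (pcurve s r t $ 4)^2"
    using al_be_radicand_pos[of t] signs_sq assms by (simp_all add: pcurve_def power_mult_distrib)
  show Q: "pcurve s r t \<in> Q" unfolding Q_plane_iff(1)[OF y] x z radicand_1 ..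
  show "L2 (pcurve s r t) = L3 (pcurve s r t)" using plane_iff(3)[OF Q y] x by blast
qed

lemma eq_sgn_sqrt:
  fixes x w :: real
  assumes "x^2 = w"
  shows "x = sgn x * sqrt w"
  unfolding assms[symmetric] by (simp add: sgn_mult_abs)

lemma umbilic_in_pcurve:
  assumes "p \<in> Q" "L2 p = L3 p"
  shows "p = pcurve (sgn (p$1)) (sgn (p$3)) (p$4)"
proof -
  have y: "p$2 = 0" using y_zero_iff[OF assms(1)] L_bounds[OF assms(1)] assms(2) by auto
  have x: "(p$1)^2 = al1 + be1 * (p$4)^2" and z: "(p$3)^2 = al3 + be3 * (p$4)^2"
    using plane_iff(3,4)[OF assms(1) y] assms(2) by auto
  show ?thesis
    unfolding vec_eq_iff forall_4 pcurve_def vector_4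
    by (intro conjI eq_sgn_sqrt x z y refl)
qed

lemma sgn_pcurve:
  assumes "s \<in> signs" "r \<in> signs"
  shows "sgn (pcurve s r t $ 1) = s" "sgn (pcurve s r t $ 3) = r"
  using assms al_be_radicand_pos[of t] by (auto simp: pcurve_def sgn_mult)

lemma umbilic_coords_nonzero:
  assumes "p \<in> Q" "L2 p = L3 p"
  shows "sgn (p$1) \<in> signs" "sgn (p$3) \<in> signs"
proof -
  have y: "p$2 = 0" using y_zero_iff[OF assms(1)] L_bounds[OF assms(1)] assms(2) by auto
  have "(p$1)^2 > 0" "(p$3)^2 > 0"
    using plane_iff(3,4)[OF assms(1) y] assms(2) al_be_radicand_pos[of "p$4"] by auto
  then show "sgn (p$1) \<in> signs" "sgn (p$3) \<in> signs" by (auto simp: sgn_real_def)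
qed

lemma range_pcurve:
  assumes "s \<in> signs" "r \<in> signs"
  shows "range (pcurve s r) = {p \<in> Q. L2 p = L3 p \<and> sgn (p$1) = s \<and> sgn (p$3) = r}"
  using pcurve_umbilic[OF assms] sgn_pcurve[OF assms] umbilic_in_pcurve by fastforce

lemma continuous_on_pcurve: "continuous_on S (pcurve s r)"
  unfolding pcurve_def[abs_def] by (intro continuous_on_vector_4 continuous_intros)

lemma regular_curve_pcurve: "regular_curve (range (pcurve s r))"
proof -
  have "diffeomorphic (range (pcurve s r)) (UNIV :: real set)"
  proof (rule diffeomorphicI[where f = "\<lambda>q. q$4" and g = "pcurve s r"])
    have id: "smooth_on (\<lambda>s. s) (UNIV :: real set)"
      by (intro smooth_on_linear bounded_linear_ident) auto
    show "smooth_map UNIV (pcurve s r)"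
      unfolding pcurve_def
      by (intro smooth_mapI[of _ UNIV] smooth_on_vector_4 smooth_on_mult smooth_on_sqrt smooth_on_add
          smooth_on_power id smooth_on_const al_be_radicand_pos) auto
    show "smooth_map (range (pcurve s r)) (\<lambda>q. q$4)"
      by (intro smooth_mapI[of _ UNIV] smooth_on_nth) auto
  qed (auto simp: pcurve_def)
  moreover have "connected (range (pcurve s r))"
    by (intro connected_continuous_image continuous_on_pcurve connected_UNIV)
  ultimately show ?thesis
    unfolding regular_curve_def by (auto intro: exI[of _ UNIV])
qed

text \<open>Neither \<open>x\<close> nor \<open>z\<close> vanishes on the partially umbilic set, so
  prescribing their signs by strict or by weak inequalities gives the same subset, which is
  therefore relatively open and closed. It is connected as the image of the
  \<open>t\<close>-axis.\<close>

lemma components_partially_umbilic: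
  "components (partially_umbilic_set Q N) = (\<lambda>(s, r). range (pcurve s r)) ` (signs \<times> signs)"
proof -
  let ?U = "{p \<in> Q. L2 p = L3 p}"
  have comp: "range (pcurve s r) \<in> components ?U" if "s \<in> signs" "r \<in> signs" for s r
  proof (rule component_if_clopen)
    show "connected (range (pcurve s r))"
      by (intro connected_continuous_image continuous_on_pcurve connected_UNIV)
    have sgn: "sgn x = \<sigma> \<longleftrightarrow> 0 < \<sigma> * x" if "\<sigma> \<in> signs" for x \<sigma> :: real
      using that by (auto simp: sgn_real_def)
    have nz: "(0 \<le> s * p$1 \<longleftrightarrow> 0 < s * p$1) \<and> (0 \<le> r * p$3 \<longleftrightarrow> 0 < r * p$3)" if "p \<in> ?U" for p
    proof -
      have "p$1 \<noteq> 0" "p$3 \<noteq> 0" using umbilic_coords_nonzero[of p] that by auto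
      then show ?thesis using \<open>s \<in> signs\<close> \<open>r \<in> signs\<close> by auto
    qed
    show 1: "range (pcurve s r) = ?U \<inter> ({p. 0 < s * p$1} \<inter> {p. 0 < r * p$3})"
      unfolding range_pcurve[OF that] sgn[OF that(1)] sgn[OF that(2)] by blast
    show "range (pcurve s r) = ?U \<inter> ({p. 0 \<le> s * p$1} \<inter> {p. 0 \<le> r * p$3})"
      unfolding 1 using nz by blast
    show "open ({p. 0 < s * p$1} \<inter> {p. 0 < r * (p :: real^4)$3})"
      by (intro open_Int open_Collect_less continuous_intros)
    show "closed ({p. 0 \<le> s * p$1} \<inter> {p. 0 \<le> r * (p :: real^4)$3})"
      by (intro closed_Int closed_Collect_le continuous_intros)
  qed simp
  have "c \<in> (\<lambda>(s, r). range (pcurve s r)) ` (signs \<times> signs)" if c: "c \<in> components ?U" for c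
  proof -
    obtain p where p: "p \<in> c" "p \<in> ?U"
      using c in_components_nonempty in_components_subset by blast
    then have s: "sgn (p$1) \<in> signs" "sgn (p$3) \<in> signs" using umbilic_coords_nonzero by auto
    have "p \<in> range (pcurve (sgn (p$1)) (sgn (p$3)))" using range_pcurve[OF s] p by auto
    then have "c = range (pcurve (sgn (p$1)) (sgn (p$3)))"
      using components_eq[OF c comp[OF s]] p(1) by blast
    then show ?thesis using s by blast
  qed
  moreover have "c \<in> components ?U" if "c \<in> (\<lambda>(s, r). range (pcurve s r)) ` (signs \<times> signs)" for c
    using that comp by auto
  ultimately show ?thesis unfolding partially_umbilic_set_Q by (intro equalityI subsetI)
qed

section \<open>The four bands and their boundaries\<close>

definition band1 :: "real \<Rightarrow> (real^4) set" where "band1 r = band_set 1 3 r C A E al1 be1"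
text \<open>The digit in the name is the index of the coordinate that runs across the band; the
  argument is the sign of the other one, \<open>z\<close> for \<open>band1\<close> and
  \<open>x\<close> for \<open>band3\<close>.\<close>

definition band3 :: "real \<Rightarrow> (real^4) set" where "band3 s = band_set 3 1 s A C E al3 be3"

lemma index_4_distinct: "(1::4) \<noteq> 3" "(3::4) \<noteq> 1" "(1::4) \<noteq> 4" "(3::4) \<noteq> 4"
  by simp_all

lemma open_band_bands: "open_band (band1 r)" "open_band (band3 s)"
  unfolding band1_def band3_def
  by (intro open_band_band_set radicand_pos_1 radicand_pos_3 index_4_distinct;
      use al_be_pos ABCE in \<open>simp add: less_imp_le\<close>)+

lemma pcurve_emb:
  "pcurve s r t = emb 1 3 (s * sqrt (al1 + be1 * t^2)) (r * sqrt (al3 + be3 * t^2)) t"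
  "pcurve s r t = emb 3 1 (r * sqrt (al3 + be3 * t^2)) (s * sqrt (al1 + be1 * t^2)) t"
  by (simp_all add: pcurve_def emb_vector)

lemma band_graph_boundary:
  assumes rad: "\<And>t. \<kappa> * (1 - (al + be * t^2) / m + t^2 / n) = w t" and pos: "\<And>t. al + be * t^2 > 0"
  shows "band_graph i j \<sigma> \<kappa> m n ` {(u, t). u^2 = al + be * t^2} =
    range (\<lambda>t. emb i j (1 * sqrt (al + be * t^2)) (\<sigma> * sqrt (w t)) t) \<union>
    range (\<lambda>t. emb i j (- 1 * sqrt (al + be * t^2)) (\<sigma> * sqrt (w t)) t)"
proof -
  have "u^2 = al + be * t^2 \<longleftrightarrow> u = 1 * sqrt (al + be * t^2) \<or> u = - 1 * sqrt (al + be * t^2)" for u t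
  proof -
    have "u^2 = al + be * t^2 \<longleftrightarrow> u^2 = (sqrt (al + be * t^2))^2" using pos[of t] by simp
    then show ?thesis by (simp only: power2_eq_iff) simp
  qed
  then have "{(u, t). u^2 = al + be * t^2} = range (\<lambda>t. (1 * sqrt (al + be * t^2), t)) \<union> range (\<lambda>t. (- 1 * sqrt (al + be * t^2), t))"
    by blast
  moreover have "(sqrt (al + be * t^2))^2 = al + be * t^2" for t
    using pos[of t] by simp
  ultimately show ?thesis by (simp add: image_Un image_image band_graph_def rad)
qed

lemma closure_band1: "closure (band1 r) - band1 r = range (pcurve 1 r) \<union> range (pcurve (- 1) r)"
  unfolding band1_def pcurve_emb(1)[abs_def]
  using al_be_pos by (subst closure_band_set) (auto simp: band_graph_boundary[OF radicand_1 al_be_radicand_pos(1)])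

lemma closure_band3: "closure (band3 s) - band3 s = range (pcurve s 1) \<union> range (pcurve s (- 1))"
  unfolding band3_def pcurve_emb(2)[abs_def]
  using al_be_pos by (subst closure_band_set) (auto simp: band_graph_boundary[OF radicand_3 al_be_radicand_pos(2)])

lemma band_set_eq:
  assumes ij: "i = 1 \<and> j = 3 \<or> i = 3 \<and> j = 1" and "\<sigma> \<in> signs"
    and Q: "\<And>p. p$2 = 0 \<Longrightarrow> p \<in> Q \<longleftrightarrow> (p$j)^2 = \<kappa> * (1 - (p$i)^2 / m + (p$4)^2 / n)"
    and rad: "\<And>u t. u^2 \<le> al + be * t^2 \<Longrightarrow> \<kappa> * (1 - u^2 / m + t^2 / n) > 0"
  shows "band_set i j \<sigma> \<kappa> m n al be =
    {p \<in> Q. p$2 = 0 \<and> (p$i)^2 < al + be * (p$4)^2 \<and> sgn (p$j) = \<sigma>}"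
proof (intro equalityI subsetI)
  have nth: "emb i j u v t $ i = u" "emb i j u v t $ j = v" "emb i j u v t $ 4 = t" "emb i j u v t $ 2 = 0" for u v t
    using ij by (auto simp: emb_vector)
  {
    fix p assume "p \<in> band_set i j \<sigma> \<kappa> m n al be"
    then obtain u t where u: "u^2 < al + be * t^2" and p: "p = emb i j u (\<sigma> * sqrt (\<kappa> * (1 - u^2 / m + t^2 / n))) t"
      by (auto simp: band_graph_def band_set_def)
    have pos: "\<kappa> * (1 - u^2 / m + t^2 / n) > 0" using u by (intro rad) simp
    then have "(p$j)^2 = \<kappa> * (1 - u^2 / m + t^2 / n)" "sgn (p$j) = \<sigma>"
      unfolding p nth using \<open>\<sigma> \<in> signs\<close> by (auto simp: power_mult_distrib sgn_mult)
    then show "p \<in> {p \<in> Q. p$2 = 0 \<and> (p$i)^2 < al + be * (p$4)^2 \<and> sgn (p$j) = \<sigma>}"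
      using Q[of p] u nth by (simp add: p)
  }
  fix p assume p: "p \<in> {p \<in> Q. p$2 = 0 \<and> (p$i)^2 < al + be * (p$4)^2 \<and> sgn (p$j) = \<sigma>}"
  then have "(p$j)^2 = \<kappa> * (1 - (p$i)^2 / m + (p$4)^2 / n)" using Q[of p] by blast
  from eq_sgn_sqrt[OF this] have "p$j = \<sigma> * sqrt (\<kappa> * (1 - (p$i)^2 / m + (p$4)^2 / n))"
    using p by simp
  then have "p = band_graph i j \<sigma> \<kappa> m n (p$i, p$4)"
    using ij p by (auto simp: band_graph_def emb_vector vec_eq_iff forall_4)
  then show "p \<in> band_set i j \<sigma> \<kappa> m n al be" unfolding band_set_def using p by blast
qed

text \<open>The band is the locus where the coordinate \<open>L2\<close>, constant on the lines of
  the second foliation, equals \<open>B\<close>, cut by a sign. In this form it can be compared with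
  leaves; \<open>band3\<close> belongs to the third foliation in the same way.\<close>

lemma band1_eq:
  assumes "r \<in> signs"
  shows "band1 r = {p \<in> Q. L2 p = B \<and> L2 p < L3 p \<and> sgn (p$3) = r}"
proof -
  have "band1 r = {p \<in> Q. p$2 = 0 \<and> (p$1)^2 < al1 + be1 * (p$4)^2 \<and> sgn (p$3) = r}"
    unfolding band1_def by (intro band_set_eq assms Q_plane_iff(1) radicand_pos_1) auto
  then show ?thesis using plane_iff(1) y_zero_iff by blast
qed

lemma band3_eq:
  assumes "s \<in> signs"
  shows "band3 s = {p \<in> Q. L3 p = B \<and> L2 p < L3 p \<and> sgn (p$1) = s}"
proof -
  have "band3 s = {p \<in> Q. p$2 = 0 \<and> (p$3)^2 < al3 + be3 * (p$4)^2 \<and> sgn (p$1) = s}"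
    unfolding band3_def by (intro band_set_eq assms Q_plane_iff(2) radicand_pos_3) auto
  then show ?thesis using plane_iff(2) y_zero_iff by blast
qed

section \<open>Separatrix surfaces and compact leaves\<close>

lemma integral_curve_affine:
  assumes ic: "integral_curve Q N k J \<Gamma>" and k: "k \<in> {1, 2, 3}" and "\<beta> \<noteq> 0"
    and I: "open I" "is_interval I" "\<And>s. s \<in> I \<Longrightarrow> \<alpha> + \<beta> * s \<in> J"
  shows "integral_curve Q N k I (\<lambda>s. \<Gamma> (\<alpha> + \<beta> * s))"
proof -
  obtain v where v: "continuous_on J v" "\<And>s. s \<in> J \<Longrightarrow> (\<Gamma> has_vector_derivative v s) (at s)"
    "\<And>s. s \<in> J \<Longrightarrow> v s \<noteq> 0" "\<And>s. s \<in> J \<Longrightarrow> v s \<in> eigenline_field Q N k (\<Gamma> s)"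
    using ic unfolding integral_curve_def by blast
  have dom: "\<Gamma> s \<in> foliation_domain Q N k" if "s \<in> J" for s
    using ic that by (auto simp: integral_curve_def)
  then have Q: "\<Gamma> s \<in> Q" if "s \<in> J" for s
    using k that by (auto simp: foliation_domain_Q)
  define v' where "v' s = \<beta> *\<^sub>R v (\<alpha> + \<beta> * s)" for s
  have "continuous_on I v'"
    unfolding v'_def by (intro continuous_intros continuous_on_compose2[OF v(1)]) (use I in auto)
  moreover have "((\<lambda>s. \<Gamma> (\<alpha> + \<beta> * s)) has_vector_derivative v' s) (at s)" if "s \<in> I" for s
  proof -
    have "((\<lambda>s. \<alpha> + \<beta> * s) has_vector_derivative \<beta>) (at s)"
      by (auto intro!: derivative_eq_intros)
    from vector_diff_chain_at[OF this] v(2)[OF I(3)[OF that]]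
    show ?thesis by (simp add: o_def v'_def)
  qed
  moreover have "v' s \<noteq> 0" if "s \<in> I" for s
    using v(3)[OF I(3)[OF that]] \<open>\<beta> \<noteq> 0\<close> by (simp add: v'_def)
  moreover have "v' s \<in> eigenline_field Q N k (\<Gamma> (\<alpha> + \<beta> * s))" if "s \<in> I" for s
  proof -
    let ?r = "\<alpha> + \<beta> * s"
    have m: "?r \<in> J" by (rule I(3)[OF that])
    obtain \<nu> where \<nu>: "v ?r \<bullet> lam (\<Gamma> ?r) = 0" "\<And>i. v ?r $ i * (Lk k (\<Gamma> ?r) - ax $ i) = \<nu> * \<Gamma> ?r $ i"
      using v(4)[OF m] by (auto simp: eigenline_field_Q[OF Q[OF m] k] eigdir_def)
    have "eigdir (\<Gamma> ?r) (Lk k (\<Gamma> ?r)) (v' s)"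
      unfolding eigdir_def v'_def using \<nu> by (intro conjI exI[of _ "\<beta> * \<nu>"]) (simp_all add: mult.assoc)
    then show ?thesis by (simp add: eigenline_field_Q[OF Q[OF m] k])
  qed
  ultimately show ?thesis
    unfolding integral_curve_def using I dom by blast
qed

text \<open>The affine map sends 1 to \<open>s * pi / 2\<close>. Limiting endpoints are approached
  at the right end of \<open>(0, 1)\<close>, so for \<open>s = - 1\<close> the arc is traversed
  backwards.\<close>

lemma affine_image_arc:
  assumes "s \<in> signs"
  shows "(\<lambda>\<tau>. - (s * pi / 2) + s * pi * \<tau>) ` {0<..<1} = {- pi / 2<..<pi / 2}"
proof (intro equalityI subsetI)
  fix x assume "x \<in> (\<lambda>\<tau>. - (s * pi / 2) + s * pi * \<tau>) ` {0<..<1}"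
  then obtain \<tau> where t: "0 < \<tau>" "\<tau> < 1" "x = - (s * pi / 2) + s * pi * \<tau>" by auto
  have "pi * \<tau> > 0" "pi * \<tau> < pi" using t by auto
  then show "x \<in> {- pi / 2<..<pi / 2}" using assms t(3) by auto
next
  fix x assume t: "x \<in> {- pi / 2<..<pi / 2}"
  let ?t = "s * x / pi + 1 / 2"
  have "x = - (s * pi / 2) + s * pi * ?t" using assms by (auto simp: field_simps)
  moreover have "?t \<in> {0<..<1}" using assms t pi_gt_zero by (auto simp: field_simps)
  ultimately show "x \<in> (\<lambda>\<tau>. - (s * pi / 2) + s * pi * \<tau>) ` {0<..<1}" by blast
qed

lemma limiting_endpoint_arc:
  assumes ic: "integral_curve Q N k {- pi / 2<..<pi / 2} \<Gamma>" and k: "k \<in> {2, 3}" and "s \<in> signs"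
    and cont: "continuous_on UNIV \<Gamma>" and q: "L2 (\<Gamma> (s * pi / 2)) = L3 (\<Gamma> (s * pi / 2))"
  shows "limiting_endpoint Q N k (\<Gamma> ` {- pi / 2<..<pi / 2}) (\<Gamma> (s * pi / 2))"
  unfolding limiting_endpoint_def
proof (intro conjI exI)
  let ?g = "\<lambda>\<tau>. \<Gamma> (- (s * pi / 2) + s * pi * \<tau>)"
  have k': "k \<in> {1, 2, 3}" using k by auto
  have "L2 x < L3 x" if "x \<in> \<Gamma> ` {- pi / 2<..<pi / 2}" for x
    using ic that k foliation_domain_Q by (auto simp: integral_curve_def)
  then show "\<Gamma> (s * pi / 2) \<notin> \<Gamma> ` {- pi / 2<..<pi / 2}" using q by fastforce
  show "integral_curve Q N k {0<..<1} ?g"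
    by (rule integral_curve_affine[OF ic k'])
       (use affine_image_arc[OF \<open>s \<in> signs\<close>] assms(3) in \<open>auto simp: is_interval_oo\<close>)
  show "?g ` {0<..<1} = \<Gamma> ` {- pi / 2<..<pi / 2}"
    unfolding affine_image_arc[OF \<open>s \<in> signs\<close>, symmetric] by (simp add: image_image)
  have "isCont ?g 1"
    by (intro continuous_at_compose[unfolded o_def, of 1 _ \<Gamma>] continuous_intros)
       (use cont in \<open>simp add: continuous_on_eq_continuous_at\<close>)
  then have "(?g \<longlongrightarrow> ?g 1) (at_left 1)"
    unfolding isCont_def by (rule tendsto_within_subset) auto
  then show "(?g \<longlongrightarrow> \<Gamma> (s * pi / 2)) (at_left 1)" by (simp add: algebra_simps)
qed

lemma limiting_endpoint_const:
  assumes le: "limiting_endpoint Q N k S q" and q: "q \<in> Q" and "S \<subseteq> Q" "S \<noteq> {}"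
    and f: "continuous_on Q f" "\<And>x. x \<in> S \<Longrightarrow> f x = y"
  shows "f q = (y :: real)"
proof -
  obtain g where g: "g ` {0<..<1} = S" "(g \<longlongrightarrow> q) (at_left (1::real))"
    using le unfolding limiting_endpoint_def by blast
  have ev: "\<forall>\<^sub>F \<tau> in at_left 1. g \<tau> \<in> S"
    unfolding g(1)[symmetric] eventually_at_left_field by (intro exI[of _ 0]) auto
  have "\<forall>\<^sub>F \<tau> in at_left 1. g \<tau> \<in> Q" using ev assms(3) by (auto elim: eventually_mono)
  then have "((\<lambda>\<tau>. f (g \<tau>)) \<longlongrightarrow> f q) (at_left 1)"
    by (intro continuous_on_tendsto_compose[OF f(1) g(2) q])
  moreover have "((\<lambda>\<tau>. f (g \<tau>)) \<longlongrightarrow> y) (at_left 1)"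
    using ev f(2) by (intro tendsto_eventually) (auto elim: eventually_mono)
  ultimately show ?thesis by (rule tendsto_unique[OF trivial_limit_at_left_real])
qed

text \<open>The sign is continuous away from 0, so it passes to the limit just as the elliptic
  coordinate does in \<open>limiting_endpoint_const\<close>.\<close>

lemma limiting_endpoint_sgn:
  assumes le: "limiting_endpoint Q N k S q" and "q$i \<noteq> 0"
    and s: "\<And>x. x \<in> S \<Longrightarrow> sgn (x$i) = y"
  shows "sgn (q$i) = y"
proof -
  obtain g where g: "g ` {0<..<1} = S" "(g \<longlongrightarrow> q) (at_left (1::real))"
    using le unfolding limiting_endpoint_def by blast
  have ev: "\<forall>\<^sub>F \<tau> in at_left 1. g \<tau> \<in> S"
    unfolding g(1)[symmetric] eventually_at_left_field by (intro exI[of _ 0]) auto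
  have "((\<lambda>\<tau>. sgn (g \<tau> $ i)) \<longlongrightarrow> sgn (q$i)) (at_left 1)"
    by (intro tendsto_sgn tendsto_vec_nth g assms(2))
  moreover have "((\<lambda>\<tau>. sgn (g \<tau> $ i)) \<longlongrightarrow> y) (at_left 1)"
    using ev s by (intro tendsto_eventually) (auto elim: eventually_mono)
  ultimately show ?thesis by (rule tendsto_unique[OF trivial_limit_at_left_real])
qed

text \<open>An endpoint inherits \<open>f\<close> and the sign of coordinate \<open>i\<close> from
  its leaf; as \<open>f = B\<close> at partially umbilic points, the leaf lies in the band.
  Conversely, every leaf in the band is an arc whose ends have opposite signs of coordinate
  \<open>j\<close>, and the end with sign \<open>s\<close> lies on the given curve. Hence both
  values of \<open>s\<close> give the same surface.\<close>

lemma separatrix_surface_arc: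
  assumes k: "k \<in> {2, 3}" and f: "continuous_on Q f" "\<And>p. p \<in> Q \<Longrightarrow> L2 p = L3 p \<Longrightarrow> f p = B"
    and leaf: "\<And>p. p \<in> Q \<Longrightarrow> L2 p < L3 p \<Longrightarrow> arc_leaf k f i j p" and "r \<in> signs" "s \<in> signs"
  shows "separatrix_surface Q N k {p \<in> Q. L2 p = L3 p \<and> sgn (p$i) = r \<and> sgn (p$j) = s} =
    {p \<in> Q. f p = B \<and> L2 p < L3 p \<and> sgn (p$i) = r}" (is "separatrix_surface Q N k ?P = ?W")
proof (intro equalityI subsetI)
  fix x assume "x \<in> separatrix_surface Q N k ?P"
  then obtain p q where p: "p \<in> Q" "L2 p < L3 p" and x: "x \<in> leaf Q N k p"
    and le: "limiting_endpoint Q N k (leaf Q N k p) q" and q: "q \<in> ?P"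
    unfolding separatrix_surface_def leaves_def using k foliation_domain_Q by auto
  obtain \<Gamma> where \<Gamma>: "leaf Q N k p = \<Gamma> ` arc (f p = B)" "integral_curve Q N k (arc (f p = B)) \<Gamma>"
    "\<And>x. \<Gamma> x \<in> Q \<and> f (\<Gamma> x) = f p \<and> sgn (\<Gamma> x $ i) = sgn (p$i)"
    using leaf[OF p] unfolding arc_leaf_def by blast
  then have L: "y \<in> Q" "f y = f p" "sgn (y$i) = sgn (p$i)" if "y \<in> leaf Q N k p" for y
    using that by auto
  have "f q = f p"
    by (rule limiting_endpoint_const[OF le _ _ _ f(1) L(2)]) (use x q L in auto)
  moreover have "sgn (q$i) = sgn (p$i)"
    using q \<open>r \<in> signs\<close> by (intro limiting_endpoint_sgn[OF le _ L(3)]) auto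
  moreover have "x \<in> foliation_domain Q N k"
    using \<Gamma>(2) x unfolding \<Gamma>(1) integral_curve_def by auto
  ultimately show "x \<in> ?W" using q f(2)[of q] L[OF x] k foliation_domain_Q by auto
next
  fix p assume p: "p \<in> ?W"
  obtain \<Gamma> where \<Gamma>: "continuous_on UNIV \<Gamma>" "leaf Q N k p = \<Gamma> ` {- pi / 2<..<pi / 2}" "p \<in> leaf Q N k p"
    "integral_curve Q N k {- pi / 2<..<pi / 2} \<Gamma>" "\<And>x. \<Gamma> x \<in> Q \<and> sgn (\<Gamma> x $ i) = sgn (p$i)"
    "L2 (\<Gamma> (s * pi / 2)) = L3 (\<Gamma> (s * pi / 2))" "sgn (\<Gamma> (s * pi / 2) $ j) = s"
    using leaf[of p] p \<open>s \<in> signs\<close> unfolding arc_leaf_def by auto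
  have "limiting_endpoint Q N k (leaf Q N k p) (\<Gamma> (s * pi / 2))"
    unfolding \<Gamma>(2) by (rule limiting_endpoint_arc[OF \<Gamma>(4) k \<open>s \<in> signs\<close> \<Gamma>(1,6)])
  moreover have "\<Gamma> (s * pi / 2) \<in> ?P" using \<Gamma>(5-7) p by auto
  moreover have "leaf Q N k p \<in> leaves Q N k"
    unfolding leaves_def using k p foliation_domain_Q by auto
  ultimately show "p \<in> separatrix_surface Q N k ?P"
    unfolding separatrix_surface_def using \<Gamma>(3) by blast
qed

lemma L23_umbilic:
  assumes "p \<in> Q" "L2 p = L3 p"
  shows "L2 p = B" "L3 p = B"
  using L_bounds[OF assms(1)] assms(2) by auto

lemma separatrix_surface_2:
  assumes "s \<in> signs" "r \<in> signs"
  shows "separatrix_surface Q N 2 (range (pcurve s r)) = band1 r"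
proof -
  have "range (pcurve s r) = {p \<in> Q. L2 p = L3 p \<and> sgn (p$3) = r \<and> sgn (p$1) = s}"
    unfolding range_pcurve[OF assms] by blast
  then show ?thesis
    unfolding band1_eq[OF assms(2)] using assms
    by (simp only:) (intro separatrix_surface_arc continuous_on_L2 L23_umbilic leaf_curve2, auto)
qed

lemma separatrix_surface_3:
  assumes "s \<in> signs" "r \<in> signs"
  shows "separatrix_surface Q N 3 (range (pcurve s r)) = band3 s"
  unfolding band3_eq[OF assms(1)] range_pcurve[OF assms] using assms
  by (intro separatrix_surface_arc continuous_on_L3 L23_umbilic leaf_curve3) auto

text \<open>A leaf with \<open>f p \<noteq> B\<close> is a whole oval. Otherwise
  \<open>f = B\<close> on all of it, and the nonzero coordinate \<open>i\<close> provides the sign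
  that selects a band.\<close>

lemma leaves_compact_or_band:
  assumes k: "k \<in> {2, 3}" and S: "S \<in> leaves Q N k"
    and leaf: "\<And>p. p \<in> Q \<Longrightarrow> L2 p < L3 p \<Longrightarrow> arc_leaf k f i j p"
    and nz: "\<And>p. p \<in> Q \<Longrightarrow> L2 p < L3 p \<Longrightarrow> f p = B \<Longrightarrow> p$i \<noteq> 0"
  shows "compact S \<or> (\<forall>x\<in>S. x \<in> Q \<and> f x = B \<and> L2 x < L3 x \<and> sgn (x$i) \<in> signs)"
proof -
  obtain p where p: "p \<in> Q" "L2 p < L3 p" and S: "S = leaf Q N k p"
    using S k foliation_domain_Q by (auto simp: leaves_def)
  obtain \<Gamma> where \<Gamma>: "leaf Q N k p = \<Gamma> ` arc (f p = B)" "integral_curve Q N k (arc (f p = B)) \<Gamma>"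
    "compact (range \<Gamma>)" "\<And>x. \<Gamma> x \<in> Q \<and> f (\<Gamma> x) = f p \<and> sgn (\<Gamma> x $ i) = sgn (p$i)"
    using leaf[OF p] unfolding arc_leaf_def by blast
  show ?thesis
  proof (cases "f p = B")
    case False
    then show ?thesis using \<Gamma>(1,3) S by simp
  next
    case True
    have "x \<in> Q \<and> f x = B \<and> L2 x < L3 x \<and> sgn (x$i) \<in> signs" if x: "x \<in> S" for x
    proof -
      have "x \<in> foliation_domain Q N k" using \<Gamma>(2) x unfolding S \<Gamma>(1) integral_curve_def by auto
      then have "x \<in> Q" "L2 x < L3 x" using k foliation_domain_Q by auto
      moreover have "f x = B" using \<Gamma>(4) x True unfolding S \<Gamma>(1) by auto
      ultimately show ?thesis using nz[of x] by (auto simp: sgn_real_def)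
    qed
    then show ?thesis by blast
  qed
qed

lemma leaves_2_compact_or_band:
  assumes "S \<in> leaves Q N 2"
  shows "compact S \<or> S \<subseteq> band1 1 \<union> band1 (- 1)"
proof -
  have "p$3 \<noteq> 0" if p: "p \<in> Q" "L2 p < L3 p" "L2 p = B" for p
  proof -
    have "(p$3)^2 * ((A - C) * (B - C) * (C + E)) > 0"
      unfolding ell_coords(3)[OF ell_L[OF p(1)]] using L_bounds[OF p(1)] p ABCE
      by (auto intro!: mult_pos_pos)
    then show ?thesis by auto
  qed
  from leaves_compact_or_band[OF _ assms leaf_curve2 this] show ?thesis
    by (auto simp: band1_eq)
qed

lemma leaves_3_compact_or_band:
  assumes "S \<in> leaves Q N 3"
  shows "compact S \<or> S \<subseteq> band3 1 \<union> band3 (- 1)"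
proof -
  have "p$1 \<noteq> 0" if p: "p \<in> Q" "L2 p < L3 p" "L3 p = B" for p
  proof -
    have "(p$1)^2 * ((A - B) * (A - C) * (A + E)) > 0"
      unfolding ell_coords(1)[OF ell_L[OF p(1)]] using L_bounds[OF p(1)] p ABCE
      by (auto intro!: mult_pos_pos)
    then show ?thesis by auto
  qed
  from leaves_compact_or_band[OF _ assms leaf_curve3 this] show ?thesis
    by (auto simp: band3_eq)
qed

text \<open>With \<open>x = a * u\<close>, \<open>z = c * w\<close> and
  \<open>t^2 = E * (u^2 + w^2 - 1)\<close>, the displayed equation is
  \<open>x^2 = al1 + be1 * t^2\<close> in disguise. The fact \<open>eq\<close> is this
  equivalence.\<close>

lemma partially_umbilic_param:
  "partially_umbilic_set Q N \<inter> {p. p$4 \<ge> 0} =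
    {Q1_param a b c d u v w | u v w.
       (a^2 + d^2) / (a^2 - b^2) * u^2 - (c^2 + d^2) / (b^2 - c^2) * w^2 - 1 = 0 \<and>
       u^2 + w^2 \<ge> 1 \<and> v = 0}" (is "?L = ?R")
proof -
  have eq: "(A + E) / (A - B) * u^2 - (C + E) / (B - C) * w^2 - 1 = 0 \<longleftrightarrow>
      A * u^2 = al1 + be1 * (E * (u^2 + w^2 - 1))" for u w
  proof -
    have "(A + E) / (A - B) * u^2 - (C + E) / (B - C) * w^2 - 1 = 0 \<longleftrightarrow>
      (B - C) * (A + E) * u^2 = (A - B) * (B - C) + (A - B) * (C + E) * w^2"
      using ABCE by (simp add: divide_simps) (auto simp: algebra_simps)
    also have "\<dots> \<longleftrightarrow> u^2 * ((A - C) * (B + E)) = (A - B) * ((B + E) + (C + E) * (u^2 + w^2 - 1))"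
      by (auto simp: algebra_simps)
    also have "\<dots> \<longleftrightarrow> A * u^2 = al1 + be1 * (E * (u^2 + w^2 - 1))"
    proof -
      let ?V = "(A - B) * ((B + E) + (C + E) * (u^2 + w^2 - 1))" and ?W = "al1 + be1 * (E * (u^2 + w^2 - 1))"
      let ?k = "(A - C) * (B + E)"
      have nz: "?k \<noteq> 0" "A \<noteq> 0" using ABCE by auto
      have "?W * ?k = A * ?V"
        using ABCE unfolding al1_def be1_def by (simp add: divide_simps) (simp add: algebra_simps)
      then have "A * u^2 = ?W \<longleftrightarrow> A * (u^2 * ?k) = A * ?V"
        using mult_right_cancel[OF nz(1), of "A * u^2" ?W] by (simp only: mult.assoc)
      then show ?thesis by (simp only: mult_left_cancel[OF nz(2)])
    qed
    finally show ?thesis .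
  qed
  have pos: "a > 0" "b > 0" "c > 0" "d > 0" using ab bc c_pos d_pos by auto
  show ?thesis
  proof (intro equalityI subsetI)
    fix p assume "p \<in> ?L"
    then have p: "p \<in> Q" "L2 p = L3 p" "p$4 \<ge> 0" by (auto simp: partially_umbilic_set_Q)
    have y: "p$2 = 0" using y_zero_iff[OF p(1)] L_bounds[OF p(1)] p(2) by auto
    define u w where "u = p$1 / a" and "w = p$3 / c"
    have x: "p$1 = a * u" "p$3 = c * w" using pos by (simp_all add: u_def w_def)
    have t: "(p$4)^2 = E * (u^2 + w^2 - 1)"
      using p(1) y ABCE pos unfolding Q_iff_coords x by (simp add: A_def C_def power_mult_distrib field_simps)
    have "A * u^2 = al1 + be1 * (E * (u^2 + w^2 - 1))"
      using plane_iff(3)[OF p(1) y] p(2) unfolding x t by (simp add: A_def power_mult_distrib)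
    then have "(a^2 + d^2) / (a^2 - b^2) * u^2 - (c^2 + d^2) / (b^2 - c^2) * w^2 - 1 = 0"
      using eq[of u w] unfolding A_def B_def C_def E_def by blast
    moreover have nn: "u^2 + w^2 \<ge> 1"
    proof -
      have "E * (u^2 + w^2 - 1) \<ge> 0" unfolding t[symmetric] by simp
      then show ?thesis using ABCE by (simp add: zero_le_mult_iff)
    qed
    moreover have "p$4 = d * sqrt (u^2 + 0^2 + w^2 - 1)"
    proof -
      have "(p$4)^2 = (d * sqrt (u^2 + 0^2 + w^2 - 1))^2"
        unfolding t using nn by (simp add: power_mult_distrib E_def)
      then show ?thesis
        by (rule power2_eq_imp_eq[OF _ p(3)]) (intro mult_nonneg_nonneg less_imp_le[OF pos(4)], use nn in simp)
    qed
    then have "p = Q1_param a b c d u 0 w"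
      unfolding Q1_param_def vec_eq_iff forall_4 vector_4 using x y by simp
    ultimately show "p \<in> ?R" by blast
  next
    fix p assume "p \<in> ?R"
    then obtain u w where uw: "(a^2 + d^2) / (a^2 - b^2) * u^2 - (c^2 + d^2) / (b^2 - c^2) * w^2 - 1 = 0"
      and nn: "u^2 + w^2 \<ge> 1" and p: "p = Q1_param a b c d u 0 w" by blast
    have c: "p$1 = a * u" "p$2 = 0" "p$3 = c * w" "p$4 = d * sqrt (u^2 + w^2 - 1)"
      by (simp_all add: p Q1_param_def)
    have t: "(p$4)^2 = E * (u^2 + w^2 - 1)"
      unfolding c using nn by (simp add: power_mult_distrib E_def)
    have Q: "p \<in> Q"
      unfolding Q_iff_coords t using ABCE pos unfolding c by (simp add: A_def C_def power_mult_distrib)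
    have "A * u^2 = al1 + be1 * (E * (u^2 + w^2 - 1))"
      using eq[of u w] uw unfolding A_def B_def C_def E_def by blast
    then have "(p$1)^2 = al1 + be1 * (p$4)^2"
      unfolding t c(1) by (simp add: A_def power_mult_distrib)
    then have "L2 p = L3 p" using plane_iff(3)[OF Q c(2)] by blast
    moreover have "p$4 \<ge> 0" unfolding c using pos nn by simp
    ultimately show "p \<in> ?L"
      using Q by (simp add: partially_umbilic_set_Q)
  qed
qed

end

section \<open>The Darbouxian type\<close>

text \<open>The root \<open>h\<close> of \<open>c h\<^sup>2 - 2 b h + w = 0\<close> that vanishes with \<open>w\<close>, in a form that covers \<open>c = 0\<close> as well.\<close>

definition small_root :: "real \<Rightarrow> real \<Rightarrow> real \<Rightarrow> real" where
  "small_root c b w = w / (b + sqrt (b^2 - c * w))"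

lemma small_root:
  assumes "b > 0" "b^2 - c * w > 0"
  shows "b - c * small_root c b w = sqrt (b^2 - c * w)"
    and "c * (small_root c b w)^2 - 2 * b * small_root c b w + w = 0"
proof -
  define r where "r = sqrt (b^2 - c * w)"
  have r: "r > 0" "r * r = b^2 - c * w" using assms by (auto simp: r_def)
  define h where "h = small_root c b w"
  have h: "h * (b + r) = w" using assms(1) r(1) by (simp add: h_def small_root_def r_def[symmetric])
  have "(c * h - (b - r)) * (b + r) = c * (h * (b + r)) - (b^2 - r * r)"
    by (simp add: algebra_simps power2_eq_square)
  also have "\<dots> = 0" unfolding h r(2) by simp
  finally have ch: "c * h = b - r" using assms(1) r(1) by simp
  then show "b - c * small_root c b w = sqrt (b^2 - c * w)" by (simp add: h_def r_def)
  have "c * h^2 - 2 * b * h + w = h * (c * h) - 2 * b * h + h * (b + r)"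
    unfolding h by (simp add: power2_eq_square)
  also have "\<dots> = 0" unfolding ch by (simp add: algebra_simps)
  finally show "c * (small_root c b w)^2 - 2 * b * small_root c b w + w = 0" by (simp add: h_def)
qed

text \<open>A quarter of the discriminant is \<open>(b - c * h)^2\<close>, and the sign condition
  selects the square root used in \<open>small_root\<close>.\<close>

lemma small_root_unique:
  assumes "b > 0" "c * h^2 - 2 * b * h + w = 0" "b - c * h > 0"
  shows "h = small_root c b w"
proof -
  have "(b - c * h)^2 = b^2 - c * w"
  proof -
    have "(b - c * h)^2 - (b^2 - c * w) = c * (c * h^2 - 2 * b * h + w)"
      by (simp add: algebra_simps power2_eq_square)
    then show ?thesis using assms(2) by simp
  qed
  then have r: "sqrt (b^2 - c * w) = b - c * h" using assms(3) by (metis abs_of_pos real_sqrt_abs)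
  have "h * (b + (b - c * h)) = w - (c * h^2 - 2 * b * h + w)" by (simp add: algebra_simps power2_eq_square)
  then have "h * (b + (b - c * h)) = w" using assms(2) by simp
  then show ?thesis unfolding small_root_def r using assms(1,3) by (simp add: eq_divide_eq)
qed

lemma has_derivative_zero_on_open:
  fixes F :: "real \<Rightarrow> real"
  assumes "open S" "s \<in> S" "\<And>s. s \<in> S \<Longrightarrow> F s = 0" "(F has_real_derivative D) (at s)"
  shows "D = 0"
proof -
  have "(F has_real_derivative 0) (at s)"
    by (rule has_field_derivative_transform_within_open[of "\<lambda>s. 0" _ _ S]) (use assms in auto)
  then show ?thesis using DERIV_unique assms(4) by blast
qed

text \<open>Implicit differentiation of \<open>c * f^2 - 2 * (n - m * s) * f + K * s^2 = 0\<close>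
  gives \<open>r * f' = K * s + m * f\<close> with \<open>r = n - m * s - c * f\<close>. As
  \<open>f\<close> and \<open>f'\<close> vanish at 0, \<open>c\<close> drops out of the third
  derivative there.\<close>

lemma third_derivative_small_root:
  fixes n m c K :: real
  assumes "n > 0"
  shows "(deriv ^^ 3) (\<lambda>s. small_root c (n - m * s) (K * s^2)) 0 = 3 * m * K / n^2"
proof -
  define S where "S = {s. n - m * s > 0} \<inter> {s. (n - m * s)^2 - c * (K * s^2) > 0}"
  define f where "f s = small_root c (n - m * s) (K * s^2)" for s
  define r where "r s = n - m * s - c * f s" for s
  define d1 where "d1 s = (K * s + m * f s) / r s" for s
  define d2 where "d2 s = (K + 2 * m * d1 s + c * (d1 s)^2) / r s" for s
  have S: "open S" "0 \<in> S"
    using assms unfolding S_def by (auto intro!: open_Int open_Collect_less continuous_intros)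
  have r: "r s > 0" if "s \<in> S" for s
    using small_root(1)[of "n - m * s" c "K * s^2"] that by (simp add: S_def r_def f_def)
  have f_eq: "c * (f s)^2 - 2 * (n - m * s) * f s + K * s^2 = 0" if "s \<in> S" for s
    using small_root(2)[of "n - m * s" c "K * s^2"] that by (simp add: S_def f_def)
  have f1: "(f has_real_derivative d1 s) (at s)" if s: "s \<in> S" for s
  proof -
    have pos: "n - m * s > 0" "(n - m * s)^2 - c * (K * s^2) > 0" using s by (auto simp: S_def)
    have ne: "n - m * s + sqrt ((n - m * s)^2 - c * (K * s^2)) \<noteq> 0"
      using pos add_pos_pos[OF pos(1), of "sqrt ((n - m * s)^2 - c * (K * s^2))"] by simp
    \<comment> \<open>The closed formula serves to show that \<open>f\<close> is differentiable; the
      value of the derivative comes from the quadratic equation.\<close>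
    have "\<exists>D. (f has_real_derivative D) (at s)"
    proof -
      show ?thesis
        unfolding f_def small_root_def using pos ne
        by (intro exI) (auto intro!: derivative_eq_intros)
    qed
    then obtain D where D: "(f has_real_derivative D) (at s)" by blast
    have "((\<lambda>s. c * (f s)^2 - 2 * (n - m * s) * f s + K * s^2) has_real_derivative
        2 * (K * s + m * f s - r s * D)) (at s)"
      by (auto intro!: derivative_eq_intros D simp: r_def algebra_simps)
    from has_derivative_zero_on_open[OF S(1) s f_eq this]
    have "D = d1 s" using r[OF s] by (simp add: d1_def field_simps)
    then show ?thesis using D by simp
  qed
  have dr: "(r has_real_derivative - m - c * d1 s) (at s)" if "s \<in> S" for s
    unfolding r_def by (auto intro!: derivative_eq_intros f1[OF that])
  have d1': "(d1 has_real_derivative d2 s) (at s)" if s: "s \<in> S" for s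
  proof -
    have "((\<lambda>s. K * s + m * f s) has_real_derivative K + m * d1 s) (at s)"
      by (auto intro!: derivative_eq_intros f1[OF s])
    from DERIV_divide[OF this dr[OF s]]
    have "(d1 has_real_derivative ((K + m * d1 s) * r s - (K * s + m * f s) * (- m - c * d1 s)) / (r s * r s)) (at s)"
      using r[OF s] by (simp add: d1_def[abs_def])
    moreover have "((K + m * d1 s) * r s - (K * s + m * f s) * (- m - c * d1 s)) / (r s * r s) = d2 s"
    proof -
      have "K * s + m * f s = d1 s * r s" using r[OF s] by (simp add: d1_def)
      then have "(K + m * d1 s) * r s - (K * s + m * f s) * (- m - c * d1 s) = (K + 2 * m * d1 s + c * (d1 s)^2) * r s"
        by (simp add: algebra_simps power2_eq_square)
      then show ?thesis using r[OF s] by (simp add: d2_def)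
    qed
    ultimately show ?thesis by simp
  qed
  have zero: "f 0 = 0" "r 0 = n" "d1 0 = 0" "d2 0 = K / n"
    by (simp_all add: f_def small_root_def r_def d1_def d2_def)
  have d2': "(d2 has_real_derivative 3 * m * K / n^2) (at 0)"
  proof -
    have "((\<lambda>s. K + 2 * m * d1 s + c * (d1 s)^2) has_real_derivative 2 * m * d2 0 + c * (2 * d1 0 * d2 0)) (at 0)"
      by (auto intro!: derivative_eq_intros d1'[OF S(2)])
    from DERIV_divide[OF this dr[OF S(2)]]
    have "(d2 has_real_derivative ((2 * m * (K / n)) * n - K * (- m)) / (n * n)) (at 0)"
      using assms by (simp add: d2_def[abs_def] zero)
    moreover have "((2 * m * (K / n)) * n - K * (- m)) / (n * n) = 3 * m * K / n^2"
      using assms by (simp add: power2_eq_square)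
    ultimately show ?thesis by simp
  qed
  have 1: "deriv f s = d1 s" if "s \<in> S" for s using f1[OF that] by (rule DERIV_imp_deriv)
  have 2: "deriv (deriv f) s = d2 s" if "s \<in> S" for s
  proof (rule DERIV_imp_deriv)
    show "(deriv f has_real_derivative d2 s) (at s)"
      by (rule has_field_derivative_transform_within_open[OF d1'[OF that] S(1) that]) (simp add: 1)
  qed
  have "deriv (deriv (deriv f)) 0 = 3 * m * K / n^2"
  proof (rule DERIV_imp_deriv)
    show "(deriv (deriv f) has_real_derivative 3 * m * K / n^2) (at 0)"
      by (rule has_field_derivative_transform_within_open[OF d2' S]) (simp add: 2)
  qed
  then show ?thesis by (simp add: f_def[abs_def] numeral_3_eq_3)
qed

lemma orthonormal_expansion:
  assumes "v \<in> span {e1, e2, e3}" "norm e1 = 1" "norm e2 = 1" "norm e3 = 1"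
    "e1 \<bullet> e2 = 0" "e1 \<bullet> e3 = 0" "e2 \<bullet> e3 = 0"
  shows "v = (v \<bullet> e1) *\<^sub>R e1 + (v \<bullet> e2) *\<^sub>R e2 + (v \<bullet> e3) *\<^sub>R e3"
proof -
  obtain c1 c2 c3 where "v - c1 *\<^sub>R e1 - c2 *\<^sub>R e2 - c3 *\<^sub>R e3 = 0"
    using assms(1) by (auto simp: span_insert)
  then have v: "v = c1 *\<^sub>R e1 + c2 *\<^sub>R e2 + c3 *\<^sub>R e3" by (simp add: algebra_simps)
  have "e1 \<bullet> e1 = 1" "e2 \<bullet> e2 = 1" "e3 \<bullet> e3 = 1" using assms(2-4) by (simp_all add: dot_square_norm)
  moreover have "e2 \<bullet> e1 = 0" "e3 \<bullet> e1 = 0" "e3 \<bullet> e2 = 0"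
    using assms(5-7) by (simp_all add: inner_commute)
  ultimately show ?thesis
    using assms(5-7) by (simp add: v inner_add_left)
qed

context quadric
begin

lemma eigdir_scaleR: "eigdir p l v \<Longrightarrow> eigdir p l (k *\<^sub>R v)"
  unfolding eigdir_def by (metis inner_scaleR_left mult.assoc mult_zero_right vector_scaleR_component real_scaleR_def)

text \<open>The numbers \<open>e1 \<bullet> lam (N p)\<close> and
  \<open>e2 \<bullet> lam (N p)\<close> govern the cubic jet. The second vanishes because
  \<open>e2\<close> is the \<open>y\<close>-axis and \<open>p$2 = 0\<close>; the first has to be
  nonzero for the jet not to vanish.\<close>

lemma pu_frame:
  assumes p: "p \<in> Q" and BB: "L2 p = L3 p"
  obtains e1 e2 e3 where "norm e1 = 1" "norm e2 = 1" "norm e3 = 1"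
    "e1 \<bullet> e2 = 0" "e1 \<bullet> e3 = 0" "e2 \<bullet> e3 = 0" "span {e1, e2, e3} = tangent_space N p"
    "eigdir p B e1" "eigdir p B e2" "eigdir p (L1 p) e3"
    "eigenspace Q N p (1 / (B * norm (lam p))) = span {e1, e2}"
    "e1 \<bullet> lam (N p) \<noteq> 0" "e2 \<bullet> lam (N p) = 0"
proof -
  note b = L_bounds[OF p]
  let ?n = "norm (lam p)"
  have n: "?n > 0" using lam_nonzero[OF p] by simp
  have e: "ell p (L1 p) B B" using ell_L[OF p] BB b by (metis order_antisym)
  have y: "p$2 = 0" by (rule ell_BB_y[OF e])
  obtain v where v: "v \<noteq> 0" "eigdir p (L1 p) v"
    using eigdir_of_root[OF p] pel_L[OF p, of "L1 p"] by auto
  let ?w = "pu_dir p"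
  have w: "?w \<noteq> 0" "eigdir p B ?w" using eigdir_pu_dir[OF e] by auto
  define e1 e2 e3 where "e1 = inverse (norm ?w) *\<^sub>R ?w" and "e2 = (axis 2 1 :: real^4)" and "e3 = inverse (norm v) *\<^sub>R v"
  have nrm: "norm e1 = 1" "norm e2 = 1" "norm e3 = 1"
    using w v by (simp_all add: e1_def e2_def e3_def)
  have eig: "eigdir p B e1" "eigdir p B e2" "eigdir p (L1 p) e3"
    unfolding e1_def e2_def e3_def using w v eigdir_scaleR eigdir_axis_2[OF y] by auto
  have l: "B \<noteq> 0" "L1 p \<noteq> 0" "B \<noteq> L1 p" using b ABCE by auto
  have orth: "e1 \<bullet> e2 = 0" "e1 \<bullet> e3 = 0" "e2 \<bullet> e3 = 0"
    using eigdir_orthogonal[OF p eig(1,3) l] eigdir_orthogonal[OF p eig(2,3) l]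
    by (simp_all add: e1_def e2_def inner_axis pu_dir_def)
  have tan: "e1 \<bullet> lam p = 0" "e2 \<bullet> lam p = 0" "e3 \<bullet> lam p = 0"
    using eig by (auto simp: eigdir_def)
  have nz: "lam p \<noteq> 0" "e1 \<noteq> 0" "e2 \<noteq> 0" "e3 \<noteq> 0" using n nrm by auto
  have span: "span {e1, e2, e3} = tangent_space N p"
    using orthogonal_basis_hyperplane(5)[OF nz(1) tan nz(2-4) orth] tangent_iff[OF p] by auto
  have es: "eigenspace Q N p (1 / (B * ?n)) = span {e1, e2}"
  proof
    show "eigenspace Q N p (1 / (B * ?n)) \<subseteq> span {e1, e2}"
    proof
      fix x assume "x \<in> eigenspace Q N p (1 / (B * ?n))"
      then have x: "eigdir p B x" using eigenspace_eq[OF p l(1)] by auto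
      then have "x \<in> span {e1, e2, e3}" unfolding span tangent_iff[OF p] by (simp add: eigdir_def)
      from orthonormal_expansion[OF this nrm orth] eigdir_orthogonal[OF p x eig(3) l]
      have "x = (x \<bullet> e1) *\<^sub>R e1 + (x \<bullet> e2) *\<^sub>R e2" by simp
      moreover have "(x \<bullet> e1) *\<^sub>R e1 + (x \<bullet> e2) *\<^sub>R e2 \<in> span {e1, e2}"
        by (intro span_add span_scale span_base) auto
      ultimately show "x \<in> span {e1, e2}" by simp
    qed
    have "eigenspace Q N p (1 / (B * ?n)) = {x. x \<bullet> lam p = 0 \<and> shp p x = (1 / (B * ?n)) *\<^sub>R x}"
      using shp_eigen_iff[OF p l(1)] eigenspace_eq[OF p l(1)] by (auto simp: eigdir_def)
    then have "subspace (eigenspace Q N p (1 / (B * ?n)))"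
      using linear_shp[of p] by (auto simp: subspace_def linear_add linear_scale linear_0 inner_add_left scaleR_add_right)
    moreover have "{e1, e2} \<subseteq> eigenspace Q N p (1 / (B * ?n))"
      using eig eigenspace_eq[OF p l(1)] by auto
    ultimately show "span {e1, e2} \<subseteq> eigenspace Q N p (1 / (B * ?n))" by (rule span_minimal[rotated])
  qed
  have "e1 \<bullet> lam (N p) \<noteq> 0"
  proof -
    \<comment> \<open>In each term \<open>1 / ax$i - 1 / B\<close> equals
      \<open>(B - ax$i) / (B * ax$i)\<close>, which cancels the denominator in
      \<open>pu_dir\<close>.\<close>
    have lw: "?w \<bullet> lam (lam p) = (1 / B) * (?w \<bullet> lam p + ?n^2)"
    proof -
      have "?w \<bullet> lam (lam p) - (1 / B) * (?w \<bullet> lam p) = (1 / B) * (lam p \<bullet> lam p)"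
      proof -
        have i: "p$i / (B - ax$i) * (p$i / ax$i / ax$i) - (1 / B) * (p$i / (B - ax$i) * (p$i / ax$i)) =
            (1 / B) * (p$i / ax$i * (p$i / ax$i))" if "B - ax$i \<noteq> 0" for i
          using ax_nz[of i] l(1) that by (simp add: divide_simps) (simp add: algebra_simps)
        then show ?thesis
          using i[of 1] i[of 3] i[of 4] y ABCE
          by (simp add: inner_vec_4 pu_dir_def right_diff_distrib distrib_left)
      qed
      then show ?thesis by (simp add: dot_square_norm distrib_left)
    qed
    have "?w \<bullet> lam p = 0" using w by (simp add: eigdir_def)
    then have "?w \<bullet> lam (lam p) \<noteq> 0" using lw n l(1) by simp
    moreover have "lam (N p) = - (inverse ?n *\<^sub>R lam (lam p))"
      by (simp add: N_eq linear_neg[OF linear_lam] linear_scale[OF linear_lam])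
    ultimately show ?thesis using n w(1) by (simp add: e1_def)
  qed
  moreover have "e2 \<bullet> lam (N p) = 0" using y by (simp add: e2_def inner_axis' N_eq)
  ultimately show thesis using that[OF nrm orth span eig es] by blast
qed

text \<open>In the frame and with height \<open>k\<close> over the tangent space, the quadric is
  \<open>c * k^2 - 2 * bf x * k + wf x = 0\<close> with \<open>bf\<close> affine and
  \<open>wf\<close> quadratic, so the graph function is \<open>small_root\<close>. Its cubic part is
  created by the linear part of \<open>bf\<close>, which does not involve the second
  coordinate.\<close>

lemma type_D1_point_Q:
  assumes p: "p \<in> Q" and BB: "L2 p = L3 p"
  shows "type_D1_point Q N p"
proof -
  let ?n = "norm (lam p)"
  have n: "?n > 0" using lam_nonzero[OF p] by simp
  obtain e1 e2 e3 where nrm: "norm e1 = 1" "norm e2 = 1" "norm e3 = 1"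
    and orth: "e1 \<bullet> e2 = 0" "e1 \<bullet> e3 = 0" "e2 \<bullet> e3 = 0" and span: "span {e1, e2, e3} = tangent_space N p"
    and eig: "eigdir p B e1" "eigdir p B e2" "eigdir p (L1 p) e3"
    and es: "eigenspace Q N p (1 / (B * ?n)) = span {e1, e2}"
    and \<beta>1: "e1 \<bullet> lam (N p) \<noteq> 0" and \<beta>2: "e2 \<bullet> lam (N p) = 0"
    by (rule pu_frame[OF assms]) blast
  define \<beta>1 \<beta>3 c where "\<beta>1 = e1 \<bullet> lam (N p)" and "\<beta>3 = e3 \<bullet> lam (N p)" and "c = N p \<bullet> lam (N p)"
  have l: "B \<noteq> 0" "L1 p \<noteq> 0" using L_bounds[OF p] ABCE by auto
  have tan: "e1 \<bullet> lam p = 0" "e2 \<bullet> lam p = 0" "e3 \<bullet> lam p = 0" using eig by (auto simp: eigdir_def)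
  have sq: "e1 \<bullet> e1 = 1" "e2 \<bullet> e2 = 1" "e3 \<bullet> e3 = 1" using nrm by (simp_all add: dot_square_norm)
  have q: "e1 \<bullet> lam e1 = 1 / B" "e2 \<bullet> lam e1 = 0" "e3 \<bullet> lam e1 = 0"
    "e1 \<bullet> lam e2 = 0" "e2 \<bullet> lam e2 = 1 / B" "e3 \<bullet> lam e2 = 0"
    "e1 \<bullet> lam e3 = 0" "e2 \<bullet> lam e3 = 0" "e3 \<bullet> lam e3 = 1 / L1 p"
    using eigdir_lam[OF eig(1) l(1)] eigdir_lam[OF eig(2) l(1)] eigdir_lam[OF eig(3) l(2)] tan sq orth
    by (simp_all add: inner_commute)
  have Nt: "N p \<bullet> e1 = 0" "N p \<bullet> e2 = 0" "N p \<bullet> e3 = 0" "N p \<bullet> N p = 1" "p \<bullet> lam (N p) = - ?n" "N p \<bullet> lam p = - ?n"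
  proof -
    show "N p \<bullet> e1 = 0" "N p \<bullet> e2 = 0" "N p \<bullet> e3 = 0" using tan by (simp_all add: N_eq inner_commute)
    show "N p \<bullet> N p = 1" "N p \<bullet> lam p = - ?n" using n by (simp_all add: N_eq dot_square_norm power2_eq_square)
    then show "p \<bullet> lam (N p) = - ?n" by (simp add: inner_lam_commute)
  qed
  have orth': "e2 \<bullet> e1 = 0" "e3 \<bullet> e1 = 0" "e3 \<bullet> e2 = 0" "e1 \<bullet> N p = 0" "e2 \<bullet> N p = 0" "e3 \<bullet> N p = 0"
    using orth Nt by (simp_all add: inner_commute)
  \<comment> \<open>By \<open>eigdir_lam\<close> the quadratic form is diagonal in the frame, with
    entries \<open>1 / B\<close>, \<open>1 / B\<close> and \<open>1 / L1 p\<close>.\<close>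
  define wf where "wf x = ((fst x)^2 + (fst (snd x))^2) * (1 / B) + (snd (snd x))^2 * (1 / L1 p)" for x :: "real \<times> real \<times> real"
  define bf where "bf x = ?n - \<beta>1 * fst x - \<beta>3 * snd (snd x)" for x :: "real \<times> real \<times> real"
  define V where "V = {x. bf x > 0} \<inter> {x. (bf x)^2 - c * wf x > 0}"
  define h where "h x = small_root c (bf x) (wf x)" for x
  define pos where "pos x k = p + fst x *\<^sub>R e1 + fst (snd x) *\<^sub>R e2 + snd (snd x) *\<^sub>R e3 + k *\<^sub>R N p" for x :: "real \<times> real \<times> real" and k
  define xc where "xc y = ((y - p) \<bullet> e1, (y - p) \<bullet> e2, (y - p) \<bullet> e3)" for y
  define hc where "hc y = (y - p) \<bullet> N p" for y
  \<comment> \<open>The last condition excludes the second sheet of the quadric over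
    \<open>V\<close>, so that \<open>small_root_unique\<close> applies.\<close>
  define U where "U = {y. bf (xc y) > 0} \<inter> {y. (bf (xc y))^2 - c * wf (xc y) > 0} \<inter> {y. bf (xc y) - c * hc y > 0}"
  have coords: "xc (pos x k) = x" "hc (pos x k) = k" for x k
    using sq orth orth' Nt by (simp_all add: xc_def hc_def pos_def inner_add_left prod_eq_iff)
  have pos_coords: "pos (xc y) (hc y) = y" for y
  proof -
    let ?u = "y - p - hc y *\<^sub>R N p"
    have "?u \<bullet> N p = 0" using Nt(4) by (simp add: hc_def inner_diff_left)
    then have "?u \<in> span {e1, e2, e3}" unfolding span by (simp add: tangent_space_def)
    from orthonormal_expansion[OF this nrm orth]
    have "?u = fst (xc y) *\<^sub>R e1 + fst (snd (xc y)) *\<^sub>R e2 + snd (snd (xc y)) *\<^sub>R e3"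
      using Nt by (simp add: xc_def inner_diff_left)
    then show ?thesis by (simp add: pos_def algebra_simps)
  qed
  have pos_Q: "pos x k \<in> Q \<longleftrightarrow> c * k^2 - 2 * bf x * k + wf x = 0" for x k
  proof -
    obtain x1 x2 x3 where x: "x = (x1, x2, x3)" by (cases x) auto
    have t': "p \<bullet> lam e1 = 0" "p \<bullet> lam e2 = 0" "p \<bullet> lam e3 = 0"
      "N p \<bullet> lam e1 = \<beta>1" "N p \<bullet> lam e2 = 0" "N p \<bullet> lam e3 = \<beta>3"
      using tan \<beta>2 by (simp_all add: inner_lam_commute[of p] inner_lam_commute[of "N p"] \<beta>1_def \<beta>3_def)
    have "pos x k \<bullet> lam (pos x k) = 1 + (c * k^2 - 2 * bf x * k + wf x)"
      using p \<beta>2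
      by (simp add: x pos_def linear_add[OF linear_lam] linear_scale[OF linear_lam] inner_add_left inner_add_right
          q t' tan Nt Q_iff \<beta>1_def[symmetric] \<beta>3_def[symmetric] c_def[symmetric] wf_def bf_def
          algebra_simps power2_eq_square)
    then show ?thesis by (simp add: Q_iff)
  qed
  have graph: "Q \<inter> U = {pos x (h x) | x. x \<in> V}"
  proof (intro equalityI subsetI)
    fix y assume y: "y \<in> Q \<inter> U"
    then have "c * (hc y)^2 - 2 * bf (xc y) * hc y + wf (xc y) = 0"
      using pos_Q[of "xc y" "hc y"] by (simp add: pos_coords)
    then have "hc y = h (xc y)"
      unfolding h_def using y by (intro small_root_unique) (auto simp: U_def)
    moreover have "xc y \<in> V" using y by (auto simp: U_def V_def)
    ultimately show "y \<in> {pos x (h x) | x. x \<in> V}" using pos_coords[of y] by (metis (mono_tags, lifting) mem_Collect_eq)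
  next
    fix y assume "y \<in> {pos x (h x) | x. x \<in> V}"
    then obtain x where x: "x \<in> V" "y = pos x (h x)" by blast
    then have b: "bf x > 0" "(bf x)^2 - c * wf x > 0" by (auto simp: V_def)
    have "y \<in> Q" unfolding x(2) pos_Q h_def by (rule small_root(2)[OF b])
    moreover have "bf x - c * h x > 0" unfolding h_def small_root(1)[OF b] using b by simp
    ultimately show "y \<in> Q \<inter> U" using b by (simp add: U_def x(2) coords)
  qed
  have cont: "continuous_on UNIV (\<lambda>y. bf (xc y))" "continuous_on UNIV (\<lambda>y. wf (xc y))" "continuous_on UNIV hc"
    unfolding bf_def wf_def xc_def hc_def using l by (auto intro!: continuous_intros)
  have "open U"
    unfolding U_def by (intro open_Int open_Collect_less continuous_intros cont)
  have oV: "open V"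
  proof -
    have "continuous_on UNIV bf" "continuous_on UNIV wf"
      unfolding bf_def[abs_def] wf_def[abs_def] using l by (auto intro!: continuous_intros)
    then show ?thesis unfolding V_def by (intro open_Int open_Collect_less continuous_intros)
  qed
  have xc0: "xc p = 0" "hc p = 0" by (simp_all add: xc_def hc_def zero_prod_def)
  have b0: "bf 0 = ?n" "wf 0 = 0" by (simp_all add: bf_def wf_def)
  have "p \<in> U" "0 \<in> V" using n by (simp_all add: U_def V_def xc0 b0)
  have smooth: "smooth_on h V"
  proof -
    have proj: "smooth_on (\<lambda>x. fst x) V" "smooth_on (\<lambda>x. fst (snd x)) V" "smooth_on (\<lambda>x. snd (snd x)) V"
      by (intro smooth_on_linear oV bounded_linear_fst bounded_linear_fst_comp bounded_linear_snd_comp bounded_linear_snd)+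
    have sb: "smooth_on bf V" and sw: "smooth_on wf V"
      unfolding bf_def[abs_def] wf_def[abs_def]
      by (intro smooth_on_add smooth_on_diff smooth_on_mult smooth_on_power smooth_on_const proj oV;
          simp add: l)+
    show ?thesis
      unfolding h_def[abs_def] small_root_def
    proof (intro smooth_on_divide smooth_on_add smooth_on_sqrt smooth_on_diff smooth_on_mult smooth_on_power sb sw smooth_on_const oV)
      fix x assume "x \<in> V"
      then have "bf x > 0" "(bf x)^2 - c * wf x > 0" by (auto simp: V_def)
      then show "(bf x)^2 - c * wf x > 0" "bf x + sqrt ((bf x)^2 - c * wf x) \<noteq> 0"
        using add_pos_pos[of "bf x" "sqrt ((bf x)^2 - c * wf x)"] by auto
    qed
  qed
  \<comment> \<open>On the ray through \<open>(x1, x2, 0)\<close> the data of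
    \<open>third_derivative_small_root\<close> are \<open>m = \<beta>1 * x1\<close> and
    \<open>K = (x1^2 + x2^2) / B\<close>.\<close>
  have jet: "(deriv ^^ 3) (\<lambda>s. h (s * x1, s * x2, 0)) 0 / fact 3 =
      1 / 6 * (3 * (\<beta>1 / (B * ?n^2)) * x1^3 + 3 * (\<beta>1 / (B * ?n^2)) * x1 * x2^2 + 0 * x2^3)" for x1 x2
  proof -
    have "(\<lambda>s. h (s * x1, s * x2, 0)) = (\<lambda>s. small_root c (?n - (\<beta>1 * x1) * s) (((x1^2 + x2^2) / B) * s^2))"
      by (simp add: h_def bf_def wf_def power_mult_distrib algebra_simps add_divide_distrib)
    then have "(deriv ^^ 3) (\<lambda>s. h (s * x1, s * x2, 0)) 0 = 3 * (\<beta>1 * x1) * ((x1^2 + x2^2) / B) / ?n^2"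
      using third_derivative_small_root[OF n, of c "\<beta>1 * x1" "(x1^2 + x2^2) / B"] by simp
    moreover have "fact 3 = (6::real)" by (simp add: fact_numeral)
    ultimately show ?thesis
      using l(1) n by (simp add: field_simps power2_eq_square power3_eq_cube)
  qed
  \<comment> \<open>The coefficients of the jet are \<open>3 * k\<close>, \<open>k\<close> and 0, so
    the Darbouxian inequality reads 3 > 2.\<close>
  define k where "k = \<beta>1 / (B * ?n^2)"
  have k: "k \<noteq> 0" using \<beta>1 l(1) n by (simp add: k_def \<beta>1_def)
  have "p \<in> partially_umbilic_set Q N" using p BB by (simp add: partially_umbilic_set_Q)
  moreover have "\<exists>\<kappa>. eigenspace Q N p \<kappa> = span {e1, e2}" using es by blast
  moreover have "Q \<inter> U = {p + x1 *\<^sub>R e1 + x2 *\<^sub>R e2 + x3 *\<^sub>R e3 + h (x1, x2, x3) *\<^sub>R N p | x1 x2 x3.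
                   (x1, x2, x3) \<in> V}"
    unfolding graph by (auto simp: pos_def)
  moreover have "k * (k - 3 * k) \<noteq> 0" "3 * k / k > (0 / (2 * k))^2 + 2" using k by auto
  moreover have "\<forall>x1 x2. (deriv ^^ 3) (\<lambda>s. h (s * x1, s * x2, 0)) 0 / fact 3 =
      1 / 6 * (3 * k * x1^3 + 3 * k * x1 * x2^2 + 0 * x2^3)"
    using jet by (simp add: k_def)
  ultimately show ?thesis
    unfolding type_D1_point_def
    using nrm orth span \<open>open U\<close> \<open>p \<in> U\<close> \<open>0 \<in> V\<close> smooth by blast
qed

lemma type_D1_curve_pcurve:
  assumes "s \<in> signs" "r \<in> signs"
  shows "type_D1_curve Q N (range (pcurve s r))"
  unfolding type_D1_curve_def
  using regular_curve_pcurve type_D1_point_Q pcurve_umbilic[OF assms] by auto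

lemma range_pcurve_eq_iff:
  assumes "s \<in> signs" "r \<in> signs" "s' \<in> signs" "r' \<in> signs"
  shows "range (pcurve s r) = range (pcurve s' r') \<longleftrightarrow> s = s' \<and> r = r'"
proof
  assume "range (pcurve s r) = range (pcurve s' r')"
  then have "pcurve s r 0 \<in> range (pcurve s' r')" by auto
  then show "s = s' \<and> r = r'"
    unfolding range_pcurve[OF assms(3,4)] using sgn_pcurve[OF assms(1,2)] by auto
qed auto

lemma closure_band_Q: "r \<in> signs \<Longrightarrow> Q \<inter> closure (band1 r) = closure (band1 r)"
  "s \<in> signs \<Longrightarrow> Q \<inter> closure (band3 s) = closure (band3 s)"
proof -
  assume "r \<in> signs"
  then have "closure (band1 r) \<subseteq> Q" by (intro closure_minimal closed_Q) (auto simp: band1_eq)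
  then show "Q \<inter> closure (band1 r) = closure (band1 r)" by blast
next
  assume "s \<in> signs"
  then have "closure (band3 s) \<subseteq> Q" by (intro closure_minimal closed_Q) (auto simp: band3_eq)
  then show "Q \<inter> closure (band3 s) = closure (band3 s)" by blast
qed

end

theorem theorem2:
  fixes a b c d :: real
  assumes "a > b" and "b > c" and "c > 0" and "d > 0"
  shows "let Q = Q1 a b c d; N = Q1_normal a b c d in
    umbilic_set Q N = {} \<and>
    partially_umbilic_set Q N \<inter> {p. p$4 \<ge> 0} =
      {Q1_param a b c d u v w | u v w.
         (a^2 + d^2) / (a^2 - b^2) * u^2 - (c^2 + d^2) / (b^2 - c^2) * w^2 - 1 = 0 \<and>
         u^2 + w^2 \<ge> 1 \<and> v = 0} \<and>
    (\<exists>P1 P2 P3 P4 W1 W2 W3 W4.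
       distinct [P1, P2, P3, P4] \<and>
       components (partially_umbilic_set Q N) = {P1, P2, P3, P4} \<and>
       (\<forall>P\<in>{P1, P2, P3, P4}. P \<subseteq> P23_set Q N) \<and>
       (\<forall>L\<in>leaves Q N 1. diffeomorphic L (UNIV :: real set)) \<and>
       (\<forall>P\<in>{P1, P2, P3, P4}. type_D1_curve Q N P) \<and>
       {separatrix_surface Q N k P | k P. k \<in> {2, 3} \<and> P \<in> {P1, P2, P3, P4}} =
         {W1, W2, W3, W4} \<and>
       (\<forall>W\<in>{W1, W2, W3, W4}. open_band W) \<and>
       Q \<inter> closure W1 - W1 = P1 \<union> P2 \<and>
       Q \<inter> closure W2 - W2 = P2 \<union> P3 \<and>
       Q \<inter> closure W3 - W3 = P3 \<union> P4 \<and>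
       Q \<inter> closure W4 - W4 = P1 \<union> P4 \<and>
       (\<forall>k\<in>{2, 3}. \<forall>L\<in>leaves Q N k. \<not> L \<subseteq> W1 \<union> W2 \<union> W3 \<union> W4 \<longrightarrow> compact L))"
proof -
  interpret quadric a b c d by unfold_locales fact+
  \<comment> \<open>The numbering runs cyclically through the signs of \<open>(x, z)\<close>:
    neighbouring curves differ in one sign, and the band between them carries the common
    sign.\<close>
  define P1 P2 P3 P4 where P: "P1 = range (pcurve 1 1)" "P2 = range (pcurve (- 1) 1)"
    "P3 = range (pcurve (- 1) (- 1))" "P4 = range (pcurve 1 (- 1))"
  define W1 W2 W3 W4 where W: "W1 = band1 1" "W2 = band3 (- 1)" "W3 = band1 (- 1)" "W4 = band3 1"
  have "distinct [P1, P2, P3, P4]"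
    unfolding P by (simp add: range_pcurve_eq_iff)
  moreover have comp: "components (partially_umbilic_set Q N) = {P1, P2, P3, P4}"
    unfolding components_partially_umbilic P by auto
  moreover have "\<forall>P\<in>{P1, P2, P3, P4}. P \<subseteq> P23_set Q N"
    unfolding P P23_set_Q by (auto simp: range_pcurve)
  moreover have "\<forall>L\<in>leaves Q N 1. diffeomorphic L (UNIV :: real set)"
    using leaves_1_diffeomorphic by blast
  moreover have "\<forall>P\<in>{P1, P2, P3, P4}. type_D1_curve Q N P"
    unfolding P by (simp add: type_D1_curve_pcurve)
  moreover have "{separatrix_surface Q N k P | k P. k \<in> {2, 3} \<and> P \<in> {P1, P2, P3, P4}} = {W1, W2, W3, W4}"
  proof -
    \<comment> \<open>Eight pairs of a foliation and a curve yield four bands, because each band is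
      the separatrix surface at both of its boundary curves.\<close>
    have "{separatrix_surface Q N k P | k P. k \<in> {2, 3} \<and> P \<in> {P1, P2, P3, P4}} =
        separatrix_surface Q N 2 ` {P1, P2, P3, P4} \<union> separatrix_surface Q N 3 ` {P1, P2, P3, P4}"
      by blast
    also have "\<dots> = {W1, W2, W3, W4}"
      unfolding P W by (auto simp: separatrix_surface_2 separatrix_surface_3)
    finally show ?thesis .
  qed
  moreover have "\<forall>W\<in>{W1, W2, W3, W4}. open_band W"
    unfolding W by (simp add: open_band_bands)
  moreover have "Q \<inter> closure W1 - W1 = P1 \<union> P2" "Q \<inter> closure W2 - W2 = P2 \<union> P3"
    "Q \<inter> closure W3 - W3 = P3 \<union> P4" "Q \<inter> closure W4 - W4 = P1 \<union> P4"
    unfolding P W by (simp_all add: closure_band_Q closure_band1 closure_band3 Un_commute)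
  moreover have "\<forall>k\<in>{2, 3}. \<forall>L\<in>leaves Q N k. \<not> L \<subseteq> W1 \<union> W2 \<union> W3 \<union> W4 \<longrightarrow> compact L"
    unfolding W using leaves_2_compact_or_band leaves_3_compact_or_band by blast
  ultimately show ?thesis
    unfolding Let_def using umbilic_set_Q partially_umbilic_param by blast
qed

end
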